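(* Let $n\ge1$, $\mathfrak g=\mathfrak{osp}(2n-1|2n)$ with $f=\sum_{i=1}^{2n-1}F_{i+1,i}$ and $E_{ij}=\frac12(-1)^{p(i)}F_{ij}$ as in the context. Let $\mathcal A$ be the $(4n-1)\times(4n-1)$ matrix with $\mathcal A_{ij}=\delta_{ij}D+\bar E_{ji}$ for $i\le j$ and $\mathcal A_{ij}=-f_{ij}$ for $i>j$, where $f=\sum f_{ij}e_{ij}$ is the matrix of $f$ in $\mathfrak{gl}(2n-1|2n)$. Write $\operatorname{rdet}(\mathcal A)=\sum_{t=0}^{4n-1}w_{4n-1-t}D^t$. Then $w_1,\dots,w_{4n-1}\in\mathcal W(\bar{\mathfrak g},f)$, and $\{w_t:1\le t\le4n-1,\ t\equiv0\text{ or }3\pmod4\}$ freely generates $\mathcal W(\bar{\mathfrak g},f)$ as a differential algebra.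
   Context: $\mathfrak{gl}(2n-1|2n)$: index set $I=\{1,\dots,4n-1\}$, $p(i)=1$ for $i$ odd, $p(i)=0$ for $i$ even; matrix units $e_{ij}$ of parity $p(i)+p(j)$, $[e_{ij},e_{kl}]=\delta_{jk}e_{il}-(-1)^{(p(i)+p(j))(p(k)+p(l))}\delta_{il}e_{kj}$, $\operatorname{str}(\sum a_{ij}e_{ij})=\sum(-1)^{p(i)}a_{ii}$. Put $i'=4n-i$, $\delta_k=1$ if $k\in\{2n+1,2n+3,\dots,4n-1\}$, else $0$. $\theta(e_{ij})=(-1)^{p(i)p(j)+p(j)+1+\delta_i+\delta_j}e_{j'i'}$, $F_{ij}=e_{ij}+\theta(e_{ij})$, $\mathfrak g=\operatorname{span}\{F_{ij}\}\cong\mathfrak{osp}(2n-1|2n)$ with form $(X|Y)=\operatorname{str}(XY)$ and grading $F_{ij}\in\mathfrak g_{(j-i)/2}$; $\mathfrak n=\mathfrak g_{>0}$, $\mathfrak p=\mathfrak g_{\le0}$. For $\mathfrak a$ with even supersymmetric invariant form, $\bar{\mathfrak a}$ is a parity-reversed copy ($p(\bar a)=p(a)+1$); $\mathcal V(\bar{\mathfrak a})=S(\mathbb C[D]\otimes\bar{\mathfrak a})$ is the free supercommutative algebra on $D^m\bar a$ with odd derivation $D$ and SUSY PVA bracket $\{\bar a{}_\chi\bar b\}=(-1)^{p(a)(p(b)+1)}\overline{[a,b]}+\chi(a|b)$ extended by sesquilinearity $\{Dx{}_\chi y\}=-\chi\{x{}_\chi y\}$, $\{x{}_\chi Dy\}=(-1)^{p(x)+1}(D+\chi)\{x{}_\chi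 y\}$ and Leibniz $\{x{}_\chi yz\}=(-1)^{(p(x)+1)p(y)}y\{x{}_\chi z\}+\{x{}_\chi y\}z$; $\chi$ odd, supercommuting with $\mathcal V$, $D\chi+\chi D=-2\chi^2$; $x^{(m)}=D^mx$. $\mathcal V(\bar{\mathfrak p})=S(\mathbb C[D]\otimes\bar{\mathfrak p})$; $\mathfrak J$ = differential ideal of $\mathcal V(\bar{\mathfrak g})$ generated by $\bar n-(f|n)$, $n\in\mathfrak n$; $\mathcal W(\bar{\mathfrak g},f)=\{w\in\mathcal V(\bar{\mathfrak p}):\{\bar n{}_\chi w\}\in\mathbb C[\chi]\otimes\mathfrak J\ \forall n\in\mathfrak n\}$. "Freely generates" means $\mathcal W=\mathbb C[w_t^{(m)}]$ with free supercommutative generators. In $\mathcal V[D]$, $D\,a=D(a)+(-1)^{p(a)}aD$, coefficients on the left. $\operatorname{rdet}(A)=\sum_{\sigma\in S_N}\operatorname{sgn}(\sigma)A_{1\sigma(1)}\cdots A_{N\sigma(N)}$. *)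

theory Defs
  imports Complex_Main "HOL-Library.Multiset" "HOL-Library.Product_Lexorder"
          "HOL-Combinatorics.Permutations"
begin

text \<open>The free supercommutative algebra on a set of generators of type 'g (linearly ordered),
 with parity function par (True = odd).  An element is a coefficient function on monomials
 (multisets of generators); the monomial M stands for the product of its generators taken in
 increasing order.  Elements have finite support and vanish on monomials containing an odd
 generator twice.\<close>

type_synonym 'g sa = "'g multiset \<Rightarrow> complex"

definition valid_mono :: "('g \<Rightarrow> bool) \<Rightarrow> 'g multiset \<Rightarrow> bool" where
  "valid_mono par M \<longleftrightarrow> (\<forall>x. par x \<longrightarrow> count M x \<le> 1)"

definition sa_carrier :: "('g \<Rightarrow> bool) \<Rightarrow> 'g sa set" where
  "sa_carrier par = {f. finite {M. f M \<noteq> 0} \<and> (\<forall>M. f M \<noteq> 0 \<longrightarrow> valid_mono par M)}"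

definition sa_supp :: "'g sa \<Rightarrow> 'g multiset set" where
  "sa_supp f = {M. f M \<noteq> 0}"

text \<open>sign arising when the product of the ordered monomials A and B is reordered\<close>
definition msign :: "('g::linorder \<Rightarrow> bool) \<Rightarrow> 'g multiset \<Rightarrow> 'g multiset \<Rightarrow> complex" where
  "msign par A B = (if valid_mono par (A + B)
     then (-1) ^ card {(x, y). x \<in># A \<and> y \<in># B \<and> par x \<and> par y \<and> y < x} else 0)"

definition sa_mult :: "('g::linorder \<Rightarrow> bool) \<Rightarrow> 'g sa \<Rightarrow> 'g sa \<Rightarrow> 'g sa" where
  "sa_mult par f g = (\<lambda>M. \<Sum>A\<in>{A. A \<subseteq># M}. msign par A (M - A) * f A * g (M - A))"

definition sa_const :: "complex \<Rightarrow> 'g sa" where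
  "sa_const c = (\<lambda>M. if M = {#} then c else 0)"

definition sa_gen :: "'g \<Rightarrow> 'g sa" where
  "sa_gen x = (\<lambda>M. if M = {#x#} then 1 else 0)"

definition sa_add :: "'g sa \<Rightarrow> 'g sa \<Rightarrow> 'g sa" where
  "sa_add f g = (\<lambda>M. f M + g M)"

definition sa_scale :: "complex \<Rightarrow> 'g sa \<Rightarrow> 'g sa" where
  "sa_scale c f = (\<lambda>M. c * f M)"

fun sa_listprod :: "('g::linorder \<Rightarrow> bool) \<Rightarrow> 'g sa list \<Rightarrow> 'g sa" where
  "sa_listprod par [] = sa_const 1"
| "sa_listprod par (f # fs) = sa_mult par f (sa_listprod par fs)"

definition oddcount :: "('g \<Rightarrow> bool) \<Rightarrow> 'g list \<Rightarrow> nat" where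
  "oddcount par ys = length (filter par ys)"

definition sa_sigma :: "('g \<Rightarrow> bool) \<Rightarrow> 'g sa \<Rightarrow> 'g sa" where
  "sa_sigma par f = (\<lambda>M. if odd (size (filter_mset par M)) then - f M else f M)"

text \<open>Extension of an odd derivation given on generators by dgen (D x = generator dgen x),
 via D(y1...yk) = sum_i (-1)^(p(y1)+...+p(y_(i-1))) y1 ... (D yi) ... yk.\<close>
definition sa_D_mono :: "('g::linorder \<Rightarrow> bool) \<Rightarrow> ('g \<Rightarrow> 'g) \<Rightarrow> 'g multiset \<Rightarrow> 'g sa" where
  "sa_D_mono par dgen M = (let ys = sorted_list_of_multiset M in
     (\<lambda>N. \<Sum>i<length ys. (-1) ^ oddcount par (take i ys) *
        sa_listprod par (map sa_gen (ys[i := dgen (ys ! i)])) N))"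

definition sa_D :: "('g::linorder \<Rightarrow> bool) \<Rightarrow> ('g \<Rightarrow> 'g) \<Rightarrow> 'g sa \<Rightarrow> 'g sa" where
  "sa_D par dgen f = (\<lambda>N. \<Sum>M\<in>sa_supp f. f M * sa_D_mono par dgen M N)"

type_synonym mat = "nat \<Rightarrow> nat \<Rightarrow> complex"

definition NN :: "nat \<Rightarrow> nat" where "NN n = 4 * n - 1"

definition Iset :: "nat \<Rightarrow> nat set" where "Iset n = {1..NN n}"

definition pp :: "nat \<Rightarrow> nat" where "pp i = i mod 2"

definition prm :: "nat \<Rightarrow> nat \<Rightarrow> nat" where "prm n i = 4 * n - i"

definition dlt :: "nat \<Rightarrow> nat \<Rightarrow> nat" where
  "dlt n k = (if 2 * n + 1 \<le> k \<and> k \<le> 4 * n - 1 \<and> odd k then 1 else 0)"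

definition th_sign :: "nat \<Rightarrow> nat \<Rightarrow> nat \<Rightarrow> complex" where
  "th_sign n i j = (-1) ^ (pp i * pp j + pp j + 1 + dlt n i + dlt n j)"

definition emat :: "nat \<Rightarrow> nat \<Rightarrow> mat" where
  "emat i j = (\<lambda>k l. if k = i \<and> l = j then 1 else 0)"

definition Fm :: "nat \<Rightarrow> nat \<Rightarrow> nat \<Rightarrow> mat" where
  "Fm n i j = (\<lambda>k l. emat i j k l + th_sign n i j * emat (prm n j) (prm n i) k l)"

definition mmul :: "nat \<Rightarrow> mat \<Rightarrow> mat \<Rightarrow> mat" where
  "mmul n X Y = (\<lambda>i j. \<Sum>k\<in>Iset n. X i k * Y k j)"

definition str :: "nat \<Rightarrow> mat \<Rightarrow> complex" where
  "str n X = (\<Sum>i\<in>Iset n. (-1) ^ pp i * X i i)"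

definition sbr :: "nat \<Rightarrow> mat \<Rightarrow> mat \<Rightarrow> nat \<Rightarrow> nat \<Rightarrow> mat" where
  "sbr n X Y a b = (\<lambda>i j. mmul n X Y i j - (-1) ^ (a * b) * mmul n Y X i j)"

text \<open>A basis of g: F_ij with i+j<4n, and F_(i,i') when it is nonzero.
 (For i+j>4n, F_ij = +-F_(j',i').)\<close>
definition Bas :: "nat \<Rightarrow> (nat \<times> nat) set" where
  "Bas n = {(i, j). i \<in> Iset n \<and> j \<in> Iset n \<and>
      (i + j < 4 * n \<or> (i + j = 4 * n \<and> th_sign n i j = 1))}"

text \<open>coordinate of an element X of g along the basis vector F_a\<close>
definition coord :: "nat \<Rightarrow> mat \<Rightarrow> nat \<times> nat \<Rightarrow> complex" where
  "coord n X a = (case a of (i, j) \<Rightarrow> if i + j < 4 * n then X i j else X i j / 2)"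

definition bpar :: "nat \<times> nat \<Rightarrow> nat" where
  "bpar a = (case a of (i, j) \<Rightarrow> (pp i + pp j) mod 2)"

definition Fb :: "nat \<Rightarrow> nat \<times> nat \<Rightarrow> mat" where
  "Fb n a = (case a of (i, j) \<Rightarrow> Fm n i j)"

text \<open>n = g_{>0} is spanned by the basis vectors F_ij with j > i; p = g_{<=0} by those with j <= i.\<close>
definition Bas_n :: "nat \<Rightarrow> (nat \<times> nat) set" where
  "Bas_n n = {a \<in> Bas n. fst a < snd a}"

definition Bas_p :: "nat \<Rightarrow> (nat \<times> nat) set" where
  "Bas_p n = {a \<in> Bas n. snd a \<le> fst a}"

definition fmat :: "nat \<Rightarrow> mat" where
  "fmat n = (\<lambda>k l. \<Sum>i\<in>{1..2*n-1}. Fm n (i + 1) i k l)"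

definition Emat :: "nat \<Rightarrow> nat \<Rightarrow> nat \<Rightarrow> mat" where
  "Emat n i j = (\<lambda>k l. (1/2) * (-1) ^ pp i * Fm n i j k l)"

text \<open>Generators (m, a) stand for D^m bar(F_a), a in Bas n; parity p(a)+1+m.\<close>
type_synonym gen = "nat \<times> nat \<times> nat"

definition gpar :: "gen \<Rightarrow> bool" where
  "gpar x = (case x of (m, a) \<Rightarrow> odd (bpar a + 1 + m))"

definition gD :: "gen \<Rightarrow> gen" where
  "gD x = (case x of (m, a) \<Rightarrow> (Suc m, a))"

definition Vg :: "nat \<Rightarrow> gen sa set" where
  "Vg n = {f \<in> sa_carrier gpar. \<forall>M. f M \<noteq> 0 \<longrightarrow> (\<forall>x\<in>#M. snd x \<in> Bas n)}"

definition Vp :: "nat \<Rightarrow> gen sa set" where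
  "Vp n = {f \<in> sa_carrier gpar. \<forall>M. f M \<noteq> 0 \<longrightarrow> (\<forall>x\<in>#M. snd x \<in> Bas_p n)}"

definition VD :: "gen sa \<Rightarrow> gen sa" where "VD = sa_D gpar gD"

definition Vmult :: "gen sa \<Rightarrow> gen sa \<Rightarrow> gen sa" where "Vmult = sa_mult gpar"

definition barV :: "nat \<Rightarrow> mat \<Rightarrow> gen sa" where
  "barV n X = (\<lambda>M. \<Sum>a\<in>Bas n. coord n X a * sa_gen (0, a) M)"

text \<open>Elements of C[chi] (x) V, written sum_k chi^k c_k, represented by k |-> c_k.\<close>
type_synonym chiV = "nat \<Rightarrow> gen sa"

text \<open>chi-bracket of generators: {bar a _chi bar b} = (-1)^(p(a)(p(b)+1)) bar[a,b] + chi (a|b)\<close>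
definition genbr :: "nat \<Rightarrow> nat \<times> nat \<Rightarrow> nat \<times> nat \<Rightarrow> chiV" where
  "genbr n a b = (\<lambda>k. if k = 0 then sa_scale ((-1) ^ (bpar a * (bpar b + 1)))
                             (barV n (sbr n (Fb n a) (Fb n b) (bpar a) (bpar b)))
                     else if k = 1 then sa_const (str n (mmul n (Fb n a) (Fb n b)))
                     else (\<lambda>_. 0))"

text \<open>D acting on C[chi] (x) V, using D chi + chi D = -2 chi^2 (hence D chi^2 = chi^2 D):
 D(chi^k c) = chi^k D c for k even, D(chi^k c) = - chi^k D c - 2 chi^(k+1) c for k odd.\<close>
definition chiD :: "chiV \<Rightarrow> chiV" where
  "chiD P = (\<lambda>k. sa_add (if even k then VD (P k) else sa_scale (-1) (VD (P k)))
                       (if k \<ge> 1 \<and> odd (k - 1) then sa_scale (-2) (P (k - 1)) else (\<lambda>_. 0)))"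

definition chimul :: "chiV \<Rightarrow> chiV" where
  "chimul P = (\<lambda>k. if k = 0 then (\<lambda>_. 0) else P (k - 1))"

text \<open>{x _chi D y} = (-1)^(p(x)+1) (D + chi) {x _chi y}, with x = bar a, p(x) = p(a)+1\<close>
definition stepop :: "nat \<times> nat \<Rightarrow> chiV \<Rightarrow> chiV" where
  "stepop a P = (\<lambda>k. sa_scale ((-1) ^ bpar a) (sa_add (chiD P k) (chimul P k)))"

definition brgen :: "nat \<Rightarrow> nat \<times> nat \<Rightarrow> gen \<Rightarrow> chiV" where
  "brgen n a y = (case y of (m, b) \<Rightarrow> (stepop a ^^ m) (genbr n a b))"

text \<open>Leibniz rule on a monomial y1...yk:
 {x _chi y1...yk} = sum_i (-1)^((p(x)+1)(p(y1)+...+p(y_(i-1)))) y1...y_(i-1) {x _chi yi} y_(i+1)...yk,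
 where moving y1...y_(i-1) past chi^k gives (-1)^(k(p(y1)+...+p(y_(i-1)))).\<close>
definition brmono :: "nat \<Rightarrow> nat \<times> nat \<Rightarrow> gen multiset \<Rightarrow> chiV" where
  "brmono n a M = (let ys = sorted_list_of_multiset M in
     (\<lambda>k N. \<Sum>i<length ys. (-1) ^ ((bpar a + k) * oddcount gpar (take i ys)) *
        sa_listprod gpar [sa_listprod gpar (map sa_gen (take i ys)),
                          brgen n a (ys ! i) k,
                          sa_listprod gpar (map sa_gen (drop (Suc i) ys))] N))"

definition brV :: "nat \<Rightarrow> nat \<times> nat \<Rightarrow> gen sa \<Rightarrow> chiV" where
  "brV n a w = (\<lambda>k N. \<Sum>M\<in>sa_supp w. w M * brmono n a M k N)"

definition is_diff_ideal :: "nat \<Rightarrow> gen sa set \<Rightarrow> bool" where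
  "is_diff_ideal n S \<longleftrightarrow> S \<subseteq> Vg n \<and> (\<forall>x\<in>S. \<forall>y\<in>S. sa_add x y \<in> S)
     \<and> (\<forall>x\<in>S. \<forall>v\<in>Vg n. Vmult v x \<in> S) \<and> (\<forall>x\<in>S. VD x \<in> S)"

text \<open>J: generated by bar n - (f|n), n in n (it suffices to take the basis of n)\<close>
definition Jgens :: "nat \<Rightarrow> gen sa set" where
  "Jgens n = {sa_add (sa_gen (0, a)) (sa_const (- str n (mmul n (fmat n) (Fb n a)))) | a. a \<in> Bas_n n}"

definition Jid :: "nat \<Rightarrow> gen sa set" where
  "Jid n = \<Inter>{S. is_diff_ideal n S \<and> Jgens n \<subseteq> S}"

definition Walg :: "nat \<Rightarrow> gen sa set" where
  "Walg n = {w \<in> Vp n. \<forall>a\<in>Bas_n n. \<forall>k. brV n a w k \<in> Jid n}"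

text \<open>sum_t c_t D^t represented by t |-> c_t (coefficients on the left)\<close>
type_synonym dop = "nat \<Rightarrow> gen sa"

text \<open>D (c D^t) = D(c) D^t + sigma(c) D^(t+1)  (from D a = D(a) + (-1)^p(a) a D)\<close>
definition dop_Dleft :: "dop \<Rightarrow> dop" where
  "dop_Dleft P = (\<lambda>t. sa_add (VD (P t)) (if t \<ge> 1 then sa_sigma gpar (P (t - 1)) else (\<lambda>_. 0)))"

definition dop_supp :: "dop \<Rightarrow> nat set" where
  "dop_supp P = {s. P s \<noteq> (\<lambda>_. 0)}"

definition dop_mult :: "dop \<Rightarrow> dop \<Rightarrow> dop" where
  "dop_mult P Q = (\<lambda>t N. \<Sum>s\<in>dop_supp P. Vmult (P s) ((dop_Dleft ^^ s) Q t) N)"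

fun dop_listprod :: "dop list \<Rightarrow> dop" where
  "dop_listprod [] = (\<lambda>t. if t = 0 then sa_const 1 else (\<lambda>_. 0))"
| "dop_listprod (P # Ps) = dop_mult P (dop_listprod Ps)"

definition dop_const :: "gen sa \<Rightarrow> dop" where
  "dop_const c = (\<lambda>t. if t = 0 then c else (\<lambda>_. 0))"

definition dop_D :: dop where
  "dop_D = (\<lambda>t. if t = 1 then sa_const 1 else (\<lambda>_. 0))"

definition dop_add :: "dop \<Rightarrow> dop \<Rightarrow> dop" where
  "dop_add P Q = (\<lambda>t. sa_add (P t) (Q t))"

definition Amat :: "nat \<Rightarrow> nat \<Rightarrow> nat \<Rightarrow> dop" where
  "Amat n i j = (if i \<le> j
     then dop_add (if i = j then dop_D else (\<lambda>_ _. 0)) (dop_const (barV n (Emat n j i)))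
     else dop_const (sa_const (- fmat n i j)))"

definition rdet :: "nat \<Rightarrow> (nat \<Rightarrow> nat \<Rightarrow> dop) \<Rightarrow> dop" where
  "rdet N A = (\<lambda>t M. \<Sum>\<sigma>\<in>{\<sigma>. \<sigma> permutes {1..N}}.
      of_int (sign \<sigma>) * dop_listprod (map (\<lambda>i. A i (\<sigma> i)) [1..<N+1]) t M)"

definition wgen :: "nat \<Rightarrow> nat \<Rightarrow> gen sa" where
  "wgen n k = rdet (NN n) (Amat n) (NN n - k)"

definition Tset :: "nat \<Rightarrow> nat set" where
  "Tset n = {t. 1 \<le> t \<and> t \<le> NN n \<and> (t mod 4 = 0 \<or> t mod 4 = 3)}"

text \<open>Symbols (t, m) standing for w_t^(m); parity t + m (w_t has parity t mod 2).\<close>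
definition spar :: "nat \<times> nat \<Rightarrow> bool" where
  "spar x = (case x of (t, m) \<Rightarrow> odd (t + m))"

definition FreeW :: "nat \<Rightarrow> (nat \<times> nat) sa set" where
  "FreeW n = {\<phi> \<in> sa_carrier spar. \<forall>M. \<phi> M \<noteq> 0 \<longrightarrow> (\<forall>x\<in>#M. fst x \<in> Tset n)}"

definition evalW :: "nat \<Rightarrow> (nat \<times> nat) sa \<Rightarrow> gen sa" where
  "evalW n \<phi> = (\<lambda>N. \<Sum>M\<in>sa_supp \<phi>. \<phi> M *
      sa_listprod gpar (map (\<lambda>(t, m). (VD ^^ m) (wgen n t)) (sorted_list_of_multiset M)) N)"

definition freely_generates :: "nat \<Rightarrow> bool" where
  "freely_generates n \<longleftrightarrow> inj_on (evalW n) (FreeW n) \<and> evalW n ` FreeW n = Walg n"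

end

theory Submission
  imports Defs
begin

text \<open>Replacing \<open>\<chi>\<close> by a free test variable \<open>\<epsilon>\<close> turns the bracket with an element of \<open>n\<close> into an even derivation
 commuting with \<open>D\<close>; modulo the ideal it acts on the matrix \<open>A\<close> as an infinitesimal gauge transformation
 \<open>A X - Y A\<close> with \<open>X\<close> and \<open>Y\<close> strictly upper triangular.  As \<open>A\<close> is a Hessenberg matrix, its row determinant
 arises by eliminating all unknowns but the last one from \<open>A \<phi>\<close>, hence is gauge invariant.

 For the free generation, restrict to the slice on which only the variables \<open>a\<^sub>t = F\<^sub>t\<^sub>1\<close>, \<open>t\<close> congruent to 0 or 3
 modulo 4, and their derivatives survive.  The part of the gauge derivations of lowest degree has constant
 coefficients and is triangular in the other variables, so the restriction is injective on the W-algebra.  By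
 conformal weight, \<open>w\<^sub>t\<close> restricts to a nonzero multiple of \<open>a\<^sub>t\<close> plus terms in the \<open>a\<^sub>s\<close> with \<open>s < t\<close>, so the monomials
 in the \<open>D\<^sup>m w\<^sub>t\<close> restrict to a basis.\<close>

subsection \<open>The free supercommutative algebra as a ring\<close>

text \<open>Freeness of W is not imported from a structure theorem. Given w in W, the triangular
  form of the restricted monomials yields a polynomial in the D^m w_t with the same restriction to
  the slice; the difference again lies in W and restricts to 0, so it vanishes. Signs are the main
  obstacle, and the test variables remove it: \<open>eps\<close> has the parity that makes the
  derivation even, so it passes products and \<open>D\<close> without signs, and the relation
  between chi and D becomes \<open>D\<close> acting on a free variable. Likewise the differential
  operators are studied through their action on a free even variable \<open>psi\<close>, from whose
  derivatives the coefficients are read off. The residues 0 and 3 modulo 4 come from theta on the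
  antidiagonal: F_{i,i'} is nonzero exactly for odd i, and this decides which variables the gauge
  derivations can reach.\<close>

lemma finite_subsets_mset: "finite {A. A \<subseteq># (M :: 'a multiset)}"
proof (induction M)
  case empty
  have "{A. A \<subseteq># ({#} :: 'a multiset)} = {{#}}" by auto
  then show ?case by simp
next
  case (add x M)
  have "{A. A \<subseteq># add_mset x M} \<subseteq> {A. A \<subseteq># M} \<union> add_mset x ` {A. A \<subseteq># M}"
  proof
    fix A assume "A \<in> {A. A \<subseteq># add_mset x M}"
    then have A: "A \<subseteq># add_mset x M" by simp
    show "A \<in> {A. A \<subseteq># M} \<union> add_mset x ` {A. A \<subseteq># M}"
    proof (cases "x \<in># A")
      case True
      then obtain B where "A = add_mset x B" by (metis mset_add)
      with A show ?thesis by auto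
    next
      case False
      then have "A \<subseteq># M"
        using A by (metis (no_types, lifting) add_mset_diff_bothsides diff_single_trivial subset_eq_diff_conv add_mset_add_single)
      then show ?thesis by simp
    qed
  qed
  then show ?case using add by (meson finite_UnI finite_imageI finite_subset)
qed

section \<open>Signs of reordering monomials\<close>

lemma valid_mono_subset: "valid_mono par M \<Longrightarrow> A \<subseteq># M \<Longrightarrow> valid_mono par A"
  unfolding valid_mono_def by (meson le_trans mset_subset_eq_count)

lemma valid_mono_add_left: "valid_mono par (A + B) \<Longrightarrow> valid_mono par A"
  and valid_mono_add_right: "valid_mono par (A + B) \<Longrightarrow> valid_mono par B"
  by (auto intro: valid_mono_subset)

lemma valid_mono_disjoint:
  assumes "valid_mono par (A + B)" "x \<in># A" "x \<in># B" "par x"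
  shows False
proof -
  have "count (A + B) x \<ge> 2"
    using assms(2,3) by (metis count_greater_eq_one_iff count_union one_add_one add_mono)
  with assms show False unfolding valid_mono_def by fastforce
qed

definition inv_pairs :: "('g::linorder \<Rightarrow> bool) \<Rightarrow> 'g multiset \<Rightarrow> 'g multiset \<Rightarrow> ('g \<times> 'g) set" where
  "inv_pairs par A B = {(x, y). x \<in># A \<and> y \<in># B \<and> par x \<and> par y \<and> y < x}"

lemma msign_inv: "msign par A B = (if valid_mono par (A + B) then (-1) ^ card (inv_pairs par A B) else 0)"
  by (simp add: msign_def inv_pairs_def)

lemma finite_inv_pairs [simp]: "finite (inv_pairs par A B)"
  by (rule finite_subset[of _ "set_mset A \<times> set_mset B"]) (auto simp: inv_pairs_def)

lemma inv_pairs_add_right: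
  assumes "valid_mono par (B + C)"
  shows "card (inv_pairs par A (B + C)) = card (inv_pairs par A B) + card (inv_pairs par A C)"
proof -
  have "inv_pairs par A (B + C) = inv_pairs par A B \<union> inv_pairs par A C"
    by (auto simp: inv_pairs_def)
  moreover have "inv_pairs par A B \<inter> inv_pairs par A C = {}"
    using valid_mono_disjoint[OF assms] by (auto simp: inv_pairs_def)
  ultimately show ?thesis by (simp add: card_Un_disjoint)
qed

lemma inv_pairs_add_left:
  assumes "valid_mono par (A + B)"
  shows "card (inv_pairs par (A + B) C) = card (inv_pairs par A C) + card (inv_pairs par B C)"
proof -
  have "inv_pairs par (A + B) C = inv_pairs par A C \<union> inv_pairs par B C"
    by (auto simp: inv_pairs_def)
  moreover have "inv_pairs par A C \<inter> inv_pairs par B C = {}"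
    using valid_mono_disjoint[OF assms] by (auto simp: inv_pairs_def)
  ultimately show ?thesis by (simp add: card_Un_disjoint)
qed

text \<open>Both sides count the odd inversions met when three ordered monomials are merged; a
  repeated odd generator makes both 0. Associativity of the product reduces to this.\<close>

lemma msign_cocycle: "msign par A (B + C) * msign par B C = msign par (A + B) C * msign par A B"
proof (cases "valid_mono par (A + B + C)")
  case True
  then have v: "valid_mono par (A + B)" "valid_mono par (B + C)"
    by (metis add.assoc valid_mono_add_left valid_mono_add_right)+
  with True show ?thesis
    by (simp add: msign_inv inv_pairs_add_left inv_pairs_add_right power_add add.assoc)
qed (simp add: msign_inv add.assoc)

lemma msign_empty [simp]:
  "msign par {#} A = (if valid_mono par A then 1 else 0)"
  "msign par A {#} = (if valid_mono par A then 1 else 0)"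
  by (auto simp: msign_inv inv_pairs_def)

text \<open>Validity makes the odd part of a multiset a set, so counting with and without
  multiplicity agrees.\<close>

lemma card_odd_set:
  assumes "valid_mono par A"
  shows "card {x. x \<in># A \<and> par x} = size (filter_mset par A)"
proof -
  have "mset_set (set_mset (filter_mset par A)) = filter_mset par A"
  proof (rule multiset_eqI)
    fix x
    show "count (mset_set (set_mset (filter_mset par A))) x = count (filter_mset par A) x"
    proof (cases "x \<in># filter_mset par A")
      case True
      then have "par x" "count A x \<le> 1" "x \<in># A" using assms by (auto simp: valid_mono_def)
      moreover from this have "count A x = 1"
        by (metis count_greater_eq_one_iff le_antisym)
      ultimately show ?thesis using True by simp
    qed (auto simp: count_eq_zero_iff)
  qed
  then have "size (filter_mset par A) = card (set_mset (filter_mset par A))"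
    by (metis size_mset_set)
  then show ?thesis by (simp add: Collect_conj_eq)
qed

text \<open>A pair of odd generators, one from each monomial, is inverted in exactly one of the two
  orders, so the two inversion numbers add up to the product of the odd sizes.\<close>

lemma msign_swap:
  "msign par A B = (-1) ^ (size (filter_mset par A) * size (filter_mset par B)) * msign par B A"
proof (cases "valid_mono par (A + B)")
  case True
  define SA where "SA = {x. x \<in># A \<and> par x}"
  define SB where "SB = {x. x \<in># B \<and> par x}"
  have "SA \<times> SB = inv_pairs par A B \<union> prod.swap ` inv_pairs par B A"
    using valid_mono_disjoint[OF True]
    by (force simp: inv_pairs_def SA_def SB_def image_iff not_less_iff_gr_or_eq)
  moreover have "inv_pairs par A B \<inter> prod.swap ` inv_pairs par B A = {}"
    by (auto simp: inv_pairs_def)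
  ultimately have "card (SA \<times> SB) = card (inv_pairs par A B) + card (inv_pairs par B A)"
    by (simp add: card_Un_disjoint card_image)
  moreover have "card (SA \<times> SB) = size (filter_mset par A) * size (filter_mset par B)"
    using True card_odd_set valid_mono_add_left valid_mono_add_right
    unfolding SA_def SB_def by (metis card_cartesian_product)
  ultimately have e: "size (filter_mset par A) * size (filter_mset par B)
      = card (inv_pairs par A B) + card (inv_pairs par B A)" by simp
  have "(-1::complex) ^ (k + l) * (-1) ^ l = (-1) ^ k" for k l :: nat
    by (simp add: power_add mult.assoc flip: power_mult_distrib)
  then show ?thesis using True by (simp add: msign_inv e add.commute)
qed (simp add: msign_inv add.commute)

lemma sa_mult_carrier:
  assumes "f \<in> sa_carrier par" "g \<in> sa_carrier par"
  shows "sa_mult par f g \<in> sa_carrier par"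
proof -
  have ex: "\<exists>A. A \<subseteq># M \<and> msign par A (M - A) * f A * g (M - A) \<noteq> 0" if "sa_mult par f g M \<noteq> 0" for M
    using that unfolding sa_mult_def by (metis (mono_tags, lifting) mem_Collect_eq sum.neutral)
  have "{M. sa_mult par f g M \<noteq> 0} \<subseteq> (\<lambda>(A, B). A + B) ` ({M. f M \<noteq> 0} \<times> {M. g M \<noteq> 0})"
  proof
    fix M assume "M \<in> {M. sa_mult par f g M \<noteq> 0}"
    with ex obtain A where "A \<subseteq># M" "f A \<noteq> 0" "g (M - A) \<noteq> 0" by fastforce
    then show "M \<in> (\<lambda>(A, B). A + B) ` ({M. f M \<noteq> 0} \<times> {M. g M \<noteq> 0})"
      by (intro image_eqI[of _ _ "(A, M - A)"]) auto
  qed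
  moreover have "finite ((\<lambda>(A, B). A + B) ` ({M. f M \<noteq> 0} \<times> {M. g M \<noteq> 0}))"
    using assms by (auto simp: sa_carrier_def)
  moreover have "valid_mono par M" if M: "sa_mult par f g M \<noteq> 0" for M
  proof -
    obtain A where "A \<subseteq># M" "msign par A (M - A) \<noteq> 0" using ex[OF M] by force
    then show ?thesis by (auto simp: msign_def split: if_splits)
  qed
  ultimately show ?thesis unfolding sa_carrier_def by (auto intro: finite_subset)
qed

lemma sa_mult_assoc: "sa_mult par (sa_mult par f g) h = sa_mult par f (sa_mult par g h)"
proof
  fix M
  let ?t = "\<lambda>A B C. msign par A (B + C) * msign par B C * f A * g B * h C"
  have "sa_mult par f (sa_mult par g h) M
      = (\<Sum>A\<in>{A. A \<subseteq># M}. \<Sum>B\<in>{B. B \<subseteq># M - A}. ?t A B (M - A - B))"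
    unfolding sa_mult_def sum_distrib_left
  proof (intro sum.cong refl)
    fix A B assume "A \<in> {A. A \<subseteq># M}" "B \<in> {B. B \<subseteq># M - A}"
    then have "B + (M - A - B) = M - A" by (metis mem_Collect_eq subset_mset.add_diff_inverse)
    then show "msign par A (M - A) * f A * (msign par B (M - A - B) * g B * h (M - A - B))
        = ?t A B (M - A - B)" by (simp add: mult_ac del: diff_diff_add)
  qed
  also have "\<dots> = (\<Sum>(A, B)\<in>Sigma {A. A \<subseteq># M} (\<lambda>A. {B. B \<subseteq># M - A}). ?t A B (M - A - B))"
    by (simp add: sum.Sigma finite_subsets_mset)
  \<comment> \<open>Both iterated products sum over the splittings of \<open>M\<close> into three
    blocks; \<open>C\<close> is the union of the first two.\<close>
  also have "\<dots> = (\<Sum>(C, A)\<in>Sigma {C. C \<subseteq># M} (\<lambda>C. {A. A \<subseteq># C}). ?t A (C - A) (M - C))"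
  proof (rule sum.reindex_bij_witness[of _ "\<lambda>(C, A). (A, C - A)" "\<lambda>(A, B). (A + B, A)"], goal_cases)
    case (1 a)
    then show ?case by auto
  next
    case (2 a)
    then obtain A B where a: "a = (A, B)" "A \<subseteq># M" "B \<subseteq># M - A" by auto
    then have "A + B \<subseteq># A + (M - A)" by (intro subset_mset.add_left_mono)
    with a show ?case by simp
  next
    case (3 b)
    then show ?case by auto
  next
    case (4 b)
    then obtain C A where b: "b = (C, A)" "C \<subseteq># M" "A \<subseteq># C" by auto
    then have "A \<subseteq># M" by (metis subset_mset.order_trans)
    moreover have "C - A \<subseteq># M - A"
      using b by (auto simp: subseteq_mset_def diff_le_mono)
    ultimately show ?case using b by simp
  next
    case (5 a)
    then show ?case by auto
  qed
  also have "\<dots> = (\<Sum>C\<in>{C. C \<subseteq># M}. \<Sum>A\<in>{A. A \<subseteq># C}. ?t A (C - A) (M - C))"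
    by (intro sum.Sigma[symmetric] ballI finite_subsets_mset)
  also have "\<dots> = sa_mult par (sa_mult par f g) h M"
    unfolding sa_mult_def sum_distrib_left sum_distrib_right
  proof (intro sum.cong refl)
    fix C A assume "C \<in> {C. C \<subseteq># M}" "A \<in> {A. A \<subseteq># C}"
    then show "?t A (C - A) (M - C) =
        msign par C (M - C) * (msign par A (C - A) * f A * g (C - A)) * h (M - C)"
      using msign_cocycle[of par A "C - A" "M - C"] by (simp add: mult_ac)
  qed
  finally show "sa_mult par (sa_mult par f g) h M = sa_mult par f (sa_mult par g h) M" by simp
qed

lemma sa_mult_const_left:
  assumes "f \<in> sa_carrier par" shows "sa_mult par (sa_const c) f = (\<lambda>M. c * f M)"
proof
  fix M
  have "sa_mult par (sa_const c) f M
      = (\<Sum>A\<in>{{#}}. msign par A (M - A) * sa_const c A * f (M - A))"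
    unfolding sa_mult_def
    by (rule sum.mono_neutral_right) (auto simp: sa_const_def finite_subsets_mset)
  then show "sa_mult par (sa_const c) f M = c * f M"
    using assms by (auto simp: sa_const_def sa_carrier_def)
qed

lemma sa_mult_const_right:
  assumes "f \<in> sa_carrier par" shows "sa_mult par f (sa_const c) = (\<lambda>M. c * f M)"
proof
  fix M
  have "sa_mult par f (sa_const c) M
      = (\<Sum>A\<in>{M}. msign par A (M - A) * f A * sa_const c (M - A))"
    unfolding sa_mult_def
    by (rule sum.mono_neutral_right) (auto simp: sa_const_def finite_subsets_mset, metis subset_mset.diff_add add.left_neutral)
  then show "sa_mult par f (sa_const c) M = c * f M"
    using assms by (auto simp: sa_const_def sa_carrier_def)
qed

lemma sa_const_carrier [simp]: "sa_const c \<in> sa_carrier par"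
  by (auto simp: sa_carrier_def sa_const_def valid_mono_def intro: finite_subset[of _ "{{#}}"])

lemma sa_zero_carrier [simp]: "(\<lambda>_. 0) \<in> sa_carrier par"
  by (auto simp: sa_carrier_def)

lemma sa_add_carrier:
  assumes "f \<in> sa_carrier par" "g \<in> sa_carrier par"
  shows "(\<lambda>M. f M + g M) \<in> sa_carrier par"
proof -
  have "{M. f M + g M \<noteq> 0} \<subseteq> {M. f M \<noteq> 0} \<union> {M. g M \<noteq> 0}" by auto
  moreover have "valid_mono par M" if "f M + g M \<noteq> 0" for M
    using that assms by (cases "f M = 0") (auto simp: sa_carrier_def)
  ultimately show ?thesis using assms by (auto simp: sa_carrier_def intro: finite_subset)
qed

lemma sa_uminus_carrier: "f \<in> sa_carrier par \<Longrightarrow> (\<lambda>M. - f M) \<in> sa_carrier par"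
  by (auto simp: sa_carrier_def)

typedef supalg = "sa_carrier gpar :: gen sa set"
  morphisms cf Abs_supalg
  by (rule exI[of _ "\<lambda>_. 0"]) simp

setup_lifting type_definition_supalg

instantiation supalg :: ring_1
begin

lift_definition zero_supalg :: supalg is "\<lambda>_. 0" by simp
lift_definition one_supalg :: supalg is "sa_const 1" by simp
lift_definition plus_supalg :: "supalg \<Rightarrow> supalg \<Rightarrow> supalg" is "\<lambda>f g M. f M + g M"
  by (rule sa_add_carrier)
lift_definition uminus_supalg :: "supalg \<Rightarrow> supalg" is "\<lambda>f M. - f M"
  by (rule sa_uminus_carrier)
lift_definition minus_supalg :: "supalg \<Rightarrow> supalg \<Rightarrow> supalg" is "\<lambda>f g M. f M - g M"
  using sa_add_carrier sa_uminus_carrier by fastforce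
lift_definition times_supalg :: "supalg \<Rightarrow> supalg \<Rightarrow> supalg" is "sa_mult gpar"
  by (rule sa_mult_carrier)

instance
proof
  fix a b c :: supalg
  show "a * b * c = a * (b * c)" by transfer (rule sa_mult_assoc)
  show "1 * a = a" by transfer (simp add: sa_mult_const_left)
  show "a * 1 = a" by transfer (simp add: sa_mult_const_right)
  show "a + b + c = a + (b + c)" by transfer (simp add: add.assoc)
  show "a + b = b + a" by transfer (simp add: add.commute)
  show "0 + a = a" by transfer simp
  show "- a + a = 0" by transfer simp
  show "a - b = a + - b" by transfer simp
  show "(a + b) * c = a * c + b * c"
    by transfer (simp add: sa_mult_def fun_eq_iff algebra_simps sum.distrib)
  show "a * (b + c) = a * b + a * c"
    by transfer (simp add: sa_mult_def fun_eq_iff algebra_simps sum.distrib)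
  show "(0::supalg) \<noteq> 1"
    by transfer (metis sa_const_def zero_neq_one)
qed

end

lemma supalg_eqI: "(\<And>M. cf x M = cf y M) \<Longrightarrow> x = y"
  by (metis cf_inject ext)

lemma cf_zero [simp]: "cf 0 M = 0" by transfer simp
lemma cf_add [simp]: "cf (x + y) M = cf x M + cf y M" by transfer simp
lemma cf_uminus [simp]: "cf (- x) M = - cf x M" by transfer simp
lemma cf_diff [simp]: "cf (x - y) M = cf x M - cf y M" by transfer simp
lemma cf_one: "cf 1 M = (if M = {#} then 1 else 0)" by transfer (simp add: sa_const_def)
lemma cf_sum [simp]: "cf (\<Sum>i\<in>I. f i) M = (\<Sum>i\<in>I. cf (f i) M)"
  by (induction I rule: infinite_finite_induct) auto
lemma cf_mult: "cf (x * y) M = (\<Sum>A\<in>{A. A \<subseteq># M}. msign gpar A (M - A) * cf x A * cf y (M - A))"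
  by transfer (simp add: sa_mult_def)
lemma finite_cf [simp]: "finite {M. cf x M \<noteq> 0}" by transfer (simp add: sa_carrier_def)
lemma cf_valid: "cf x M \<noteq> 0 \<Longrightarrow> valid_mono gpar M" by transfer (simp add: sa_carrier_def)

lift_definition K :: "complex \<Rightarrow> supalg" is sa_const by simp

lemma cf_K: "cf (K c) M = (if M = {#} then c else 0)" by transfer (simp add: sa_const_def)

definition sc :: "complex \<Rightarrow> supalg \<Rightarrow> supalg" where "sc c x = K c * x"

lemma cf_sc [simp]: "cf (sc c x) M = c * cf x M"
  unfolding sc_def by transfer (simp add: sa_mult_const_left)

lemma cf_mult_K [simp]: "cf (x * K c) M = c * cf x M"
  by transfer (simp add: sa_mult_const_right)

lemma K_0 [simp]: "K 0 = 0" and K_1 [simp]: "K 1 = 1"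
  by (auto intro!: supalg_eqI simp: cf_K cf_one)

lemma K_add: "K (a + b) = K a + K b" and K_uminus: "K (- a) = - K a"
  by (auto intro!: supalg_eqI simp: cf_K)

lemma K_sum: "K (\<Sum>i\<in>I. f i) = (\<Sum>i\<in>I. K (f i))"
  by (induction I rule: infinite_finite_induct) (auto simp: K_add)

lemma sc_mult_left [simp]: "sc c x * y = sc c (x * y)"
  by (simp add: sc_def mult.assoc)

lemma sc_mult_right [simp]: "x * sc c y = sc c (x * y)"
proof -
  have "x * K c = K c * x" by (rule supalg_eqI) (simp add: sc_def[symmetric])
  then show ?thesis by (simp add: sc_def flip: mult.assoc)
qed

lemma K_mult_left [simp]: "K c * x = sc c x" and K_mult_right [simp]: "x * K c = sc c x"
  by (auto intro: supalg_eqI simp: sc_def[symmetric])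

lemma sc_sc [simp]: "sc a (sc b x) = sc (a * b) x"
  and sc_add [simp]: "sc a (x + y) = sc a x + sc a y"
  and sc_diff [simp]: "sc a (x - y) = sc a x - sc a y"
  and sc_uminus [simp]: "sc a (- x) = - sc a x"
  and sc_minus [simp]: "sc (- a) x = - sc a x"
  and sc_0_right [simp]: "sc a 0 = 0"
  and sc_0_left [simp]: "sc 0 x = 0"
  and sc_1_left [simp]: "sc 1 x = x"
  and sc_1_right [simp]: "sc a 1 = K a"
  and sc_K [simp]: "sc a (K b) = K (a * b)"
  and sc_add_left: "sc (a + b) x = sc a x + sc b x"
  and sc_diff_left: "sc (a - b) x = sc a x - sc b x"
  by (auto intro!: supalg_eqI simp: algebra_simps cf_K cf_one)

lemma sc_sum: "sc a (\<Sum>i\<in>I. f i) = (\<Sum>i\<in>I. sc a (f i))"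
  by (induction I rule: infinite_finite_induct) auto

lemma sc_sum_left: "sc (\<Sum>i\<in>I. f i) x = (\<Sum>i\<in>I. sc (f i) x)"
  by (induction I rule: infinite_finite_induct) (auto simp: sc_add_left)

lift_definition mon :: "gen multiset \<Rightarrow> supalg" is
  "\<lambda>A M. if M = A \<and> valid_mono gpar A then 1 else 0"
  by (auto simp: sa_carrier_def)

lemma cf_mon: "cf (mon A) M = (if M = A \<and> valid_mono gpar A then 1 else 0)"
  by transfer simp

lemma mon_invalid: "\<not> valid_mono gpar A \<Longrightarrow> mon A = 0"
  by (rule supalg_eqI) (simp add: cf_mon)

lemma mon_empty [simp]: "mon {#} = 1"
  by (rule supalg_eqI) (simp add: cf_mon cf_one valid_mono_def)

lemma mon_mult: "mon A * mon B = sc (msign gpar A B) (mon (A + B))"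
proof (rule supalg_eqI)
  fix M
  have "cf (mon A * mon B) M =
     (\<Sum>C\<in>{C. C \<subseteq># M}. if C = A then (if A \<subseteq># M \<and> M = A + B \<and> valid_mono gpar A \<and> valid_mono gpar B
        then msign gpar A B else 0) else 0)"
    unfolding cf_mult by (rule sum.cong) (auto simp: cf_mon subset_mset.le_iff_add)
  also have "\<dots> = (if M = A + B \<and> valid_mono gpar A \<and> valid_mono gpar B then msign gpar A B else 0)"
    by (auto simp: sum.delta finite_subsets_mset)
  also have "\<dots> = cf (sc (msign gpar A B) (mon (A + B))) M"
    by (auto simp: cf_mon msign_inv dest: valid_mono_add_left valid_mono_add_right)
  finally show "cf (mon A * mon B) M = cf (sc (msign gpar A B) (mon (A + B))) M" .
qed

definition supp :: "supalg \<Rightarrow> gen multiset set" where "supp x = {M. cf x M \<noteq> 0}"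

lemma finite_supp [simp]: "finite (supp x)" by (simp add: supp_def)

lemma expand_mon:
  assumes "finite S" "supp x \<subseteq> S"
  shows "x = (\<Sum>M\<in>S. sc (cf x M) (mon M))"
proof (rule supalg_eqI)
  fix N
  have "cf (\<Sum>M\<in>S. sc (cf x M) (mon M)) N
      = (\<Sum>M\<in>S. if M = N then (if valid_mono gpar N then cf x N else 0) else 0)"
    unfolding cf_sum by (rule sum.cong) (auto simp: cf_mon)
  also have "\<dots> = cf x N"
    using assms cf_valid[of x N] by (auto simp: sum.delta supp_def)
  finally show "cf x N = cf (\<Sum>M\<in>S. sc (cf x M) (mon M)) N" ..
qed

definition gen :: "gen \<Rightarrow> supalg" where "gen x = mon {#x#}"

lemma valid_mono_single [simp]: "valid_mono par {#x#}" by (simp add: valid_mono_def)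

lemma cf_gen: "cf (gen x) = sa_gen x"
  by (auto simp: gen_def sa_gen_def cf_mon)

definition L :: "gen list \<Rightarrow> supalg" where "L xs = prod_list (map gen xs)"

lemma L_Nil [simp]: "L [] = 1" and L_Cons: "L (x # xs) = gen x * L xs"
  and L_append: "L (xs @ ys) = L xs * L ys"
  by (auto simp: L_def)

lemma L_sorted: "sorted xs \<Longrightarrow> L xs = mon (mset xs)"
proof (induction xs)
  case (Cons x xs)
  have "inv_pairs gpar {#x#} (mset xs) = {}"
    using Cons.prems by (fastforce simp: inv_pairs_def)
  moreover have "sc (if P then 1 else 0) (mon M) = mon M" if "\<not> P \<Longrightarrow> \<not> valid_mono gpar M" for P M
    using that mon_invalid by auto
  ultimately show ?case
    using Cons by (simp add: L_Cons gen_def mon_mult msign_inv mon_invalid)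
qed simp

lemma mon_L: "mon M = L (sorted_list_of_multiset M)"
  by (simp add: L_sorted)

lemma supalg_induct [case_names zero add mon]:
  assumes "P 0" "\<And>x y. P x \<Longrightarrow> P y \<Longrightarrow> P (x + y)" "\<And>c xs. P (sc c (L xs))"
  shows "P x"
proof -
  have "P (\<Sum>M\<in>S. sc (cf x M) (mon M))" if "finite S" for S
    using that by induction (auto simp: assms mon_L)
  from this[of "supp x"] expand_mon[of "supp x" x] show ?thesis by simp
qed

text \<open>Parity (\<open>hp\<close>), admissible variables (\<open>inV\<close>), degree
  (\<open>msz\<close>), weight (\<open>wts\<close>) and leading terms (\<open>low\<close>) are all
  conditions on the support, so their closure rules are proved once, here.\<close>

definition sup_in :: "(gen multiset \<Rightarrow> bool) \<Rightarrow> supalg \<Rightarrow> bool" where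
  "sup_in P x \<longleftrightarrow> (\<forall>M. cf x M \<noteq> 0 \<longrightarrow> P M)"

lemma sup_inD: "sup_in P x \<Longrightarrow> \<not> P M \<Longrightarrow> cf x M = 0"
  by (auto simp: sup_in_def)

lemma sup_in_0 [simp]: "sup_in P 0" by (simp add: sup_in_def)

lemma sup_in_add: "sup_in P x \<Longrightarrow> sup_in P y \<Longrightarrow> sup_in P (x + y)"
  unfolding sup_in_def cf_add by (metis add_0)

lemma sup_in_uminus [simp]: "sup_in P (- x) \<longleftrightarrow> sup_in P x"
  by (simp add: sup_in_def)

lemma sup_in_diff: "sup_in P x \<Longrightarrow> sup_in P y \<Longrightarrow> sup_in P (x - y)"
  using sup_in_add[of P x "- y"] by simp

lemma sup_in_sum: "(\<And>i. i \<in> I \<Longrightarrow> sup_in P (f i)) \<Longrightarrow> sup_in P (\<Sum>i\<in>I. f i)"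
  by (induction I rule: infinite_finite_induct) (auto intro: sup_in_add)

lemma sup_in_sc: "sup_in P x \<Longrightarrow> sup_in P (sc c x)"
  by (auto simp: sup_in_def)

lemma sup_in_K: "P {#} \<Longrightarrow> sup_in P (K c)"
  by (auto simp: sup_in_def cf_K)

lemma sup_in_1: "P {#} \<Longrightarrow> sup_in P 1"
  by (auto simp: sup_in_def cf_one)

lemma sup_in_mon: "P M \<Longrightarrow> sup_in P (mon M)"
  by (auto simp: sup_in_def cf_mon)

lemma sup_in_gen: "P {#x#} \<Longrightarrow> sup_in P (gen x)"
  by (simp add: gen_def sup_in_mon)

lemma sup_in_mono: "sup_in P x \<Longrightarrow> (\<And>M. P M \<Longrightarrow> Q M) \<Longrightarrow> sup_in Q x"
  by (auto simp: sup_in_def)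

lemma sup_in_mult:
  assumes "sup_in P x" "sup_in Q y" "\<And>A B. P A \<Longrightarrow> Q B \<Longrightarrow> R (A + B)"
  shows "sup_in R (x * y)"
  unfolding sup_in_def
proof (intro allI impI)
  fix M assume "cf (x * y) M \<noteq> 0"
  then obtain A where A: "A \<subseteq># M" "cf x A \<noteq> 0" "cf y (M - A) \<noteq> 0"
    unfolding cf_mult by (metis (mono_tags, lifting) mem_Collect_eq mult_eq_0_iff sum.neutral)
  then have "R (A + (M - A))" using assms unfolding sup_in_def by blast
  then show "R M" using A(1) by (metis subset_mset.add_diff_inverse)
qed

lemma sup_in_span:
  assumes "sup_in P x" "Q 0" "\<And>x y. Q x \<Longrightarrow> Q y \<Longrightarrow> Q (x + y)" "\<And>c M. P M \<Longrightarrow> Q (sc c (mon M))"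
  shows "Q x"
proof -
  have "Q (\<Sum>M\<in>S. sc (cf x M) (mon M))" if "finite S" "\<And>M. M \<in> S \<Longrightarrow> P M" for S
    using that by induction (auto simp: assms)
  from this[of "supp x"] expand_mon[of "supp x" x] assms(1) show ?thesis
    by (simp add: sup_in_def supp_def)
qed

section \<open>Parity and the sign rule\<close>

definition mpar :: "gen multiset \<Rightarrow> bool" where
  "mpar M \<longleftrightarrow> odd (size (filter_mset gpar M))"

lemma mpar_add [simp]: "mpar (A + B) \<longleftrightarrow> mpar A \<noteq> mpar B"
  by (simp add: mpar_def)

lemma mpar_empty [simp]: "\<not> mpar {#}" and mpar_single [simp]: "mpar {#x#} = gpar x"
  by (auto simp: mpar_def)

definition hp :: "bool \<Rightarrow> supalg \<Rightarrow> bool" where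
  "hp p = sup_in (\<lambda>M. mpar M = p)"

lemma hp_0 [simp]: "hp p 0" by (simp add: hp_def)
lemma hp_1 [simp]: "hp False 1" by (simp add: hp_def sup_in_1)
lemma hp_K [simp]: "hp False (K c)" by (simp add: hp_def sup_in_K)
lemma hp_gen [simp]: "hp (gpar x) (gen x)" by (simp add: hp_def sup_in_gen)
lemma hp_add: "hp p x \<Longrightarrow> hp p y \<Longrightarrow> hp p (x + y)" by (simp add: hp_def sup_in_add)
lemma hp_sum: "(\<And>i. i \<in> I \<Longrightarrow> hp p (f i)) \<Longrightarrow> hp p (\<Sum>i\<in>I. f i)"
  by (simp add: hp_def sup_in_sum)
lemma hp_sc: "hp p x \<Longrightarrow> hp p (sc c x)" by (simp add: hp_def sup_in_sc)
lemma hp_mult: "hp p x \<Longrightarrow> hp q y \<Longrightarrow> hp (p \<noteq> q) (x * y)"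
  using sup_in_mult[of "\<lambda>M. mpar M = p" x "\<lambda>M. mpar M = q" y "\<lambda>M. mpar M = (p \<noteq> q)"]
  by (auto simp: hp_def)
lemma hp_mon: "hp (mpar M) (mon M)" by (simp add: hp_def sup_in_mon)

definition sgn2 :: "bool \<Rightarrow> bool \<Rightarrow> complex" where
  "sgn2 p q = (if p \<and> q then -1 else 1)"

lemma sgn2_simps [simp]: "sgn2 False q = 1" "sgn2 p False = 1" "sgn2 True True = -1"
  by (auto simp: sgn2_def)

lemma mon_comm: "mon A * mon B = sc (sgn2 (mpar A) (mpar B)) (mon B * mon A)"
proof -
  have "(-1) ^ (k * l) = sgn2 (odd k) (odd l)" for k l :: nat
    by (auto simp: sgn2_def)
  then have "msign gpar A B = sgn2 (mpar A) (mpar B) * msign gpar B A"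
    using msign_swap[of gpar A B] by (simp add: mpar_def)
  then show ?thesis by (simp add: mon_mult  add.commute mult.assoc)
qed

lemma hp_comm:
  assumes "hp p x" "hp q y"
  shows "x * y = sc (sgn2 p q) (y * x)"
proof -
  have *: "mon A * y = sc (sgn2 p q) (y * mon A)" if "mpar A = p" for A
    using assms(2) unfolding hp_def
  proof (rule sup_in_span)
    fix c M assume "mpar M = q"
    then show "mon A * (sc c (mon M)) = sc (sgn2 p q) (sc c (mon M) * mon A)"
      using mon_comm[of A M] that by (simp add: mult.commute)
  qed (auto simp: algebra_simps)
  show ?thesis
    using assms(1) unfolding hp_def
    by (rule sup_in_span) (auto simp: algebra_simps *  mult.assoc)
qed

lemma odd_square_0: assumes "hp True x" shows "x * x = 0"
proof (rule supalg_eqI)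
  fix M
  have "x * x = - (x * x)" using hp_comm[OF assms assms] by simp
  then have "cf (x * x) M = - cf (x * x) M" by (metis cf_uminus)
  then show "cf (x * x) M = cf 0 M" by simp
qed

lift_definition sig :: "supalg \<Rightarrow> supalg" is
  "\<lambda>f M. (if mpar M then - f M else f M)"
  by (auto simp: sa_carrier_def elim: finite_subset[rotated])

lemma cf_sig: "cf (sig x) M = (if mpar M then - cf x M else cf x M)"
  by transfer simp

lemma sig_hp: "hp p x \<Longrightarrow> sig x = (if p then - x else x)"
  by (rule supalg_eqI) (auto simp: cf_sig hp_def sup_in_def)

lemma sig_add [simp]: "sig (x + y) = sig x + sig y"
  and sig_uminus [simp]: "sig (- x) = - sig x"
  and sig_diff [simp]: "sig (x - y) = sig x - sig y"
  and sig_0 [simp]: "sig 0 = 0"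
  and sig_1 [simp]: "sig 1 = 1"
  and sig_K [simp]: "sig (K c) = K c"
  and sig_sc [simp]: "sig (sc c x) = sc c (sig x)"
  and sig_sig [simp]: "sig (sig x) = x"
  by (auto intro!: supalg_eqI simp: cf_sig cf_one cf_K)

subsection \<open>Extension from words\<close>

text \<open>A function of words that obeys the sign rule for adjacent letters factors through the free
 supercommutative algebra; homomorphisms and derivations are obtained in this way.\<close>

definition alternating :: "(gen list \<Rightarrow> supalg) \<Rightarrow> bool" where
  "alternating g \<longleftrightarrow>
     (\<forall>u x y v. g (u @ x # y # v) = sc (sgn2 (gpar x) (gpar y)) (g (u @ y # x # v))) \<and>
     (\<forall>u x v. gpar x \<longrightarrow> g (u @ x # x # v) = 0)"

lemma alternatingI:
  assumes "\<And>u x y v. g (u @ x # y # v) = sc (sgn2 (gpar x) (gpar y)) (g (u @ y # x # v))"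
    and "\<And>u x v. gpar x \<Longrightarrow> g (u @ x # x # v) = 0"
  shows "alternating g"
  unfolding alternating_def using assms by blast

lemma alternating_swap:
  "alternating g \<Longrightarrow> g (u @ x # y # v) = sc (sgn2 (gpar x) (gpar y)) (g (u @ y # x # v))"
  unfolding alternating_def by blast

lemma alternating_swap0:
  "alternating g \<Longrightarrow> g (x # y # v) = sc (sgn2 (gpar x) (gpar y)) (g (y # x # v))"
  using alternating_swap[of g "[]"] unfolding append_Nil by blast

lemma alternating_Cons: "alternating g \<Longrightarrow> alternating (\<lambda>v. g (z # v))"
  unfolding alternating_def by (metis append_Cons)

text \<open>The sign is fixed before the alternating function is chosen. Sorting a word therefore
  costs the same sign for \<open>g\<close> and for \<open>L\<close>, which is what allows
  \<open>ext g\<close> to be evaluated on unsorted words.\<close>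

lemma alternating_insort:
  "\<exists>c. (c = 1 \<or> c = -1) \<and> (\<forall>g. alternating g \<longrightarrow> g (x # xs) = sc c (g (insort x xs)))"
proof (induction xs)
  case Nil
  show ?case by (intro exI[of _ 1]) simp
next
  case (Cons y ys)
  show ?case
  proof (cases "x \<le> y")
    case True
    then show ?thesis by (intro exI[of _ 1]) simp
  next
    case False
    from Cons obtain c where c: "c = 1 \<or> c = -1"
      "\<And>g. alternating g \<Longrightarrow> g (x # ys) = sc c (g (insort x ys))" by blast
    have "g (x # y # ys) = sc (sgn2 (gpar x) (gpar y) * c) (g (insort x (y # ys)))"
      if "alternating g" for g
      using alternating_swap0[OF that, of x y ys] c(2)[OF alternating_Cons[OF that, of y]] False
      by (simp)
    then show ?thesis using c(1)
      by (intro exI[of _ "sgn2 (gpar x) (gpar y) * c"]) (auto simp: sgn2_def)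
  qed
qed

lemma alternating_sort:
  "\<exists>c. (c = 1 \<or> c = -1) \<and> (\<forall>g. alternating g \<longrightarrow> g xs = sc c (g (sort xs)))"
proof (induction xs)
  case Nil
  show ?case by (intro exI[of _ 1]) simp
next
  case (Cons x xs)
  then obtain c where c: "c = 1 \<or> c = -1"
    "\<And>g. alternating g \<Longrightarrow> g xs = sc c (g (sort xs))" by blast
  obtain d where d: "d = 1 \<or> d = -1"
    "\<And>g. alternating g \<Longrightarrow> g (x # sort xs) = sc d (g (insort x (sort xs)))"
    using alternating_insort[of x "sort xs"] by blast
  have "g (x # xs) = sc (c * d) (g (sort (x # xs)))" if "alternating g" for g
    using c(2)[OF alternating_Cons[OF that, of x]] d(2)[OF that] by (simp)
  then show ?case using c(1) d(1) by (intro exI[of _ "c * d"]) auto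
qed

text \<open>A word with a repeated odd letter has the same sorted form as one in which two copies
  are adjacent, and there \<open>g\<close> vanishes.\<close>

lemma alternating_invalid:
  assumes "alternating g" "\<not> valid_mono gpar (mset xs)"
  shows "g xs = 0"
proof -
  obtain x where x: "gpar x" "count (mset xs) x \<ge> 2"
    using assms(2) by (auto simp: valid_mono_def not_le)
  have "{#x, x#} \<subseteq># mset xs"
    using x(2) by (auto simp: subseteq_mset_def)
  then obtain R where R: "mset xs = {#x, x#} + R" using subset_mset.le_iff_add by blast
  obtain ys where ys: "mset ys = R" using ex_mset by blast
  have s: "sort xs = sort (x # x # ys)"
    by (intro arg_cong[of _ _ sorted_list_of_multiset, of "mset xs" "mset (x # x # ys)", unfolded sorted_list_of_multiset_mset]) (simp add: R ys)
  obtain c where c: "g xs = sc c (g (sort xs))" using alternating_sort[of xs] assms(1) by blast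
  obtain d where d: "d = 1 \<or> d = -1" "g (x # x # ys) = sc d (g (sort (x # x # ys)))"
    using alternating_sort[of "x # x # ys"] assms(1) by blast
  have "g (x # x # ys) = 0"
    using assms(1) x(1) unfolding alternating_def by (metis append_Nil)
  then have "g (sort xs) = 0" using d s by auto
  then show ?thesis using c by simp
qed

lemma gen_comm: "gen x * gen y = sc (sgn2 (gpar x) (gpar y)) (gen y * gen x)"
  by (rule hp_comm) auto

lemma alternating_prod:
  assumes "\<And>x. hp (gpar x) (h x)"
  shows "alternating (\<lambda>xs. prod_list (map h xs))"
proof (rule alternatingI)
  fix u x y v
  show "prod_list (map h (u @ x # y # v)) = sc (sgn2 (gpar x) (gpar y)) (prod_list (map h (u @ y # x # v)))"
    using hp_comm[OF assms[of x] assms[of y]]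
    by (simp flip: mult.assoc)
next
  fix u x v assume "gpar x"
  then have "h x * h x = 0" using odd_square_0 assms[of x] by simp
  then show "prod_list (map h (u @ x # x # v)) = 0"
    by simp (metis mult.assoc mult_zero_left mult_zero_right)
qed

lemma alternating_L: "alternating L"
  unfolding L_def[abs_def] by (rule alternating_prod) simp

definition ext :: "(gen list \<Rightarrow> supalg) \<Rightarrow> supalg \<Rightarrow> supalg" where
  "ext g x = (\<Sum>M\<in>supp x. sc (cf x M) (g (sorted_list_of_multiset M)))"

lemma ext_superset:
  assumes "finite S" "supp x \<subseteq> S"
  shows "ext g x = (\<Sum>M\<in>S. sc (cf x M) (g (sorted_list_of_multiset M)))"
  unfolding ext_def using assms by (intro sum.mono_neutral_left) (auto simp: supp_def)

lemma ext_add: "ext g (x + y) = ext g x + ext g y"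
proof -
  have *: "supp (x + y) \<subseteq> supp x \<union> supp y" by (auto simp: supp_def)
  show ?thesis
    using ext_superset[of "supp x \<union> supp y" _ g] *
    by (simp add: sc_add_left algebra_simps sum.distrib)
qed

lemma ext_sc: "ext g (sc c x) = sc c (ext g x)"
proof -
  have "supp (sc c x) \<subseteq> supp x" by (auto simp: supp_def)
  then show ?thesis
    using ext_superset[of "supp x" _ g] by (simp add: sc_sum)
qed

lemma ext_0 [simp]: "ext g 0 = 0" by (simp add: ext_def supp_def)

lemma ext_mon: "valid_mono gpar M \<Longrightarrow> ext g (mon M) = g (sorted_list_of_multiset M)"
  using ext_superset[of "{M}" "mon M" g] by (auto simp: cf_mon supp_def)

lemma ext_L:
  assumes "alternating g"
  shows "ext g (L xs) = g xs"
proof (cases "valid_mono gpar (mset xs)")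
  case True
  obtain c where c: "\<And>g. alternating g \<Longrightarrow> g xs = sc c (g (sort xs))"
    using alternating_sort by blast
  have "L xs = sc c (mon (mset xs))"
    using c[OF alternating_L] L_sorted[of "sort xs"] by simp
  then show ?thesis using c[OF assms] True by (simp add: ext_sc ext_mon)
next
  case False
  then show ?thesis
    using alternating_invalid[OF assms] alternating_invalid[OF alternating_L] by simp
qed

lemma L_mon: "\<exists>c. (c = 1 \<or> c = -1) \<and> L xs = sc c (mon (mset xs))"
proof -
  obtain c where "c = 1 \<or> c = -1" "L xs = sc c (L (sort xs))"
    using alternating_sort[of xs] alternating_L by blast
  then show ?thesis using L_sorted[of "sort xs"] by auto
qed

definition clinear :: "(supalg \<Rightarrow> supalg) \<Rightarrow> bool" where
  "clinear F \<longleftrightarrow> (\<forall>x y. F (x + y) = F x + F y) \<and> (\<forall>c x. F (sc c x) = sc c (F x))"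

lemma clinear_add: "clinear F \<Longrightarrow> F (x + y) = F x + F y"
  and clinear_sc: "clinear F \<Longrightarrow> F (sc c x) = sc c (F x)"
  by (simp_all add: clinear_def)

lemma clinear_0: "clinear F \<Longrightarrow> F 0 = 0"
  by (metis add_cancel_right_right clinear_add)

lemma clinear_uminus: "clinear F \<Longrightarrow> F (- x) = - F x"
  by (metis sc_minus sc_1_left clinear_sc)

lemma clinear_diff: "clinear F \<Longrightarrow> F (x - y) = F x - F y"
  by (metis clinear_add clinear_uminus add_uminus_conv_diff)

lemma clinear_sum: "clinear F \<Longrightarrow> F (\<Sum>i\<in>I. f i) = (\<Sum>i\<in>I. F (f i))"
  by (induction I rule: infinite_finite_induct) (auto simp: clinear_0 clinear_add)

lemma clinear_ext [simp]: "clinear (ext g)"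
  by (simp add: clinear_def ext_add ext_sc)

lemma clinear_sig [simp]: "clinear sig" by (simp add: clinear_def)

lemma clinear_id [simp]: "clinear (\<lambda>x. x)" by (simp add: clinear_def)

lemma clinear_eqI:
  assumes "clinear F" "clinear G" "\<And>xs. F (L xs) = G (L xs)"
  shows "F x = G x"
  by (induction x rule: supalg_induct) (auto simp: assms clinear_0 clinear_add clinear_sc)

lemma clinear_eq_monI:
  assumes "clinear F" "clinear G" "\<And>M. F (mon M) = G (mon M)"
  shows "F x = G x"
  proof (rule clinear_eqI[OF assms(1,2)])
  fix xs
  obtain c where "L xs = sc c (mon (mset xs))" using L_mon by blast
  then show "F (L xs) = G (L xs)" by (simp add: assms clinear_sc)
qed

lemma sig_mult [simp]: "sig (x * y) = sig x * sig y"
proof -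
  have "sig (mon A * mon B) = sig (mon A) * sig (mon B)" for A B
    using sig_hp[OF hp_mon[of A]] sig_hp[OF hp_mon[of B]] sig_hp[OF hp_mult[OF hp_mon[of A] hp_mon[of B]]]
    by (auto split: if_splits)
  then have "sig (mon A * y) = sig (mon A) * sig y" for A
    using clinear_eq_monI[of "\<lambda>y. sig (mon A * y)" "\<lambda>y. sig (mon A) * sig y" y]
    by (simp add: clinear_def distrib_left)
  then show ?thesis
    using clinear_eq_monI[of "\<lambda>x. sig (x * y)" "\<lambda>x. sig x * sig y" x]
    by (simp add: clinear_def distrib_right)
qed

subsection \<open>Homomorphisms\<close>

definition parity_pres :: "(gen \<Rightarrow> supalg) \<Rightarrow> bool" where
  "parity_pres h \<longleftrightarrow> (\<forall>x. hp (gpar x) (h x))"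

lemma parity_presD: "parity_pres h \<Longrightarrow> hp (gpar x) (h x)"
  unfolding parity_pres_def by blast

definition Hom :: "(gen \<Rightarrow> supalg) \<Rightarrow> supalg \<Rightarrow> supalg" where
  "Hom h = ext (\<lambda>xs. prod_list (map h xs))"

lemma clinear_Hom [simp]: "clinear (Hom h)" by (simp add: Hom_def)

lemma Hom_L: "parity_pres h \<Longrightarrow> Hom h (L xs) = prod_list (map h xs)"
  unfolding Hom_def parity_pres_def by (intro ext_L alternating_prod) auto

lemma Hom_gen: "parity_pres h \<Longrightarrow> Hom h (gen x) = h x"
  using Hom_L[of h "[x]"] by (simp add: L_Cons)

lemma Hom_1: "parity_pres h \<Longrightarrow> Hom h 1 = 1"
  using Hom_L[of h "[]"] by simp

lemma Hom_K: "parity_pres h \<Longrightarrow> Hom h (K c) = K c"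
  using clinear_sc[of "Hom h" c 1] by (simp add: Hom_1)

lemma Hom_add [simp]: "Hom h (x + y) = Hom h x + Hom h y"
  and Hom_diff [simp]: "Hom h (x - y) = Hom h x - Hom h y"
  and Hom_uminus [simp]: "Hom h (- x) = - Hom h x"
  and Hom_sc [simp]: "Hom h (sc c x) = sc c (Hom h x)"
  and Hom_0 [simp]: "Hom h 0 = 0"
  by (simp_all add: clinear_add clinear_diff clinear_uminus clinear_sc clinear_0)

lemma Hom_mult: assumes "parity_pres h" shows "Hom h (x * y) = Hom h x * Hom h y"
proof -
  have "Hom h (L xs * L ys) = Hom h (L xs) * Hom h (L ys)" for xs ys
    using Hom_L[OF assms, of "xs @ ys"] by (simp add: Hom_L[OF assms] L_append)
  then have "Hom h (L xs * y) = Hom h (L xs) * Hom h y" for xs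
    using clinear_eqI[of "\<lambda>y. Hom h (L xs * y)" "\<lambda>y. Hom h (L xs) * Hom h y" y]
    by (simp add: clinear_def distrib_left)
  then show ?thesis
    using clinear_eqI[of "\<lambda>x. Hom h (x * y)" "\<lambda>x. Hom h x * Hom h y" x]
    by (simp add: clinear_def distrib_right)
qed

lemma Hom_hp: assumes "parity_pres h" "hp p x" shows "hp p (Hom h x)"
proof -
  have "hp (mpar (mset xs)) (prod_list (map h xs))" for xs
  proof (induction xs)
    case (Cons a xs)
    then have "hp (gpar a \<noteq> mpar (mset xs)) (h a * prod_list (map h xs))"
      using assms(1) by (intro hp_mult) (auto intro: parity_presD)
    moreover have "mpar (mset (a # xs)) = (gpar a \<noteq> mpar (mset xs))"
      by (metis mpar_add mpar_single mset.simps(2) add_mset_add_single add.commute)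
    ultimately show ?case by simp
  qed simp
  from this[of "sorted_list_of_multiset _"]
  have *: "hp (mpar M) (Hom h (mon M))" for M
    using Hom_L[OF assms(1)] mon_L by simp
  show ?thesis
  proof (rule sup_in_span[OF assms(2)[unfolded hp_def]])
    fix c M assume "mpar M = p"
    then show "hp p (Hom h (sc c (mon M)))" using *[of M] by (simp add: hp_sc)
  qed (auto intro: hp_add)
qed

subsection \<open>Derivations\<close>

text \<open>The flag \<open>tw\<close> is the parity of the derivation.\<close>

definition tws :: "bool \<Rightarrow> supalg \<Rightarrow> supalg" where
  "tws tw x = (if tw then sig x else x)"

lemma clinear_tws [simp]: "clinear (tws tw)" by (cases tw) (simp_all add: tws_def[abs_def])

lemma tws_add [simp]: "tws tw (x + y) = tws tw x + tws tw y"
  and tws_sc [simp]: "tws tw (sc c x) = sc c (tws tw x)"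
  and tws_0 [simp]: "tws tw 0 = 0"
  by (simp_all add: tws_def)

lemma tws_mult: "tws tw (x * y) = tws tw x * tws tw y" by (simp add: tws_def)

lemma tws_1 [simp]: "tws tw 1 = 1" by (simp add: tws_def)

lemma tws_hp: "hp p x \<Longrightarrow> tws tw x = sc (sgn2 p tw) x"
  by (auto simp: tws_def sig_hp sgn2_def)

fun dl :: "bool \<Rightarrow> (gen \<Rightarrow> supalg) \<Rightarrow> gen list \<Rightarrow> supalg" where
  "dl tw d [] = 0"
| "dl tw d (x # xs) = d x * L xs + tws tw (gen x) * dl tw d xs"

definition dpar :: "bool \<Rightarrow> (gen \<Rightarrow> supalg) \<Rightarrow> bool" where
  "dpar tw d \<longleftrightarrow> (\<forall>x. hp (gpar x \<noteq> tw) (d x))"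

lemma dparD: "dpar tw d \<Longrightarrow> hp (gpar x \<noteq> tw) (d x)"
  unfolding dpar_def by blast

lemma dl_append: "dl tw d (u @ v) = dl tw d u * L v + tws tw (L u) * dl tw d v"
  by (induction u) (auto simp: L_append L_Cons tws_mult algebra_simps)

lemma dl_pair:
  assumes "dpar tw d"
  shows "dl tw d [x, y] = sc (sgn2 (gpar x) (gpar y)) (dl tw d [y, x])"
proof -
  have dx: "hp (gpar x \<noteq> tw) (d x)" and dy: "hp (gpar y \<noteq> tw) (d y)"
    using assms by (blast intro: dparD)+
  have t: "tws tw (gen z) = sc (sgn2 (gpar z) tw) (gen z)" for z
    by (rule tws_hp) simp
  have 1: "d x * gen y = sc (sgn2 (gpar x \<noteq> tw) (gpar y)) (gen y * d x)"
    by (rule hp_comm) (use dx in auto)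
  have 2: "d y * gen x = sc (sgn2 (gpar y \<noteq> tw) (gpar x)) (gen x * d y)"
    by (rule hp_comm) (use dy in auto)
  show ?thesis
    by (simp add: t 1 2 L_Cons sgn2_def)
qed

lemma dl_square:
  assumes "dpar tw d" "gpar x"
  shows "dl tw d [x, x] = 0"
proof -
  have 0: "hp True (gen x)" using assms(2) hp_gen by metis
  have dx: "hp (\<not> tw) (d x)" using dparD[OF assms(1), of x] assms(2) by simp
  have "tws tw (gen x) = sc (sgn2 True tw) (gen x)"
    by (rule tws_hp[OF 0])
  moreover have "d x * gen x = sc (sgn2 (\<not> tw) True) (gen x * d x)"
    by (rule hp_comm[OF dx 0])
  ultimately show ?thesis by (cases tw) (auto simp: L_Cons)
qed

text \<open>By \<open>dl_append\<close>, exchanging two adjacent letters affects only the two-letter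
  word in the middle and its product; there the sign rule is \<open>dl_pair\<close>.\<close>

lemma alternating_dl: assumes "dpar tw d" shows "alternating (dl tw d)"
proof (rule alternatingI)
  fix u x y v
  have 1: "dl tw d (u @ [x, y] @ v) = dl tw d u * L v' + tws tw (L u) * (dl tw d [x, y] * L v + tws tw (L [x, y]) * dl tw d v)"
    if "v' = [x, y] @ v" for x y v'
    unfolding dl_append that by simp
  have c: "L [x, y] = sc (sgn2 (gpar x) (gpar y)) (L [y, x])"
    using gen_comm[of x y] by (simp add: L_Cons)
  have c': "L ([x, y] @ v) = sc (sgn2 (gpar x) (gpar y)) (L ([y, x] @ v))"
    unfolding L_append c by (simp add: mult.assoc)
  show "dl tw d (u @ x # y # v) = sc (sgn2 (gpar x) (gpar y)) (dl tw d (u @ y # x # v))"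
    using 1[of "[x, y] @ v" x y] 1[of "[y, x] @ v" y x]
    unfolding c c' dl_pair[OF assms, of x y] clinear_sc[OF clinear_tws]
    by (simp add: algebra_simps  mult.assoc)
next
  fix u x v assume x: "gpar x"
  have "L [x, x] = 0" using odd_square_0[of "gen x"] x hp_gen[of x] by (simp add: L_Cons)
  moreover from this have "L ([x, x] @ v) = 0" unfolding L_append by simp
  ultimately have "dl tw d (u @ [x, x] @ v) = 0"
    unfolding dl_append[of tw d u] dl_append[of tw d "[x,x]"] dl_square[OF assms x]
    by (simp add: clinear_0)
  then show "dl tw d (u @ x # x # v) = 0" by simp
qed

definition Der :: "bool \<Rightarrow> (gen \<Rightarrow> supalg) \<Rightarrow> supalg \<Rightarrow> supalg" where
  "Der tw d = ext (dl tw d)"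

lemma clinear_Der [simp]: "clinear (Der tw d)" by (simp add: Der_def)

lemma Der_L: "dpar tw d \<Longrightarrow> Der tw d (L xs) = dl tw d xs"
  unfolding Der_def by (intro ext_L alternating_dl)

lemma Der_gen: "dpar tw d \<Longrightarrow> Der tw d (gen x) = d x"
  using Der_L[of tw d "[x]"] by (simp add: L_Cons)

lemma Der_1: "dpar tw d \<Longrightarrow> Der tw d 1 = 0"
  using Der_L[of tw d "[]"] by simp

lemma Der_K: "dpar tw d \<Longrightarrow> Der tw d (K c) = 0"
  using clinear_sc[of "Der tw d" c 1] by (simp add: Der_1)

lemma Der_add [simp]: "Der tw d (x + y) = Der tw d x + Der tw d y"
  and Der_diff [simp]: "Der tw d (x - y) = Der tw d x - Der tw d y"
  and Der_uminus [simp]: "Der tw d (- x) = - Der tw d x"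
  and Der_sc [simp]: "Der tw d (sc c x) = sc c (Der tw d x)"
  and Der_0 [simp]: "Der tw d 0 = 0"
  by (simp_all add: clinear_add clinear_diff clinear_uminus clinear_sc clinear_0)

lemma Der_mult:
  assumes "dpar tw d"
  shows "Der tw d (x * y) = Der tw d x * y + tws tw x * Der tw d y"
proof -
  have "Der tw d (L xs * L ys) = Der tw d (L xs) * L ys + tws tw (L xs) * Der tw d (L ys)" for xs ys
    using Der_L[OF assms, of "xs @ ys"] by (simp add: Der_L[OF assms] dl_append L_append)
  then have "Der tw d (L xs * y) = Der tw d (L xs) * y + tws tw (L xs) * Der tw d y" for xs
    using clinear_eqI[of "\<lambda>y. Der tw d (L xs * y)" "\<lambda>y. Der tw d (L xs) * y + tws tw (L xs) * Der tw d y" y]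
    by (simp add: clinear_def distrib_left)
  then show ?thesis
    using clinear_eqI[of "\<lambda>x. Der tw d (x * y)" "\<lambda>x. Der tw d x * y + tws tw x * Der tw d y" x]
    by (simp add: clinear_def distrib_right)
qed

lemma Der_hp:
  assumes "dpar tw d" "hp p x" shows "hp (p \<noteq> tw) (Der tw d x)"
proof -
  have L: "hp (mpar (mset xs)) (L xs)" for xs
    by (metis L_mon hp_sc hp_mon)
  have m: "mpar (mset (a # xs)) = (gpar a \<noteq> mpar (mset xs))" for a xs
    by (metis mpar_add mpar_single mset.simps(2) add_mset_add_single add.commute)
  have "hp (mpar (mset xs) \<noteq> tw) (dl tw d xs)" for xs
  proof (induction xs)
    case (Cons a xs)
    have "hp ((gpar a \<noteq> tw) \<noteq> mpar (mset xs)) (d a * L xs)"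
      using assms(1) L by (intro hp_mult dparD)
    moreover have "hp (gpar a \<noteq> (mpar (mset xs) \<noteq> tw)) (tws tw (gen a) * dl tw d xs)"
      by (intro hp_mult Cons) (simp add: tws_hp[OF hp_gen] hp_sc)
    moreover have "((gpar a \<noteq> tw) \<noteq> mpar (mset xs)) = (mpar (mset (a # xs)) \<noteq> tw)"
      "(gpar a \<noteq> (mpar (mset xs) \<noteq> tw)) = (mpar (mset (a # xs)) \<noteq> tw)"
      unfolding m by auto
    ultimately show ?case unfolding dl.simps by (intro hp_add) simp_all
  qed simp
  from this[of "sorted_list_of_multiset _"]
  have *: "hp (mpar M \<noteq> tw) (Der tw d (mon M))" for M
    using Der_L[OF assms(1)] mon_L by simp
  show ?thesis
  proof (rule sup_in_span[OF assms(2)[unfolded hp_def]])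
    fix c M assume "mpar M = p"
    then show "hp (p \<noteq> tw) (Der tw d (sc c (mon M)))" using *[of M] by (simp add: hp_sc)
  qed (auto intro: hp_add)
qed

subsection \<open>The odd derivation and the bracket\<close>

lemma gpar_Suc [simp]: "gpar (Suc m, a) = (\<not> gpar (m, a))"
  by (simp add: gpar_def)

definition D :: "supalg \<Rightarrow> supalg" where
  "D = Der True (\<lambda>x. gen (gD x))"

lemma dpar_D: "dpar True (\<lambda>x. gen (gD x))"
  unfolding dpar_def
proof
  fix x :: gen
  have "gpar (gD x) = (gpar x \<noteq> True)" by (cases x) (simp add: gD_def)
  then show "hp (gpar x \<noteq> True) (gen (gD x))" using hp_gen[of "gD x"] by simp
qed

lemma clinear_D [simp]: "clinear D" by (simp add: D_def)

lemma D_add [simp]: "D (x + y) = D x + D y"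
  and D_diff [simp]: "D (x - y) = D x - D y"
  and D_uminus [simp]: "D (- x) = - D x"
  and D_sc [simp]: "D (sc c x) = sc c (D x)"
  and D_0 [simp]: "D 0 = 0"
  and D_K [simp]: "D (K c) = 0"
  and D_1 [simp]: "D 1 = 0"
  by (simp_all add: D_def Der_K Der_1 dpar_D)

lemma D_mult: "D (x * y) = D x * y + sig x * D y"
  using Der_mult[OF dpar_D] by (simp add: D_def tws_def)

lemma D_gen [simp]: "D (gen (m, a)) = gen (Suc m, a)"
  using Der_gen[OF dpar_D, of "(m, a)"] by (simp add: D_def) (simp add: gD_def)

lemma D_hp: "hp p x \<Longrightarrow> hp (\<not> p) (D x)"
  using Der_hp[OF dpar_D, of p x] by (simp add: D_def)

lemma D_sum: "D (\<Sum>i\<in>I. f i) = (\<Sum>i\<in>I. D (f i))"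
  by (rule clinear_sum) simp

lemma Dpow_add [simp]: "(D ^^ m) (x + y) = (D ^^ m) x + (D ^^ m) y"
  and Dpow_diff [simp]: "(D ^^ m) (x - y) = (D ^^ m) x - (D ^^ m) y"
  and Dpow_sc [simp]: "(D ^^ m) (sc c x) = sc c ((D ^^ m) x)"
  and Dpow_0 [simp]: "(D ^^ m) 0 = 0"
  by (induction m) auto

lemma Dpow_gen: "(D ^^ m) (gen (k, a)) = gen (m + k, a)"
  by (induction m) auto

lemma Dpow_hp: "hp p x \<Longrightarrow> hp (p \<noteq> odd m) ((D ^^ m) x)"
proof (induction m)
  case (Suc m)
  then show ?case using D_hp[of "p \<noteq> odd m"] by (cases p) auto
qed simp

lemma dl_sum:
  "dl tw d xs = (\<Sum>i<length xs. tws tw (L (take i xs)) * d (xs ! i) * L (drop (Suc i) xs))"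
proof (induction xs)
  case (Cons x xs)
  show ?case
    unfolding list.size(4) add_Suc_right add_0_right sum.lessThan_Suc_shift
    by (simp add: Cons L_Cons tws_mult sum_distrib_left mult.assoc)
qed simp

lemma L_hp: "hp (mpar (mset xs)) (L xs)"
  by (metis L_mon hp_sc hp_mon)

lemma mpar_oddcount: "mpar (mset xs) = odd (oddcount gpar xs)"
  by (simp add: mpar_def oddcount_def flip: mset_filter)

lemma sgn2_power: "sgn2 (odd k) (odd l) = (-1) ^ (k * l)"
  by (auto simp: sgn2_def)

lemma sig_L: "sig (L xs) = sc ((-1) ^ oddcount gpar xs) (L xs)"
  using sig_hp[OF L_hp[of xs]] by (auto simp: mpar_oddcount)

section \<open>Translation of the given functions into the type \<open>supalg\<close>\<close>

lemma cf_listprod: "sa_listprod gpar (map cf xs) = cf (prod_list xs)"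
  by (induction xs) (auto simp: one_supalg.rep_eq times_supalg.rep_eq)

lemma cf_listprod_gen: "sa_listprod gpar (map sa_gen xs) = cf (L xs)"
  using cf_listprod[of "map gen xs"] by (simp add: L_def o_def cf_gen)

lemma Vmult_cf: "Vmult (cf x) (cf y) = cf (x * y)"
  by (simp add: Vmult_def times_supalg.rep_eq)

lemma sa_add_cf: "sa_add (cf x) (cf y) = cf (x + y)"
  by (simp add: sa_add_def fun_eq_iff)

lemma sa_scale_cf: "sa_scale c (cf x) = cf (sc c x)"
  by (simp add: sa_scale_def fun_eq_iff)

lemma sa_const_cf: "sa_const c = cf (K c)"
  by (simp add: K.rep_eq)

lemma zero_cf: "(\<lambda>_. 0) = cf 0"
  by (simp add: fun_eq_iff)

lemma sa_sigma_cf: "sa_sigma gpar (cf x) = cf (sig x)"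
  by (simp add: sa_sigma_def cf_sig mpar_def fun_eq_iff)

lemma sa_supp_cf: "sa_supp (cf x) = supp x"
  by (simp add: sa_supp_def supp_def)

text \<open>The sign of the prefix in \<open>sa_D_mono\<close> is the effect of \<open>sig\<close>
  on that prefix, so the summands are those of \<open>dl_sum\<close>.\<close>

lemma VD_cf: "VD (cf x) = cf (D x)"
proof
  fix N
  have "sa_D_mono gpar gD M N = cf (dl True (\<lambda>x. gen (gD x)) (sorted_list_of_multiset M)) N" for M
  proof -
    let ?ys = "sorted_list_of_multiset M"
    have "dl True (\<lambda>x. gen (gD x)) ?ys
        = (\<Sum>i<length ?ys. sc ((-1) ^ oddcount gpar (take i ?ys)) (L (?ys[i := gD (?ys ! i)])))"
      unfolding dl_sum
      by (intro sum.cong refl) (simp add: tws_def sig_L upd_conv_take_nth_drop L_append L_Cons mult.assoc)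
    then show ?thesis
      by (simp add: sa_D_mono_def cf_listprod_gen Let_def)
  qed
  then show "VD (cf x) N = cf (D x) N"
    by (simp add: VD_def sa_D_def sa_supp_cf D_def Der_def ext_def)
qed

lemma VD_pow_cf: "(VD ^^ m) (cf x) = cf ((D ^^ m) x)"
  by (induction m) (auto simp: VD_cf)

section \<open>Subalgebras on prescribed indices\<close>

definition inV :: "(nat \<times> nat) set \<Rightarrow> supalg \<Rightarrow> bool" where
  "inV S = sup_in (\<lambda>M. \<forall>y\<in>#M. snd y \<in> S)"

lemma inV_0 [simp]: "inV S 0" and inV_K [simp]: "inV S (K c)" and inV_1 [simp]: "inV S 1"
  by (auto simp: inV_def intro: sup_in_K sup_in_1)

lemma inV_add: "inV S x \<Longrightarrow> inV S y \<Longrightarrow> inV S (x + y)"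
  and inV_diff: "inV S x \<Longrightarrow> inV S y \<Longrightarrow> inV S (x - y)"
  and inV_sum: "(\<And>i. i \<in> I \<Longrightarrow> inV S (f i)) \<Longrightarrow> inV S (sum f I)"
  and inV_sc: "inV S x \<Longrightarrow> inV S (sc c x)"
  and inV_gen: "snd (z :: gen) \<in> S \<Longrightarrow> inV S (gen z)"
  by (auto simp: inV_def intro: sup_in_add sup_in_diff sup_in_sum sup_in_sc sup_in_gen)

lemma inV_mono: "inV S x \<Longrightarrow> S \<subseteq> T \<Longrightarrow> inV T x"
  unfolding inV_def by (erule sup_in_mono) auto

lemma inV_mult: "inV S x \<Longrightarrow> inV S y \<Longrightarrow> inV S (x * y)"
  unfolding inV_def by (erule (1) sup_in_mult) auto

lemma inV_L: "\<forall>y\<in>set xs. snd y \<in> S \<Longrightarrow> inV S (L xs)"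
  by (induction xs) (auto simp: L_Cons intro: inV_mult inV_gen)

lemma inV_span:
  assumes "inV S x" "Q 0" "\<And>x y. Q x \<Longrightarrow> Q y \<Longrightarrow> Q (x + y)"
    "\<And>c xs. \<forall>y\<in>set xs. snd y \<in> S \<Longrightarrow> Q (sc c (L xs))"
  shows "Q x"
  using assms(1) unfolding inV_def
proof (rule sup_in_span)
  fix c and M :: "gen multiset" assume "\<forall>y\<in>#M. snd y \<in> S"
  then show "Q (sc c (mon M))" unfolding mon_L by (intro assms(4)) simp
qed (use assms in auto)

lemma inV_sig: "inV S x \<Longrightarrow> inV S (sig x)"
  by (auto simp: inV_def sup_in_def cf_sig)

lemma inV_Der:
  assumes "dpar tw d" "\<And>m a. a \<in> S \<Longrightarrow> inV S (d (m, a))" "inV S x"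
  shows "inV S (Der tw d x)"
proof -
  have "inV S (dl tw d xs)" if "\<forall>y\<in>set xs. snd y \<in> S" for xs
    using that
  proof (induction xs)
    case (Cons y xs)
    then have "inV S (tws tw (gen y))" "inV S (d y)"
      using assms(2)[of "snd y" "fst y"] by (auto simp: tws_def inV_gen inV_sig)
    then show ?case using Cons by (auto intro!: inV_add inV_mult inV_L)
  qed simp
  then show ?thesis
    by (intro inV_span[OF assms(3), of "\<lambda>x. inV S (Der tw d x)"])
      (auto simp: Der_L assms(1) intro: inV_add inV_sc)
qed

lemma inV_D: "inV S x \<Longrightarrow> inV S (D x)"
  unfolding D_def by (rule inV_Der[OF dpar_D]) (auto simp: gD_def intro: inV_gen)

lemma inV_Dpow: "inV S x \<Longrightarrow> inV S ((D ^^ m) x)"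
  by (induction m) (auto intro: inV_D)

lemma mem_carrier_cf: "f \<in> sa_carrier gpar \<longleftrightarrow> (\<exists>x. f = cf x)"
  by (metis Abs_supalg_inverse cf)

lemma mem_Vg: "cf x \<in> Vg n \<longleftrightarrow> inV (Bas n) x"
  using cf[of x] by (simp add: Vg_def inV_def sup_in_def)

lemma mem_Vp: "cf x \<in> Vp n \<longleftrightarrow> inV (Bas_p n) x"
  using cf[of x] by (simp add: Vp_def inV_def sup_in_def)

lemma Vg_cf: "f \<in> Vg n \<Longrightarrow> \<exists>x. f = cf x"
  and Vp_cf: "f \<in> Vp n \<Longrightarrow> \<exists>x. f = cf x"
  by (auto simp: Vg_def Vp_def mem_carrier_cf)

definition bar :: "nat \<Rightarrow> mat \<Rightarrow> supalg" where
  "bar n X = (\<Sum>a\<in>Bas n. sc (coord n X a) (gen (0, a)))"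

lemma barV_cf: "barV n X = cf (bar n X)"
  by (simp add: barV_def bar_def cf_gen fun_eq_iff)

definition gbr :: "nat \<Rightarrow> nat \<times> nat \<Rightarrow> nat \<times> nat \<Rightarrow> nat \<Rightarrow> supalg" where
  "gbr n a b k = (if k = 0 then sc ((-1) ^ (bpar a * (bpar b + 1)))
                             (bar n (sbr n (Fb n a) (Fb n b) (bpar a) (bpar b)))
                     else if k = 1 then K (str n (mmul n (Fb n a) (Fb n b)))
                     else 0)"

lemma genbr_cf: "genbr n a b k = cf (gbr n a b k)"
  by (auto simp: genbr_def gbr_def barV_cf sa_scale_cf sa_const_cf zero_cf)

text \<open>The coefficient of chi^k in (D + chi) P, up to the sign of \<open>a\<close>: at even k
  the -2 from D chi + chi D = -2 chi^2 and the 1 from multiplication by chi combine to -1, at odd k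
  only the latter occurs.\<close>

definition chi_step :: "nat \<times> nat \<Rightarrow> (nat \<Rightarrow> supalg) \<Rightarrow> nat \<Rightarrow> supalg" where
  "chi_step a P k = sc ((-1) ^ bpar a) ((if even k then D (P k) else - D (P k)) +
     (if k = 0 then 0 else if even k then - P (k - 1) else P (k - 1)))"

lemma stepop_cf: "stepop a (\<lambda>k. cf (P k)) k = cf (chi_step a P k)"
  by (cases k)
    (auto simp: stepop_def chi_step_def chiD_def chimul_def fun_eq_iff VD_cf sa_add_def sa_scale_def algebra_simps)

definition brg :: "nat \<Rightarrow> nat \<times> nat \<Rightarrow> gen \<Rightarrow> nat \<Rightarrow> supalg" where
  "brg n a y = (case y of (m, b) \<Rightarrow> (chi_step a ^^ m) (gbr n a b))"

lemma brgen_cf: "brgen n a y k = cf (brg n a y k)"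
proof -
  have "(stepop a ^^ m) (genbr n a b) = (\<lambda>k. cf ((chi_step a ^^ m) (gbr n a b) k))" for m b
  proof (induction m)
    case (Suc m)
    have "(stepop a ^^ Suc m) (genbr n a b) = stepop a (\<lambda>k. cf ((chi_step a ^^ m) (gbr n a b) k))"
      by (simp add: Suc)
    then show ?case by (simp add: stepop_cf ext)
  qed (simp add: genbr_cf ext)
  then show ?thesis by (cases y) (simp add: brgen_def brg_def)
qed

definition brw :: "nat \<Rightarrow> nat \<times> nat \<Rightarrow> gen list \<Rightarrow> nat \<Rightarrow> supalg" where
  "brw n a ys k = (\<Sum>i<length ys. sc ((-1) ^ ((bpar a + k) * oddcount gpar (take i ys)))
     (L (take i ys) * brg n a (ys ! i) k * L (drop (Suc i) ys)))"

definition br :: "nat \<Rightarrow> nat \<times> nat \<Rightarrow> supalg \<Rightarrow> nat \<Rightarrow> supalg" where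
  "br n a x k = ext (\<lambda>ys. brw n a ys k) x"

lemma brV_cf: "brV n a (cf x) k = cf (br n a x k)"
proof
  fix N
  have "sa_listprod gpar [cf u, cf v, cf w] = cf (u * v * w)" for u v w
    using cf_listprod[of "[u, v, w]"] by (simp add: mult.assoc)
  then have "brmono n a M k N = cf (brw n a (sorted_list_of_multiset M) k) N" for M
    by (simp add: brmono_def brw_def cf_listprod_gen brgen_cf Let_def del: sa_listprod.simps)
  then show "brV n a (cf x) k N = cf (br n a x k) N"
    by (simp add: brV_def sa_supp_cf br_def ext_def)
qed

subsection \<open>The bracket as an even derivation\<close>

text \<open>A free variable \<open>\<epsilon>\<close> of parity \<open>p(a)\<close>, whose index lies outside of \<open>Bas\<close>, replaces \<open>\<chi>\<close>:
 up to a sign \<open>\<chi>\<^sup>k\<close> becomes \<open>D\<^sup>k \<epsilon>\<close>.  The \<open>\<chi>\<close>-bracket with \<open>a\<close> is then an even derivation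
 that commutes with \<open>D\<close>.\<close>

definition eps :: "nat \<times> nat \<Rightarrow> nat \<Rightarrow> supalg" where
  "eps a k = gen (k, (0, bpar a + 1))"

text \<open>The exponent solves the recursion \<open>es_Suc\<close>. It is forced by
  \<open>D_W\<close>: in \<open>chi_step\<close> the shift from k to k + 1 carries the sign
  (-1)^(p(a) + k), whereas \<open>D\<close> sends \<open>eps a k\<close> to
  \<open>eps a (Suc k)\<close> without one.\<close>

definition es :: "nat \<times> nat \<Rightarrow> nat \<Rightarrow> complex" where
  "es a k = (-1) ^ (bpar a * k + k * (k - 1) div 2)"

lemma bpar_01: "bpar a = 0 \<or> bpar a = 1"
  by (cases a) (auto simp: bpar_def)

lemma gpar_eps: "gpar (k, (0, bpar a + 1)) = odd (bpar a + k)"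
  using bpar_01[of a] by (auto simp: gpar_def bpar_def pp_def)

lemma hp_eps: "hp (odd (bpar a + k)) (eps a k)"
  unfolding eps_def using hp_gen[of "(k, (0, bpar a + 1))"] unfolding gpar_eps .

lemma D_eps [simp]: "D (eps a k) = eps a (Suc k)"
  by (simp add: eps_def)

lemma tri_Suc: "Suc k * k div 2 = k * (k - 1) div 2 + k"
  by (cases k) (auto simp: algebra_simps)

lemma es_0 [simp]: "es a 0 = 1" and es_1: "es a (Suc 0) = (-1) ^ bpar a"
  by (simp_all add: es_def)

lemma es_Suc: "es a (Suc k) = (-1) ^ (bpar a + k) * es a k"
  using tri_Suc[of k] by (simp add: es_def power_add mult_ac)

text \<open>Substitution of \<open>eps a k\<close>, with the sign \<open>es a k\<close>, for chi^k
  in a polynomial of degree below \<open>N\<close>.\<close>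

definition W :: "nat \<times> nat \<Rightarrow> nat \<Rightarrow> (nat \<Rightarrow> supalg) \<Rightarrow> supalg" where
  "W a N P = (\<Sum>k<N. sc (es a k) (eps a k * P k))"

lemma W_cong_bound:
  assumes "\<And>k. k \<ge> N \<Longrightarrow> P k = 0" "N \<le> N'"
  shows "W a N' P = W a N P"
  unfolding W_def using assms by (intro sum.mono_neutral_right) auto

lemma neg1_sq: "(-1::complex) ^ k * (-1) ^ k = 1"
  by (simp flip: power_mult_distrib)

text \<open>This is the point of the test variable: the twisted operator \<open>chi_step\<close>,
  with its correction from chi^2, becomes the plain derivation \<open>D\<close>.\<close>

lemma D_W:
  assumes "P N = 0"
  shows "D (W a N P) = W a (Suc N) (chi_step a P)"
proof -
  have *: "sc (es a k) (eps a k * chi_step a P k) =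
      sc (es a k) (sig (eps a k) * D (P k)) +
      (if k = 0 then 0 else sc (es a (k - 1)) (eps a k * P (k - 1)))" for k
  proof -
    have s: "sig (eps a k) = sc ((-1) ^ (bpar a + k)) (eps a k)"
      using sig_hp[OF hp_eps[of a k]] by auto
    show ?thesis
    proof (cases k)
      case 0
      then show ?thesis using s by (simp add: chi_step_def flip: One_nat_def)
    next
      case (Suc l)
      have "es a k * (-1) ^ bpar a = es a l * (-1) ^ l"
        using neg1_sq[of "bpar a"] unfolding Suc es_Suc by (simp add: power_add)
      with Suc show ?thesis
        using s[unfolded Suc] by (auto simp: chi_step_def power_add algebra_simps)
    qed
  qed
  have "W a (Suc N) (chi_step a P) = (\<Sum>k<Suc N. sc (es a k) (sig (eps a k) * D (P k))) +
      (\<Sum>k<Suc N. if k = 0 then 0 else sc (es a (k - 1)) (eps a k * P (k - 1)))"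
    unfolding W_def * by (simp add: sum.distrib)
  also have "(\<Sum>k<Suc N. if k = 0 then 0 else sc (es a (k - 1)) (eps a k * P (k - 1))) =
      (\<Sum>k<N. sc (es a k) (eps a (Suc k) * P k))"
    unfolding sum.lessThan_Suc_shift by simp
  also have "(\<Sum>k<Suc N. sc (es a k) (sig (eps a k) * D (P k))) =
      (\<Sum>k<N. sc (es a k) (sig (eps a k) * D (P k)))"
    using assms by simp
  finally show ?thesis
    by (simp add: W_def D_sum D_mult sum.distrib add.commute)
qed

lemma chi_step_bound: "(\<And>k. k \<ge> N \<Longrightarrow> P k = 0) \<Longrightarrow> k \<ge> Suc N \<Longrightarrow> chi_step a P k = 0"
  by (cases k) (auto simp: chi_step_def)

lemma brg_bound: "k \<ge> m + 2 \<Longrightarrow> brg n a (m, b) k = 0"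
proof (induction m arbitrary: k)
  case 0
  then show ?case by (simp add: brg_def gbr_def)
next
  case (Suc m)
  have "chi_step a (brg n a (m, b)) k = 0"
    using Suc.prems by (intro chi_step_bound[of "m + 2"] Suc.IH) auto
  then show ?case by (simp add: brg_def)
qed

definition dv0 :: "nat \<Rightarrow> nat \<times> nat \<Rightarrow> nat \<times> nat \<Rightarrow> supalg" where
  "dv0 n a b = W a 2 (gbr n a b)"

definition dv :: "nat \<Rightarrow> nat \<times> nat \<Rightarrow> gen \<Rightarrow> supalg" where
  "dv n a y = (if snd y \<in> Bas n then (D ^^ fst y) (dv0 n a (snd y)) else 0)"

text \<open>The bracket of generators has degree at most 1 in chi and each derivative raises it by
  at most one, hence the bound m + 2 on the number of coefficients.\<close>

lemma W_brg: "N \<ge> m + 2 \<Longrightarrow> W a N (brg n a (m, b)) = (D ^^ m) (dv0 n a b)"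
proof (induction m arbitrary: N)
  case 0
  have "gbr n a b k = 0" if "k \<ge> 2" for k using that by (simp add: gbr_def)
  then show ?case
    using W_cong_bound[of 2 "gbr n a b" N a] 0 by (simp add: brg_def dv0_def)
next
  case (Suc m)
  then obtain N' where N: "N = Suc N'" "N' \<ge> m + 2" by (cases N) auto
  have "W a N (chi_step a (brg n a (m, b))) = D (W a N' (brg n a (m, b)))"
    unfolding N by (intro D_W[symmetric] brg_bound N)
  then show ?case using Suc.IH[OF N(2)] by (simp add: brg_def)
qed

definition hmat :: "nat \<Rightarrow> mat \<Rightarrow> bool" where
  "hmat p X \<longleftrightarrow> (\<forall>k l. X k l \<noteq> 0 \<longrightarrow> even (pp k + pp l + p))"

lemma hmat_mmul: "hmat p X \<Longrightarrow> hmat q Y \<Longrightarrow> hmat (p + q) (mmul n X Y)"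
  unfolding hmat_def mmul_def
proof (intro allI impI)
  fix k l assume h: "\<forall>k l. X k l \<noteq> 0 \<longrightarrow> even (pp k + pp l + p)"
    "\<forall>k l. Y k l \<noteq> 0 \<longrightarrow> even (pp k + pp l + q)" "(\<Sum>i\<in>Iset n. X k i * Y i l) \<noteq> 0"
  then obtain i where "X k i * Y i l \<noteq> 0" by (meson sum.not_neutral_contains_not_neutral)
  then have "even (pp k + pp i + p)" "even (pp i + pp l + q)" using h by auto
  then show "even (pp k + pp l + (p + q))" by presburger
qed

lemma hmat_sbr: assumes "hmat p X" "hmat q Y" shows "hmat (p + q) (sbr n X Y c d)"
  unfolding hmat_def
proof (intro allI impI)
  fix k l assume "sbr n X Y c d k l \<noteq> 0"
  then have "mmul n X Y k l \<noteq> 0 \<or> mmul n Y X k l \<noteq> 0" by (auto simp: sbr_def)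
  then show "even (pp k + pp l + (p + q))"
    using hmat_mmul[OF assms, of n] hmat_mmul[OF assms(2,1), of n] by (auto simp: hmat_def add.commute)
qed

lemma pp_prm: "i \<in> Iset n \<Longrightarrow> pp (prm n i) = pp i"
  by (auto simp: pp_def prm_def Iset_def NN_def mod2_eq_if)

lemma hmat_Fm: "i \<in> Iset n \<Longrightarrow> j \<in> Iset n \<Longrightarrow> hmat (pp i + pp j) (Fm n i j)"
  using pp_prm[of i n] pp_prm[of j n]
  by (auto simp: hmat_def Fm_def emat_def split: if_splits)

lemma hmat_cong: "even p = even q \<Longrightarrow> hmat p X = hmat q X"
  by (auto simp: hmat_def)

lemma Bas_Iset: "(i, j) \<in> Bas n \<Longrightarrow> i \<in> Iset n \<and> j \<in> Iset n"
  by (auto simp: Bas_def)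

lemma hmat_Fb: "a \<in> Bas n \<Longrightarrow> hmat (bpar a) (Fb n a)"
  using hmat_Fm[of "fst a" n "snd a"] Bas_Iset[of "fst a" "snd a" n]
    hmat_cong[of "bpar a" "pp (fst a) + pp (snd a)"]
  by (cases a) (auto simp: bpar_def Fb_def)

lemma hp_bar: assumes "hmat p X" shows "hp (odd (p + 1)) (bar n X)"
  unfolding bar_def
proof (rule hp_sum)
  fix c assume "c \<in> Bas n"
  obtain i j where c: "c = (i, j)" by (cases c)
  show "hp (odd (p + 1)) (sc (coord n X c) (gen (0, c)))"
  proof (cases "X i j = 0")
    case False
    then have "even (pp i + pp j + p)" using assms by (auto simp: hmat_def)
    then have "gpar (0, c) = odd (p + 1)" by (auto simp: gpar_def c bpar_def)
    then show ?thesis using hp_gen[of "(0, c)"] by (simp add: hp_sc)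
  qed (simp add: c coord_def)
qed

lemma str_hmat: assumes "hmat p X" "odd p" shows "str n X = 0"
  unfolding str_def
proof (rule sum.neutral, rule ballI)
  fix i
  have "even (pp i + pp i + p)" if "X i i \<noteq> 0" using assms(1) that unfolding hmat_def by blast
  then show "(-1) ^ pp i * X i i = 0" using assms(2) by auto
qed

lemma finite_Bas [simp]: "finite (Bas n)"
  by (rule finite_subset[of _ "Iset n \<times> Iset n"]) (auto simp: Bas_def Iset_def)

lemma Bas_n_subset: "Bas_n n \<subseteq> Bas n" and Bas_p_subset: "Bas_p n \<subseteq> Bas n"
  by (auto simp: Bas_n_def Bas_p_def)

text \<open>\<open>eps\<close> compensates the parity of \<open>a\<close>, and the supertrace term
  survives only when \<open>a\<close> and \<open>b\<close> have equal parity, by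
  \<open>str_hmat\<close>. The resulting derivation is even.\<close>

lemma hp_dv0: assumes "a \<in> Bas n" "b \<in> Bas n" shows "hp (gpar (0, b)) (dv0 n a b)"
proof -
  have 0: "hp (odd (bpar a + 0) \<noteq> odd (bpar a + bpar b + 1)) (eps a 0 * gbr n a b 0)"
    unfolding gbr_def
    using hp_bar[OF hmat_sbr[OF hmat_Fb[OF assms(1)] hmat_Fb[OF assms(2)]]]
    by (intro hp_mult hp_eps) (simp add: hp_sc)
  have q: "(odd (bpar a + 0) \<noteq> odd (bpar a + bpar b + 1)) = gpar (0, b)"
    by (auto simp: gpar_def)
  have 1: "hp (gpar (0, b)) (eps a 0 * gbr n a b 0)" using 0 unfolding q .
  have 2: "hp (gpar (0, b)) (eps a 1 * gbr n a b 1)"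
  proof (cases "even (bpar a + bpar b)")
    case True
    then have "gpar (0, b) = (odd (bpar a + 1) \<noteq> False)" by (auto simp: gpar_def)
    then show ?thesis using hp_mult[OF hp_eps[of a 1] hp_K] by (simp add: gbr_def)
  next
    case False
    then have "str n (mmul n (Fb n a) (Fb n b)) = 0"
      using str_hmat hmat_mmul[OF hmat_Fb[OF assms(1)] hmat_Fb[OF assms(2)]] by blast
    then show ?thesis by (simp add: gbr_def)
  qed
  show ?thesis
    unfolding dv0_def W_def numeral_2_eq_2 sum.lessThan_Suc
    using 1 2 by (auto intro!: hp_add hp_sc)
qed

lemma dpar_dv: assumes "a \<in> Bas n" shows "dpar False (dv n a)"
  unfolding dpar_def
proof
  fix y :: gen
  show "hp (gpar y \<noteq> False) (dv n a y)"
  proof (cases "snd y \<in> Bas n")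
    case True
    have "(gpar (0, snd y) \<noteq> odd (fst y)) = (gpar y \<noteq> False)"
      by (cases y) (auto simp: gpar_def)
    then show ?thesis
      using Dpow_hp[OF hp_dv0[OF assms True], of "fst y"] True by (simp add: dv_def)
  qed (simp add: dv_def)
qed

definition delta :: "nat \<Rightarrow> nat \<times> nat \<Rightarrow> supalg \<Rightarrow> supalg" where
  "delta n a = Der False (dv n a)"

lemma Der_D_commute:
  assumes "dpar False d" "\<And>x. d (gD x) = D (d x)"
  shows "Der False d (D x) = D (Der False d x)"
proof (rule clinear_eqI[of "\<lambda>x. Der False d (D x)" "\<lambda>x. D (Der False d x)"])
  fix xs
  have s: "sig (d y) = (if gpar y then - d y else d y)" for y
    using sig_hp[of "gpar y" "d y"] dparD[OF assms(1), of y] by simp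
  have sg: "sig (gen y) = (if gpar y then - gen y else gen y)" for y
    using sig_hp[OF hp_gen[of y]] by simp
  have Dg: "D (gen y) = gen (gD y)" for y by (cases y) (simp add: gD_def)
  show "Der False d (D (L xs)) = D (Der False d (L xs))"
  proof (induction xs)
    case Nil
    then show ?case by (simp add: Der_1[OF assms(1)])
  next
    case (Cons y xs)
    then show ?case
      by (auto simp: L_Cons D_mult Der_mult[OF assms(1)] tws_def Der_gen[OF assms(1)] Dg assms(2) s sg algebra_simps)
  qed
qed (simp_all add: clinear_def)

lemma delta_D: assumes "a \<in> Bas n" shows "delta n a (D x) = D (delta n a x)"
  unfolding delta_def
proof (rule Der_D_commute[OF dpar_dv[OF assms]])
  show "dv n a (gD y) = D (dv n a y)" for y by (cases y) (simp add: dv_def gD_def)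
qed

text \<open>Moving \<open>eps a k\<close> between the front and the bracketed letter, past the
  preceding letters, produces exactly the Leibniz sign in \<open>brw\<close>; no other sign is left
  in the derivation.\<close>

lemma delta_br_L:
  assumes a: "a \<in> Bas n" and xs: "\<forall>y\<in>set xs. snd y \<in> Bas n \<and> fst y + 2 \<le> N"
  shows "delta n a (L xs) = W a N (brw n a xs)"
proof -
  have "W a N (brw n a xs) = (\<Sum>k<N. \<Sum>i<length xs. sc (es a k)
     (eps a k * sc ((-1) ^ ((bpar a + k) * oddcount gpar (take i xs))) (L (take i xs)) * brg n a (xs ! i) k * L (drop (Suc i) xs)))"
    by (simp add: W_def brw_def sum_distrib_left sc_sum mult.assoc)
  also have "\<dots> = (\<Sum>k<N. \<Sum>i<length xs. sc (es a k)
     (L (take i xs) * eps a k * brg n a (xs ! i) k * L (drop (Suc i) xs)))"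
  proof (intro sum.cong refl)
    fix k i
    have "L (take i xs) * eps a k = sc ((-1) ^ ((bpar a + k) * oddcount gpar (take i xs))) (eps a k * L (take i xs))"
      using hp_comm[OF L_hp hp_eps, of "take i xs" a k]
      unfolding mpar_oddcount sgn2_power by (simp add: mult.commute)
    then show "sc (es a k) (eps a k * sc ((-1) ^ ((bpar a + k) * oddcount gpar (take i xs))) (L (take i xs)) * brg n a (xs ! i) k * L (drop (Suc i) xs))
      = sc (es a k) (L (take i xs) * eps a k * brg n a (xs ! i) k * L (drop (Suc i) xs))"
      by simp
  qed
  also have "\<dots> = (\<Sum>i<length xs. L (take i xs) * W a N (brg n a (xs ! i)) * L (drop (Suc i) xs))"
    unfolding W_def sum_distrib_left sum_distrib_right
    by (subst sum.swap) (simp add: mult.assoc)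
  also have "\<dots> = (\<Sum>i<length xs. L (take i xs) * dv n a (xs ! i) * L (drop (Suc i) xs))"
  proof (intro sum.cong refl)
    fix i assume "i \<in> {..<length xs}"
    then have "xs ! i \<in> set xs" by simp
    then have "snd (xs ! i) \<in> Bas n" "fst (xs ! i) + 2 \<le> N" using xs by auto
    then have "W a N (brg n a (xs ! i)) = dv n a (xs ! i)"
      using W_brg[of "fst (xs ! i)" N a n "snd (xs ! i)"] by (simp add: dv_def)
    then show "L (take i xs) * W a N (brg n a (xs ! i)) * L (drop (Suc i) xs) = L (take i xs) * dv n a (xs ! i) * L (drop (Suc i) xs)"
      by simp
  qed
  also have "\<dots> = delta n a (L xs)"
    unfolding delta_def Der_L[OF dpar_dv[OF a]] dl_sum tws_def by simp
  finally show ?thesis ..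
qed

lemma delta_br:
  assumes a: "a \<in> Bas n" and x: "inV (Bas n) x"
  shows "\<exists>N0. \<forall>N\<ge>N0. delta n a x = W a N (br n a x)"
proof -
  \<comment> \<open>Large enough for \<open>W_brg\<close> on every letter occurring in
    \<open>x\<close>.\<close>
  define N0 where "N0 = (\<Sum>M\<in>supp x. \<Sum>y\<in>set_mset M. fst y + 2)"
  have "delta n a x = W a N (br n a x)" if N: "N \<ge> N0" for N
  proof -
    have *: "delta n a (mon M) = W a N (brw n a (sorted_list_of_multiset M))" if M: "M \<in> supp x" for M
    proof -
      have "\<forall>y\<in>#M. snd y \<in> Bas n" using x M by (simp add: inV_def sup_in_def supp_def)
      moreover have "fst y + 2 \<le> N" if "y \<in># M" for y
      proof -
        have "fst y + 2 \<le> (\<Sum>y\<in>set_mset M. fst y + 2)"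
          using that by (intro member_le_sum) auto
        also have "\<dots> \<le> N0"
          unfolding N0_def using M by (intro member_le_sum[of M "supp x" "\<lambda>M. \<Sum>y\<in>set_mset M. fst y + 2"]) auto
        finally show ?thesis using N by simp
      qed
      ultimately show ?thesis unfolding mon_L by (intro delta_br_L[OF a]) auto
    qed
    have "delta n a x = (\<Sum>M\<in>supp x. sc (cf x M) (delta n a (mon M)))"
      using expand_mon[of "supp x" x] clinear_sum[of "delta n a"] unfolding delta_def
      by (metis (no_types, lifting) Der_sc finite_supp clinear_Der clinear_sum order_refl sum.cong)
    also have "\<dots> = (\<Sum>M\<in>supp x. sc (cf x M) (W a N (brw n a (sorted_list_of_multiset M))))"
      using * by (intro sum.cong) auto
    also have "\<dots> = W a N (br n a x)"
      unfolding W_def br_def ext_def sc_sum sum_distrib_left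
      by (subst sum.swap) (simp add: mult.commute)
    finally show ?thesis .
  qed
  then show ?thesis by blast
qed

subsection \<open>Reduction modulo the ideal\<close>

lemma Hom_D_commute:
  assumes h: "parity_pres h" and hD: "\<And>x. h (gD x) = D (h x)"
  shows "Hom h (D x) = D (Hom h x)"
proof (rule clinear_eqI[of "\<lambda>x. Hom h (D x)" "\<lambda>x. D (Hom h x)"])
  fix xs
  have s: "sig (h y) = (if gpar y then - h y else h y)" for y
    using sig_hp[OF parity_presD[OF h, of y]] by simp
  have sg: "sig (gen y) = (if gpar y then - gen y else gen y)" for y
    using sig_hp[OF hp_gen[of y]] by simp
  have Dg: "D (gen y) = gen (gD y)" for y by (cases y) (simp add: gD_def)
  show "Hom h (D (L xs)) = D (Hom h (L xs))"
  proof (induction xs)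
    case Nil
    then show ?case by (simp add: Hom_1[OF h])
  next
    case (Cons y xs)
    then show ?case
      by (auto simp: L_Cons D_mult Hom_mult[OF h] Hom_gen[OF h] Dg hD s sg)
  qed
qed (simp_all add: clinear_def)

lemma inV_Hom:
  assumes "parity_pres h" "\<And>y. snd y \<in> S \<Longrightarrow> inV T (h y)" "inV S x"
  shows "inV T (Hom h x)"
proof -
  have "inV T (prod_list (map h xs))" if "\<forall>y\<in>set xs. snd y \<in> S" for xs
    using that by (induction xs) (auto intro: inV_mult assms(2))
  then show ?thesis
    by (intro inV_span[OF assms(3), of "\<lambda>x. inV T (Hom h x)"])
      (auto simp: Hom_L assms(1) intro: inV_add inV_sc)
qed

lemma Hom_id:
  assumes "parity_pres h" "\<And>y. snd y \<in> S \<Longrightarrow> h y = gen y" "inV S x"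
  shows "Hom h x = x"
proof -
  have "prod_list (map h xs) = L xs" if "\<forall>y\<in>set xs. snd y \<in> S" for xs
    using that by (induction xs) (auto simp: L_Cons assms(2))
  then show ?thesis
    by (intro inV_span[OF assms(3), of "\<lambda>x. Hom h x = x"]) (auto simp: Hom_L assms(1))
qed

text \<open>The quotient map from V(g) to V(p): the variables of n become the constants (f|n), whose
  derivatives vanish. Its kernel on V(g) turns out to be \<open>Jid\<close>, see
  \<open>Jid_iff\<close>.\<close>

definition rh :: "nat \<Rightarrow> gen \<Rightarrow> supalg" where
  "rh n y = (if snd y \<in> Bas_n n then (if fst y = 0 then K (str n (mmul n (fmat n) (Fb n (snd y)))) else 0)
     else gen y)"

definition rho :: "nat \<Rightarrow> supalg \<Rightarrow> supalg" where "rho n = Hom (rh n)"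

lemma hmat_fmat: "hmat 1 (fmat n)"
  unfolding hmat_def
proof (intro allI impI)
  fix k l assume "fmat n k l \<noteq> 0"
  then obtain i where i: "i \<in> {1..2*n-1}" "Fm n (i + 1) i k l \<noteq> 0"
    unfolding fmat_def by (meson sum.not_neutral_contains_not_neutral)
  then have "i + 1 \<in> Iset n" "i \<in> Iset n" by (auto simp: Iset_def NN_def)
  then have "even (pp k + pp l + (pp (i + 1) + pp i))" using hmat_Fm i unfolding hmat_def by blast
  moreover have "odd (pp (i + 1) + pp i)" by (auto simp: pp_def mod2_eq_if)
  ultimately show "even (pp k + pp l + 1)" by auto
qed

text \<open>A nonzero constant may only replace an even variable. As f is odd, (f|n) vanishes unless
  n is odd, and then the barred variable is even.\<close>

lemma parity_pres_rh: "parity_pres (rh n)"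
  unfolding parity_pres_def
proof
  fix y :: gen
  show "hp (gpar y) (rh n y)"
  proof (cases "snd y \<in> Bas_n n \<and> fst y = 0")
    case True
    then have b: "snd y \<in> Bas n" using Bas_n_subset by blast
    show ?thesis
    proof (cases "odd (bpar (snd y))")
      case True
      with \<open>snd y \<in> Bas_n n \<and> fst y = 0\<close> have "gpar y = False"
        by (cases y) (auto simp: gpar_def)
      then show ?thesis using \<open>snd y \<in> Bas_n n \<and> fst y = 0\<close> by (simp add: rh_def)
    next
      case False
      then have "str n (mmul n (fmat n) (Fb n (snd y))) = 0"
        by (intro str_hmat[OF hmat_mmul[OF hmat_fmat hmat_Fb[OF b]]]) simp
      then show ?thesis using \<open>snd y \<in> Bas_n n \<and> fst y = 0\<close> by (simp add: rh_def)
    qed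
  next
    case False
    then have "rh n y = 0 \<or> rh n y = gen y" by (auto simp: rh_def)
    then show ?thesis by auto
  qed
qed

lemma rho_add [simp]: "rho n (x + y) = rho n x + rho n y"
  and rho_diff [simp]: "rho n (x - y) = rho n x - rho n y"
  and rho_uminus [simp]: "rho n (- x) = - rho n x"
  and rho_sc [simp]: "rho n (sc c x) = sc c (rho n x)"
  and rho_0 [simp]: "rho n 0 = 0"
  and rho_1 [simp]: "rho n 1 = 1"
  and rho_K [simp]: "rho n (K c) = K c"
  and rho_mult: "rho n (x * y) = rho n x * rho n y"
  and rho_gen: "rho n (gen g) = rh n g"
  by (simp_all add: rho_def parity_pres_rh Hom_1 Hom_K Hom_mult Hom_gen)

lemma rho_sum: "rho n (\<Sum>i\<in>I. f i) = (\<Sum>i\<in>I. rho n (f i))"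
  by (simp add: rho_def clinear_sum)

lemma rho_D: "rho n (D x) = D (rho n x)"
  unfolding rho_def
proof (rule Hom_D_commute[OF parity_pres_rh])
  show "rh n (gD y) = D (rh n y)" for y by (cases y) (auto simp: rh_def gD_def)
qed

lemma rho_Dpow: "rho n ((D ^^ m) x) = (D ^^ m) (rho n x)"
  by (induction m) (auto simp: rho_D)

lemma rho_eps [simp]: "rho n (eps a k) = eps a k"
  by (auto simp: eps_def rho_gen rh_def Bas_n_def Bas_def Iset_def)

lemma Bas_cases: "b \<in> Bas n \<longleftrightarrow> b \<in> Bas_n n \<or> b \<in> Bas_p n"
  by (auto simp: Bas_n_def Bas_p_def)

lemma Bas_disjoint: "b \<in> Bas_p n \<Longrightarrow> b \<notin> Bas_n n"
  by (auto simp: Bas_n_def Bas_p_def)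

lemma inV_rho: "inV (Bas n) x \<Longrightarrow> inV (Bas_p n) (rho n x)"
  unfolding rho_def
  by (rule inV_Hom[OF parity_pres_rh]) (auto simp: rh_def Bas_cases intro: inV_gen)

lemma rho_id: "S \<inter> Bas_n n = {} \<Longrightarrow> inV S x \<Longrightarrow> rho n x = x"
  unfolding rho_def by (rule Hom_id[OF parity_pres_rh]) (auto simp: rh_def)

lemma hp_comm_any:
  assumes "hp p z" shows "z * y = (if p then sig y else y) * z"
proof (rule clinear_eq_monI[of "\<lambda>y. z * y" "\<lambda>y. (if p then sig y else y) * z"])
  fix M
  show "z * mon M = (if p then sig (mon M) else mon M) * z"
    using hp_comm[OF assms hp_mon[of M]] sig_hp[OF hp_mon[of M]] by (cases p; cases "mpar M") auto
qed (auto simp: clinear_def distrib_left distrib_right)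

text \<open>The kernel of \<open>rho\<close> on V(g) is itself a differential ideal containing the
  generators, hence contains the smallest one.\<close>

lemma Jid_rho_0:
  assumes "cf x \<in> Jid n" shows "rho n x = 0"
proof -
  define S where "S = {cf x | x. inV (Bas n) x \<and> rho n x = 0}"
  have S: "cf x \<in> S \<longleftrightarrow> inV (Bas n) x \<and> rho n x = 0" for x
    by (auto simp: S_def cf_inject)
  have "is_diff_ideal n S"
    unfolding is_diff_ideal_def
  proof (intro conjI ballI)
    show "S \<subseteq> Vg n" by (auto simp: S_def mem_Vg)
    fix f assume "f \<in> S"
    then obtain x where x: "f = cf x" "inV (Bas n) x" "rho n x = 0" by (auto simp: S_def)
    show "VD f \<in> S" using x by (simp add: VD_cf S inV_D rho_D)
    show "sa_add f g \<in> S" if g: "g \<in> S" for g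
    proof -
      obtain y where "g = cf y" "inV (Bas n) y" "rho n y = 0" using g by (auto simp: S_def)
      then show ?thesis using x by (simp add: sa_add_cf S inV_add)
    qed
    show "Vmult v f \<in> S" if v: "v \<in> Vg n" for v
    proof -
      obtain y where "v = cf y" using Vg_cf v by blast
      then show ?thesis using x v by (simp add: Vmult_cf S mem_Vg rho_mult inV_mult)
    qed
  qed
  moreover have "Jgens n \<subseteq> S"
  proof
    fix f assume "f \<in> Jgens n"
    then obtain a where a: "a \<in> Bas_n n"
      "f = sa_add (sa_gen (0, a)) (sa_const (- str n (mmul n (fmat n) (Fb n a))))"
      by (auto simp: Jgens_def)
    have "f = cf (gen (0, a) - K (str n (mmul n (fmat n) (Fb n a))))"
      by (simp add: a(2) sa_add_def sa_const_cf cf_gen fun_eq_iff K_uminus)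
    then show "f \<in> S" using a(1) subsetD[OF Bas_n_subset a(1)]
      by (auto simp: S rho_gen rh_def intro!: inV_diff inV_gen)
  qed
  ultimately have "Jid n \<subseteq> S" unfolding Jid_def by blast
  with assms S show ?thesis by blast
qed

lemma Jid_add: "cf x \<in> Jid n \<Longrightarrow> cf y \<in> Jid n \<Longrightarrow> cf (x + y) \<in> Jid n"
  and Jid_mult: "inV (Bas n) v \<Longrightarrow> cf x \<in> Jid n \<Longrightarrow> cf (v * x) \<in> Jid n"
  and Jid_D: "cf x \<in> Jid n \<Longrightarrow> cf (D x) \<in> Jid n"
  unfolding Jid_def is_diff_ideal_def mem_Vg[symmetric]
  by (auto simp flip: sa_add_cf Vmult_cf VD_cf)

lemma Jid_gen: "a \<in> Bas_n n \<Longrightarrow> cf (gen (0, a) - K (str n (mmul n (fmat n) (Fb n a)))) \<in> Jid n"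
proof -
  assume a: "a \<in> Bas_n n"
  have "cf (gen (0, a) - K (str n (mmul n (fmat n) (Fb n a)))) \<in> Jgens n"
    unfolding Jgens_def mem_Collect_eq
    by (rule exI[of _ a]) (use a in \<open>simp add: sa_add_def sa_const_cf cf_gen fun_eq_iff K_uminus\<close>)
  then show ?thesis by (auto simp: Jid_def)
qed

lemma Jid_0: assumes "n \<ge> 1" shows "cf 0 \<in> Jid n"
proof -
  have "(1, 2) \<in> Bas_n n" using assms by (auto simp: Bas_n_def Bas_def Iset_def NN_def)
  from Jid_mult[OF inV_0 Jid_gen[OF this]] show ?thesis by simp
qed

text \<open>Induction along words: each letter y is congruent to its image y', and y u - y' u' = y
  (u - u') + (y - y') u'.\<close>

lemma Jid_diff_rho:
  assumes n: "n \<ge> 1" and x: "inV (Bas n) x" shows "cf (x - rho n x) \<in> Jid n"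
  using x
proof (rule inV_span)
  fix c and xs :: "gen list" assume "\<forall>y\<in>set xs. snd y \<in> Bas n"
  then have "cf (L xs - rho n (L xs)) \<in> Jid n"
  proof (induction xs)
    case Nil
    have "L [] - rho n (L []) = 0" by simp
    then show ?case using Jid_0[OF n] by metis
  next
    case (Cons y xs)
    define z where "z = gen y - rh n y"
    have "cf z \<in> Jid n"
    proof (cases "snd y \<in> Bas_n n")
      case True
      have "cf (gen (m, snd y) - rh n (m, snd y)) \<in> Jid n" for m
      proof (induction m)
        case 0
        then show ?case using Jid_gen[OF True] True by (simp add: rh_def del: cf_diff)
      next
        case (Suc m)
        have "D (gen (m, snd y) - rh n (m, snd y)) = gen (Suc m, snd y) - rh n (Suc m, snd y)"
          using True by (simp add: rh_def)
        with Jid_D[OF Suc] show ?case by metis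
      qed
      from this[of "fst y"] show ?thesis by (simp add: z_def del: cf_diff)
    next
      case False
      then have "z = 0" by (simp add: z_def rh_def)
      then show ?thesis using Jid_0[OF n] by metis
    qed
    moreover have "hp (gpar y) z"
      unfolding z_def hp_def
      by (intro sup_in_diff) (simp_all add: hp_def[symmetric] parity_presD[OF parity_pres_rh])
    moreover have "inV (Bas n) (rho n (L xs))"
      using Cons.prems by (intro inV_mono[OF inV_rho Bas_p_subset] inV_L) auto
    \<comment> \<open>\<open>is_diff_ideal\<close> provides left multiples, so \<open>z\<close> is
      first moved to the right of the other factor.\<close>
    ultimately have "cf (z * rho n (L xs)) \<in> Jid n"
      using hp_comm_any[of "gpar y" z "rho n (L xs)"]
      by (auto intro!: Jid_mult inV_sig)
    moreover have "cf (gen y * (L xs - rho n (L xs))) \<in> Jid n"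
      using Cons by (intro Jid_mult) (auto intro: inV_gen simp del: cf_diff)
    ultimately have "cf (gen y * (L xs - rho n (L xs)) + z * rho n (L xs)) \<in> Jid n"
      by (rule Jid_add[rotated])
    moreover have "gen y * (L xs - rho n (L xs)) + z * rho n (L xs) = L (y # xs) - rho n (L (y # xs))"
      by (simp add: L_Cons rho_mult rho_gen z_def algebra_simps)
    ultimately show ?case by metis
  qed
  from Jid_mult[OF inV_K this, of c]
  show "cf (sc c (L xs) - rho n (sc c (L xs))) \<in> Jid n" by (simp del: cf_diff cf_sc)
next
  fix x y assume "cf (x - rho n x) \<in> Jid n" "cf (y - rho n y) \<in> Jid n"
  from Jid_add[OF this] show "cf (x + y - rho n (x + y)) \<in> Jid n" by (simp add: add_diff_add del: cf_diff cf_add)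
next
  have "0 - rho n 0 = 0" by simp
  then show "cf (0 - rho n 0) \<in> Jid n" using Jid_0[OF n] by metis
qed

lemma Jid_iff: "n \<ge> 1 \<Longrightarrow> inV (Bas n) x \<Longrightarrow> cf x \<in> Jid n \<longleftrightarrow> rho n x = 0"
  using Jid_rho_0[of x n] Jid_diff_rho[of n x] by auto

subsection \<open>Coefficients along fresh variables\<close>

lemma cf_gen_mult:
  "cf (gen z * y) M = (if z \<in># M then msign gpar {#z#} (M - {#z#}) * cf y (M - {#z#}) else 0)"
proof -
  have "cf (gen z * y) M = (\<Sum>A\<in>{A. A \<subseteq># M}. if A = {#z#} then msign gpar {#z#} (M - {#z#}) * cf y (M - {#z#}) else 0)"
    unfolding cf_mult by (rule sum.cong) (auto simp: gen_def cf_mon)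
  then show ?thesis by (simp add: sum.delta finite_subsets_mset)
qed

lemma msign_single:
  assumes "valid_mono gpar M" "z \<notin># M"
  shows "msign gpar {#z#} M \<noteq> 0"
proof -
  have "valid_mono gpar (add_mset z M)"
    using assms by (auto simp: valid_mono_def not_in_iff)
  then show ?thesis by (simp add: msign_inv)
qed

text \<open>No \<open>z i\<close> occurs in any \<open>y j\<close>, so the coefficient of
  \<open>z i\<close> times a monomial over \<open>S\<close> comes from the summand \<open>i\<close>
  alone.\<close>

lemma fresh_coefficients:
  assumes "finite I" "inj_on z I" "\<And>i. i \<in> I \<Longrightarrow> snd (z i) \<notin> S" "\<And>i. i \<in> I \<Longrightarrow> inV S (y i)"
    and "(\<Sum>i\<in>I. gen (z i) * y i) = 0" and "i \<in> I"
  shows "y i = 0"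
proof (rule supalg_eqI)
  fix M
  show "cf (y i) M = cf 0 M"
  proof (cases "cf (y i) M = 0")
    case False
    then have M: "\<forall>v\<in>#M. snd v \<in> S" using assms(4)[OF assms(6)] by (auto simp: inV_def sup_in_def)
    then have zi: "z j \<notin># M" if "j \<in> I" for j using assms(3)[OF that] by blast
    have "cf (gen (z j) * y j) (add_mset (z i) M) = (if j = i then msign gpar {#z i#} M * cf (y i) M else 0)"
      if "j \<in> I" for j
      using zi[OF that] assms(2,6) that by (auto simp: cf_gen_mult inj_on_def)
    then have "cf (\<Sum>j\<in>I. gen (z j) * y j) (add_mset (z i) M)
        = (\<Sum>j\<in>I. if j = i then msign gpar {#z i#} M * cf (y i) M else 0)"
      unfolding cf_sum by (intro sum.cong) auto
    also have "\<dots> = msign gpar {#z i#} M * cf (y i) M"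
      using assms(1,6) by (simp add: sum.delta)
    finally have "msign gpar {#z i#} M * cf (y i) M = 0" using assms(5) by simp
    then show ?thesis using msign_single[OF cf_valid[OF False] zi[OF assms(6)]] by simp
  qed simp
qed

subsection \<open>The W-algebra\<close>

text \<open>Membership in W without chi: all coefficients of the bracket with \<open>a\<close> are
  packed into one value of an even derivation.\<close>

definition inW :: "nat \<Rightarrow> supalg \<Rightarrow> bool" where
  "inW n x \<longleftrightarrow> inV (Bas_p n) x \<and> (\<forall>a\<in>Bas_n n. rho n (delta n a x) = 0)"

lemma inV_bar: "inV (Bas n) (bar n X)"
  unfolding bar_def by (intro inV_sum inV_sc inV_gen) simp

lemma inV_br: assumes "inV (Bas n) x" shows "inV (Bas n) (br n a x k)"
proof -
  have st: "inV (Bas n) (chi_step a P k)" if "\<And>k. inV (Bas n) (P k)" for P k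
    unfolding chi_step_def
    using that inV_sc[OF that, of "-1"] inV_D[OF that] inV_sc[OF inV_D[OF that], of "-1"]
    by (intro inV_sc inV_add) auto
  have g: "inV (Bas n) (brg n a y k)" for y k
  proof -
    have "inV (Bas n) ((chi_step a ^^ m) (gbr n a b) k)" for m b k
      by (induction m arbitrary: k) (auto simp: gbr_def intro: st inV_sc inV_bar)
    then show ?thesis by (cases y) (simp add: brg_def)
  qed
  have w: "inV (Bas n) (brw n a xs k)" if "\<forall>y\<in>set xs. snd y \<in> Bas n" for xs
    unfolding brw_def using that g
    by (intro inV_sum inV_sc inV_mult inV_L) (auto dest: in_set_takeD in_set_dropD)
  show ?thesis
    unfolding br_def ext_def
  proof (intro inV_sum inV_sc w)
    fix M assume "M \<in> supp x"
    then show "\<forall>y\<in>set (sorted_list_of_multiset M). snd y \<in> Bas n"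
      using assms by (simp add: inV_def sup_in_def supp_def)
  qed
qed

lemma es_nonzero: "es a k \<noteq> 0" by (simp add: es_def)

text \<open>The derivatives of the test variable are independent over V(p), so a vanishing sum makes
  every chi-coefficient vanish modulo the ideal.\<close>

lemma Walg_iff:
  assumes n: "n \<ge> 1" shows "cf x \<in> Walg n \<longleftrightarrow> inW n x"
proof (cases "inV (Bas_p n) x")
  case True
  then have x: "inV (Bas n) x" using inV_mono Bas_p_subset by blast
  have "(\<forall>k. brV n a (cf x) k \<in> Jid n) \<longleftrightarrow> rho n (delta n a x) = 0" if a: "a \<in> Bas_n n" for a
  proof -
    have aB: "a \<in> Bas n" using a Bas_n_subset by blast
    obtain N0 where N0: "\<And>N. N \<ge> N0 \<Longrightarrow> delta n a x = W a N (br n a x)"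
      using delta_br[OF aB x] by blast
    have J: "brV n a (cf x) k \<in> Jid n \<longleftrightarrow> rho n (br n a x k) = 0" for k
      unfolding brV_cf by (rule Jid_iff[OF n inV_br[OF x]])
    have r: "rho n (delta n a x) = (\<Sum>k<N. eps a k * sc (es a k) (rho n (br n a x k)))" if "N \<ge> N0" for N
      using N0[OF that] by (simp add: W_def rho_sum rho_mult)
    show ?thesis
    proof
      assume "\<forall>k. brV n a (cf x) k \<in> Jid n"
      then show "rho n (delta n a x) = 0" using r[of N0] J by simp
    next
      assume 0: "rho n (delta n a x) = 0"
      show "\<forall>k. brV n a (cf x) k \<in> Jid n"
      proof
        fix k
        define N where "N = max N0 (Suc k)"
        have "sc (es a k) (rho n (br n a x k)) = 0"
        proof (rule fresh_coefficients[of "{..<N}" "\<lambda>k. (k, (0, bpar a + 1))" "Bas_p n" "\<lambda>k. sc (es a k) (rho n (br n a x k))"])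
          show "(\<Sum>i<N. gen (i, 0, bpar a + 1) * sc (es a i) (rho n (br n a x i))) = 0"
            using r[of N] 0 by (simp add: N_def eps_def)
          show "inV (Bas_p n) (sc (es a i) (rho n (br n a x i)))" for i
            by (intro inV_sc inV_rho inV_br x)
        qed (auto simp: inj_on_def N_def Bas_p_def Bas_def Iset_def)
        then have "sc (inverse (es a k)) (sc (es a k) (rho n (br n a x k))) = 0" by simp
        then have "rho n (br n a x k) = 0" using es_nonzero[of a k] by (simp only: sc_sc left_inverse sc_1_left) simp
        then show "brV n a (cf x) k \<in> Jid n" by (simp add: J)
      qed
    qed
  qed
  then show ?thesis using True by (auto simp: Walg_def inW_def mem_Vp)
qed (simp add: Walg_def inW_def mem_Vp)

lemma Walg_cf: "f \<in> Walg n \<Longrightarrow> \<exists>x. f = cf x"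
  using Vp_cf by (auto simp: Walg_def)

lemma delta_add [simp]: "delta n a (x + y) = delta n a x + delta n a y"
  and delta_diff [simp]: "delta n a (x - y) = delta n a x - delta n a y"
  and delta_uminus [simp]: "delta n a (- x) = - delta n a x"
  and delta_sc [simp]: "delta n a (sc c x) = sc c (delta n a x)"
  and delta_0 [simp]: "delta n a 0 = 0"
  by (simp_all add: delta_def)

lemma delta_sum: "delta n a (\<Sum>i\<in>I. f i) = (\<Sum>i\<in>I. delta n a (f i))"
  by (simp add: delta_def clinear_sum)

lemma delta_mult: "a \<in> Bas n \<Longrightarrow> delta n a (x * y) = delta n a x * y + x * delta n a y"
  using Der_mult[OF dpar_dv] by (simp add: delta_def tws_def)

lemma delta_gen: "a \<in> Bas n \<Longrightarrow> delta n a (gen y) = dv n a y"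
  using Der_gen[OF dpar_dv] by (simp add: delta_def)

lemma delta_1: "a \<in> Bas n \<Longrightarrow> delta n a 1 = 0"
  using Der_1[OF dpar_dv] by (simp add: delta_def)

lemma inW_0: "inW n 0" and inW_1: "inW n 1"
  using Bas_n_subset by (auto simp: inW_def delta_1 subset_iff)

lemma inW_add: "inW n x \<Longrightarrow> inW n y \<Longrightarrow> inW n (x + y)"
  and inW_diff: "inW n x \<Longrightarrow> inW n y \<Longrightarrow> inW n (x - y)"
  and inW_sc: "inW n x \<Longrightarrow> inW n (sc c x)"
  by (auto simp: inW_def intro: inV_add inV_diff inV_sc)

lemma inW_sum: "(\<And>i. i \<in> I \<Longrightarrow> inW n (f i)) \<Longrightarrow> inW n (sum f I)"
  by (induction I rule: infinite_finite_induct) (auto intro: inW_0 inW_add)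

lemma inW_mult: "inW n x \<Longrightarrow> inW n y \<Longrightarrow> inW n (x * y)"
  using Bas_n_subset by (auto simp: inW_def delta_mult rho_mult subset_iff intro: inV_mult)

lemma inW_D: "inW n x \<Longrightarrow> inW n (D x)"
  using Bas_n_subset by (auto simp: inW_def delta_D rho_D subset_iff intro: inV_D)

lemma inW_Dpow: "inW n x \<Longrightarrow> inW n ((D ^^ m) x)"
  by (induction m) (auto intro: inW_D)

lemma inW_prod_list: "\<forall>x\<in>set xs. inW n x \<Longrightarrow> inW n (prod_list xs)"
  by (induction xs) (auto intro: inW_1 inW_mult)

subsection \<open>The orthosymplectic matrices\<close>

lemma prm_Iset [simp]: "i \<in> Iset n \<Longrightarrow> prm n i \<in> Iset n"
  and prm_prm [simp]: "i \<in> Iset n \<Longrightarrow> prm n (prm n i) = i"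
  by (auto simp: Iset_def NN_def prm_def)

lemma pp_01: "pp i = 0 \<or> pp i = 1"
  by (auto simp: pp_def)

lemma even_pp [simp]: "even (pp i) = even i"
  by (auto simp: pp_def mod2_eq_if)

lemma neg1_even_iff: "(-1::complex) ^ k = (if even k then 1 else -1)"
  by simp

lemma neg1_cong: "even k = even l \<Longrightarrow> (-1::complex) ^ k = (-1) ^ l"
  by (simp add: neg1_even_iff)

text \<open>The self-dual index 2n is even, so for odd i exactly one of i and i' lies in the upper
  half, where \<open>dlt\<close> is 1.\<close>

lemma dlt_prm: "i \<in> Iset n \<Longrightarrow> dlt n i + dlt n (prm n i) = pp i"
proof -
  assume i: "i \<in> Iset n"
  consider "i < 2 * n" | "i = 2 * n" | "i > 2 * n" by linarith
  then show ?thesis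
    using i by cases (auto simp: dlt_def prm_def Iset_def NN_def pp_def mod2_eq_if)
qed

text \<open>This cocycle identity says that \<open>\<theta>\<close> is an automorphism.\<close>

lemma th_compose:
  "th_sign n a b * th_sign n b c = - ((-1) ^ ((pp a + pp b) * (pp b + pp c)) * th_sign n a c)"
proof -
  have "th_sign n a b * th_sign n b c =
    (-1) ^ ((pp a * pp b + pp b + 1 + dlt n a + dlt n b) + (pp b * pp c + pp c + 1 + dlt n b + dlt n c))"
    by (simp only: th_sign_def power_add)
  also have "\<dots> = (-1) ^ (1 + (pp a + pp b) * (pp b + pp c) + (pp a * pp c + pp c + 1 + dlt n a + dlt n c))"
    by (rule neg1_cong) auto
  also have "\<dots> = - ((-1) ^ ((pp a + pp b) * (pp b + pp c)) * th_sign n a c)"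
    by (simp add: th_sign_def power_add)
  finally show ?thesis .
qed

lemma th_diag: "th_sign n i i = -1"
  unfolding th_sign_def by (simp add: neg1_even_iff)

lemma th_swap: "th_sign n i j * th_sign n j i = (-1) ^ (pp i + pp j)"
  unfolding th_compose th_diag using pp_01[of i] pp_01[of j] by auto

lemma th_square: "th_sign n i j * th_sign n i j = 1"
  unfolding th_sign_def by (simp flip: power_add mult_2)

lemma th_prm: "i \<in> Iset n \<Longrightarrow> j \<in> Iset n \<Longrightarrow> th_sign n (prm n j) (prm n i) = th_sign n i j"
proof -
  assume i: "i \<in> Iset n" and j: "j \<in> Iset n"
  have "even (dlt n (prm n k)) = (even k = even (dlt n k))" if "k \<in> Iset n" for k
    using dlt_prm[OF that] by (metis even_add even_pp)
  then show ?thesis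
    unfolding th_sign_def using i j by (intro neg1_cong) (auto simp: pp_prm)
qed

text \<open>The fixed points of theta, that is, the elements of g described by their entries.
  Matrices are total functions, hence the vanishing outside the index set.\<close>

definition Gmat :: "nat \<Rightarrow> mat \<Rightarrow> bool" where
  "Gmat n X \<longleftrightarrow> (\<forall>k l. X k l \<noteq> 0 \<longrightarrow> k \<in> Iset n \<and> l \<in> Iset n) \<and>
     (\<forall>k\<in>Iset n. \<forall>l\<in>Iset n. X k l = th_sign n (prm n l) (prm n k) * X (prm n l) (prm n k))"

lemma Gmat_sym:
  assumes "Gmat n X" "k \<in> Iset n" "l \<in> Iset n"
  shows "X k l = th_sign n k l * X (prm n l) (prm n k)"
  using assms th_prm[of k n l] unfolding Gmat_def by metis

lemma Gmat_out: "Gmat n X \<Longrightarrow> k \<notin> Iset n \<or> l \<notin> Iset n \<Longrightarrow> X k l = 0"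
  unfolding Gmat_def by blast

lemma Gmat_Fm: assumes "a \<in> Iset n" "b \<in> Iset n" shows "Gmat n (Fm n a b)"
  unfolding Gmat_def
proof (intro conjI allI ballI impI)
  fix k l
  show "k \<in> Iset n" "l \<in> Iset n" if "Fm n a b k l \<noteq> 0"
    using that assms by (auto simp: Fm_def emat_def split: if_splits)
  assume k: "k \<in> Iset n" and l: "l \<in> Iset n"
  have e1: "emat a b (prm n l) (prm n k) = emat (prm n b) (prm n a) k l"
    using assms k l by (auto simp: emat_def)
  have e2: "emat (prm n b) (prm n a) (prm n l) (prm n k) = emat a b k l"
    using assms k l by (auto simp: emat_def) (metis prm_prm)+
  have s1: "th_sign n (prm n l) (prm n k) * emat (prm n b) (prm n a) k l = th_sign n a b * emat (prm n b) (prm n a) k l"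
    using assms k l by (auto simp: emat_def)
  have s2: "th_sign n (prm n l) (prm n k) * emat a b k l = th_sign n a b * emat a b k l"
    using assms k l by (auto simp: emat_def th_prm)
  have "th_sign n (prm n l) (prm n k) * Fm n a b (prm n l) (prm n k)
      = th_sign n a b * emat (prm n b) (prm n a) k l + th_sign n a b * (th_sign n a b * emat a b k l)"
    unfolding Fm_def e1 e2 distrib_left s1 using s2 by (simp add: mult_ac)
  then show "Fm n a b k l = th_sign n (prm n l) (prm n k) * Fm n a b (prm n l) (prm n k)"
    using th_square[of n a b] by (simp add: Fm_def flip: mult.assoc)
qed

lemma Gmat_scale: assumes X: "Gmat n X" shows "Gmat n (\<lambda>k l. c * X k l)"
  unfolding Gmat_def
proof (intro conjI allI ballI impI)
  fix k l
  show "k \<in> Iset n" "l \<in> Iset n" if "c * X k l \<noteq> 0"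
    using that Gmat_out[OF X, of k l] by auto
  assume "k \<in> Iset n" "l \<in> Iset n"
  then have "X k l = th_sign n (prm n l) (prm n k) * X (prm n l) (prm n k)"
    using X unfolding Gmat_def by blast
  then show "c * X k l = th_sign n (prm n l) (prm n k) * (c * X (prm n l) (prm n k))"
    by (metis mult.left_commute)
qed

lemma Gmat_Fb: "a \<in> Bas n \<Longrightarrow> Gmat n (Fb n a)"
  by (cases a) (auto simp: Fb_def Bas_def intro: Gmat_Fm)

lemma Gmat_Emat: "i \<in> Iset n \<Longrightarrow> j \<in> Iset n \<Longrightarrow> Gmat n (Emat n i j)"
  unfolding Emat_def by (intro Gmat_scale Gmat_Fm)

lemma Gmat_0: "Gmat n (\<lambda>k l. 0)"
  unfolding Gmat_def by simp

lemma Gmat_sum: "(\<And>i. i \<in> I \<Longrightarrow> Gmat n (f i)) \<Longrightarrow> Gmat n (\<lambda>k l. \<Sum>i\<in>I. f i k l)"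
proof (induction I rule: infinite_finite_induct)
  case (insert x F)
  then have 1: "Gmat n (\<lambda>k l. \<Sum>i\<in>F. f i k l)" "Gmat n (f x)" by auto
  have "Gmat n (\<lambda>k l. f x k l + (\<Sum>i\<in>F. f i k l))"
    unfolding Gmat_def
  proof (intro conjI allI ballI impI)
    fix k l
    show "k \<in> Iset n" "l \<in> Iset n" if "f x k l + (\<Sum>i\<in>F. f i k l) \<noteq> 0"
      using that Gmat_out[OF 1(1), of k l] Gmat_out[OF 1(2), of k l]
      by (metis add.right_neutral)+
    assume "k \<in> Iset n" "l \<in> Iset n"
    with 1 show "f x k l + (\<Sum>i\<in>F. f i k l) = th_sign n (prm n l) (prm n k) * (f x (prm n l) (prm n k) + (\<Sum>i\<in>F. f i (prm n l) (prm n k)))"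
      unfolding Gmat_def distrib_left by metis
  qed
  with insert(1,2) show ?case by simp
next
  case (infinite A)
  from infinite(1) show ?case by (simp add: Gmat_0)
next
  case empty
  show ?case by (simp add: Gmat_0)
qed

lemma Gmat_fmat: "Gmat n (fmat n)"
  unfolding fmat_def by (rule Gmat_sum, rule Gmat_Fm) (auto simp: Iset_def NN_def)

lemma hmat_Emat: "i \<in> Iset n \<Longrightarrow> j \<in> Iset n \<Longrightarrow> hmat (pp i + pp j) (Emat n i j)"
  using hmat_Fm[of i n j] by (auto simp: hmat_def Emat_def)

lemma Fm_entry:
  assumes "b = (i, j)" "b \<in> Bas n" "r \<in> Iset n" "s \<in> Iset n"
  shows "Fb n b r s = (if b = (r, s) then 1 else 0) + (if b = (prm n s, prm n r) then th_sign n i j else 0)"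
proof -
  have "i \<in> Iset n" "j \<in> Iset n" using assms by (auto simp: Bas_def)
  then have e: "(r = prm n j \<and> s = prm n i) = (i = prm n s \<and> j = prm n r)"
    using assms(3,4) by (metis prm_prm)
  have 1: "(r = i \<and> s = j) = (b = (r, s))" using assms(1) by auto
  have 2: "(r = prm n j \<and> s = prm n i) = (b = (prm n s, prm n r))"
    unfolding assms(1) prod.inject by (rule e)
  have "Fb n b r s = (if r = i \<and> s = j then 1 else 0) + th_sign n i j * (if r = prm n j \<and> s = prm n i then 1 else 0)"
    by (simp only: Fb_def Fm_def emat_def assms(1) prod.case)
  then show ?thesis
    unfolding 1 2 by (simp only: if_distrib[of "(*) _"] mult_1_right mult_zero_right)
qed

text \<open>Theta pairs position (r, s) with (s', r'), of which the basis keeps one. On the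
  antidiagonal the pair collapses: either F is twice a matrix unit, hence the halved coordinate, or
  symmetry forces the entry to be 0.\<close>

lemma Bas_expand:
  assumes X: "Gmat n X"
  shows "X r s = (\<Sum>b\<in>Bas n. coord n X b * Fb n b r s)"
proof (cases "r \<in> Iset n \<and> s \<in> Iset n")
  case False
  then have "Fb n b r s = 0" if "b \<in> Bas n" for b
    using Gmat_out[OF Gmat_Fb[OF that]] by blast
  then show ?thesis using False Gmat_out[OF X] by simp
next
  case True
  have e: "Fb n b r s = (if b = (r, s) then 1 else 0) + (if b = (prm n s, prm n r) then th_sign n (fst b) (snd b) else 0)"
    if "b \<in> Bas n" for b
    using Fm_entry[of b "fst b" "snd b" n r s] that True by simp
  have sm: "(\<Sum>b\<in>Bas n. coord n X b * Fb n b r s) =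
      (\<Sum>b\<in>Bas n. if b = (r, s) then coord n X (r, s) else 0) +
      (\<Sum>b\<in>Bas n. if b = (prm n s, prm n r) then coord n X (prm n s, prm n r) * th_sign n (prm n s) (prm n r) else 0)"
    unfolding sum.distrib[symmetric]
  proof (intro sum.cong refl)
    fix b assume b: "b \<in> Bas n"
    have m1: "coord n X b * (if b = (r, s) then 1 else 0) = (if b = (r, s) then coord n X (r, s) else 0)"
      by (cases "b = (r, s)") simp_all
    have m2: "coord n X b * (if b = (prm n s, prm n r) then th_sign n (fst b) (snd b) else 0) =
        (if b = (prm n s, prm n r) then coord n X (prm n s, prm n r) * th_sign n (prm n s) (prm n r) else 0)"
      by (cases "b = (prm n s, prm n r)") simp_all
    show "coord n X b * Fb n b r s = (if b = (r, s) then coord n X (r, s) else 0) +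
      (if b = (prm n s, prm n r) then coord n X (prm n s, prm n r) * th_sign n (prm n s) (prm n r) else 0)"
      unfolding e[OF b] distrib_left m1 m2 ..
  qed
  have sm: "(\<Sum>b\<in>Bas n. coord n X b * Fb n b r s) =
      (if (r, s) \<in> Bas n then coord n X (r, s) else 0) +
      (if (prm n s, prm n r) \<in> Bas n then coord n X (prm n s, prm n r) * th_sign n (prm n s) (prm n r) else 0)"
    unfolding sm by (simp add: sum.delta)
  have sym: "X (prm n s) (prm n r) * th_sign n (prm n s) (prm n r) = X r s"
    using X True unfolding Gmat_def by (metis mult.commute)
  have rs: "1 \<le> r" "r < 4 * n" "1 \<le> s" "s < 4 * n" using True by (auto simp: Iset_def NN_def)
  consider "r + s < 4 * n" | "r + s > 4 * n" | "r + s = 4 * n" by linarith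
  then show ?thesis
  proof cases
    case 1
    then have "(r, s) \<in> Bas n" "(prm n s, prm n r) \<notin> Bas n"
      using True rs by (auto simp: Bas_def prm_def)
    then show ?thesis using 1 unfolding sm by (simp add: coord_def)
  next
    case 2
    then have "(r, s) \<notin> Bas n" "(prm n s, prm n r) \<in> Bas n" "prm n s + prm n r < 4 * n"
      using True rs by (auto simp: Bas_def) (auto simp: prm_def)
    then show ?thesis using sym unfolding sm by (simp add: coord_def)
  next
    case 3
    then have p: "prm n s = r" "prm n r = s" using rs by (auto simp: prm_def)
    show ?thesis
    proof (cases "th_sign n r s = 1")
      case True
      then have "(r, s) \<in> Bas n" using \<open>r \<in> Iset n \<and> s \<in> Iset n\<close> 3 by (simp add: Bas_def)
      then show ?thesis using 3 True unfolding sm p by (simp add: coord_def)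
    next
      case False
      then have "(r, s) \<notin> Bas n" using 3 by (simp add: Bas_def)
      moreover have "th_sign n r s = -1" using th_square[of n r s] False
        by (metis mult_1 square_eq_1_iff)
      then have "X r s = 0" using sym unfolding p by simp
      ultimately show ?thesis unfolding sm p by simp
    qed
  qed
qed

lemma finite_Iset [simp]: "finite (Iset n)" by (simp add: Iset_def)

lemma Emat_entry:
  assumes "i \<in> Iset n" "j \<in> Iset n" "k \<in> Iset n" "s \<in> Iset n"
  shows "Emat n j i k s = (1/2) * (-1) ^ pp j * ((if k = j then (if s = i then 1 else 0) else 0)
     + (if k = prm n i then (if s = prm n j then th_sign n j i else 0) else 0))"
  using assms by (auto simp: Emat_def Fm_def emat_def)

lemma mmul_Emat_right:
  assumes "i \<in> Iset n" "j \<in> Iset n" "s \<in> Iset n"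
  shows "mmul n X (Emat n j i) r s = (1/2) * (-1) ^ pp j * ((if s = i then X r j else 0)
    + (if s = prm n j then th_sign n j i * X r (prm n i) else 0))"
proof -
  have "mmul n X (Emat n j i) r s = (\<Sum>k\<in>Iset n. (if k = j then (if s = i then (1/2) * (-1) ^ pp j * X r j else 0) else 0)
     + (if k = prm n i then (if s = prm n j then (1/2) * (-1) ^ pp j * th_sign n j i * X r (prm n i) else 0) else 0))"
    unfolding mmul_def using assms by (intro sum.cong refl) (auto simp: Emat_entry distrib_left mult_ac)
  then show ?thesis using assms
    by (simp add: sum.distrib sum.delta distrib_left)
qed

lemma mmul_Emat_left:
  assumes "i \<in> Iset n" "j \<in> Iset n" "r \<in> Iset n"
  shows "mmul n (Emat n j i) X r s = (1/2) * (-1) ^ pp j * ((if r = j then X i s else 0)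
    + (if r = prm n i then th_sign n j i * X (prm n j) s else 0))"
proof -
  have "mmul n (Emat n j i) X r s = (\<Sum>k\<in>Iset n. (if k = i then (if r = j then (1/2) * (-1) ^ pp j * X i s else 0) else 0)
     + (if k = prm n j then (if r = prm n i then (1/2) * (-1) ^ pp j * th_sign n j i * X (prm n j) s else 0) else 0))"
    unfolding mmul_def using assms by (intro sum.cong refl) (auto simp: Emat_entry distrib_left mult_ac)
  then show ?thesis using assms
    by (simp add: sum.distrib sum.delta distrib_left)
qed

text \<open>By the symmetry of \<open>X\<close> both halves of E_ji contribute the same amount; this
  explains the factor 1/2 in E.\<close>

lemma str_Emat:
  assumes X: "Gmat n X" and i: "i \<in> Iset n" and j: "j \<in> Iset n"
  shows "str n (mmul n X (Emat n j i)) = (-1) ^ (pp i + pp j) * X i j"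
proof -
  have "str n (mmul n X (Emat n j i)) = (\<Sum>r\<in>Iset n.
     (if r = i then (-1) ^ pp i * ((1/2) * (-1) ^ pp j * X i j) else 0) +
     (if r = prm n j then (-1) ^ pp j * ((1/2) * (-1) ^ pp j * (th_sign n j i * X (prm n j) (prm n i))) else 0))"
    unfolding str_def using i j
    by (intro sum.cong refl) (auto simp: mmul_Emat_right pp_prm distrib_left)
  also have "\<dots> = (-1) ^ pp i * ((1/2) * (-1) ^ pp j * X i j) +
     (-1) ^ pp j * ((1/2) * (-1) ^ pp j * (th_sign n j i * X (prm n j) (prm n i)))"
    using i j by (simp add: sum.distrib sum.delta)
  also have "X (prm n j) (prm n i) = th_sign n i j * X i j"
    using Gmat_sym[OF X i j] th_square[of n i j] by (simp flip: mult.assoc)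
  also have "th_sign n j i * (th_sign n i j * X i j) = (-1) ^ (pp i + pp j) * X i j"
    unfolding th_swap[of n i j, symmetric] by (simp add: mult_ac)
  finally show ?thesis
    unfolding neg1_even_iff by auto
qed

text \<open>The E_ij bracket with g like matrix units, although they are linearly dependent: the
  halves produced by theta recombine by the symmetry of \<open>X\<close> and
  \<open>th_compose\<close>.\<close>

lemma sbr_Emat:
  assumes X: "Gmat n X" "hmat p X" and ij: "i \<in> Iset n" "j \<in> Iset n" and rs: "r \<in> Iset n" "s \<in> Iset n"
    and q: "even q = even (pp i + pp j)"
  shows "sbr n X (Emat n j i) p q r s =
    (\<Sum>k\<in>Iset n. (-1) ^ p * X k j * Emat n k i r s) - (\<Sum>k\<in>Iset n. (-1) ^ (p * q) * X i k * Emat n j k r s)"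
proof -
  have s1: "(\<Sum>k\<in>Iset n. (-1) ^ p * X k j * Emat n k i r s) =
      (\<Sum>k\<in>Iset n. (if k = r then (if s = i then (1/2) * (-1) ^ (p + pp r) * X r j else 0) else 0) +
       (if k = prm n s then (if r = prm n i then (1/2) * (-1) ^ (p + pp s) * X (prm n s) j * th_sign n (prm n s) i else 0) else 0))"
    using ij rs by (intro sum.cong refl) (auto simp: Emat_entry pp_prm power_add distrib_left mult_ac)
  have s2: "(\<Sum>k\<in>Iset n. (-1) ^ (p * q) * X i k * Emat n j k r s) =
      (\<Sum>k\<in>Iset n. (if k = s then (if r = j then (1/2) * (-1) ^ (p * q + pp j) * X i s else 0) else 0) +
       (if k = prm n r then (if s = prm n j then (1/2) * (-1) ^ (p * q + pp j) * X i (prm n r) * th_sign n j (prm n r) else 0) else 0))"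
    using ij rs by (intro sum.cong refl) (auto simp: Emat_entry pp_prm power_add distrib_left mult_ac)
  have t1: "(-1) ^ pp j * X r j = (-1) ^ (p + pp r) * X r j"
  proof (cases "X r j = 0")
    case False
    then have "even (pp r + pp j + p)" using X(2) unfolding hmat_def by blast
    then show ?thesis by (subst neg1_cong[of "pp j" "p + pp r"]) auto
  qed simp
  \<comment> \<open>\<open>t2\<close> and \<open>t3\<close> match the theta-halves; the cocycle sign
    of \<open>th_compose\<close> is here the bracket sign (-1)^(p q).\<close>
  have t2: "(-1) ^ pp j * (th_sign n j i * X r (prm n i)) = - ((-1) ^ (p * q + pp j) * X i (prm n r) * th_sign n j (prm n r))"
  proof (cases "X r (prm n i) = 0")
    case True
    then have "X i (prm n r) = 0"
      using Gmat_sym[OF X(1) ij(1) prm_Iset[OF rs(1)]] rs by simp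
    with True show ?thesis by simp
  next
    case False
    then have e: "even (pp r + pp i + p)" using X(2) pp_prm[OF ij(1)] unfolding hmat_def by metis
    have "X r (prm n i) = th_sign n i (prm n r) * X i (prm n r)"
      using Gmat_sym[OF X(1) rs(1) prm_Iset[OF ij(1)]] ij th_prm[of i n "prm n r"] rs by simp
    then have "th_sign n j i * X r (prm n i) = - ((-1) ^ ((pp j + pp i) * (pp i + pp r)) * th_sign n j (prm n r)) * X i (prm n r)"
      using th_compose[of n j i "prm n r"] pp_prm[OF rs(1)] by (simp flip: mult.assoc)
    moreover have "(-1::complex) ^ ((pp j + pp i) * (pp i + pp r)) = (-1) ^ (p * q)"
      using e q by (intro neg1_cong) auto
    ultimately show ?thesis by (simp add: power_add mult_ac)
  qed
  have t3: "- ((-1) ^ (p * q) * ((-1) ^ pp j * (th_sign n j i * X (prm n j) s))) = (-1) ^ (p + pp s) * X (prm n s) j * th_sign n (prm n s) i"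
  proof (cases "X (prm n s) j = 0")
    case True
    then have "X (prm n j) s = 0"
      using Gmat_sym[OF X(1) prm_Iset[OF ij(2)] rs(2)] ij rs by simp
    with True show ?thesis by simp
  next
    case False
    then have e: "even (pp s + pp j + p)" using X(2) pp_prm[OF rs(2)] unfolding hmat_def by metis
    have "X (prm n j) s = th_sign n (prm n s) j * X (prm n s) j"
      using Gmat_sym[OF X(1) prm_Iset[OF ij(2)] rs(2)] ij th_prm[of "prm n s" n j] rs by simp
    then have "th_sign n j i * X (prm n j) s = - ((-1) ^ ((pp s + pp j) * (pp j + pp i)) * th_sign n (prm n s) i) * X (prm n s) j"
      using arg_cong[OF th_compose[of n "prm n s" j i], of "\<lambda>x. x * X (prm n s) j"] pp_prm[OF rs(2)]
      by (simp add: mult_ac)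
    moreover have "(-1::complex) ^ ((pp s + pp j) * (pp j + pp i)) = (-1) ^ (p * q)"
      using e q by (intro neg1_cong) auto
    moreover have "(-1::complex) ^ pp j = (-1) ^ (p + pp s)"
      using e by (intro neg1_cong) auto
    ultimately show ?thesis unfolding neg1_even_iff by auto
  qed
  have u1: "(if s = i then (1/2) * (-1) ^ (p + pp r) * X r j else 0) = (1/2) * (-1) ^ pp j * (if s = i then X r j else 0)"
    unfolding mult.assoc t1[symmetric] by (cases "s = i") simp_all
  have u2: "(if r = prm n i then (1/2) * (-1) ^ (p + pp s) * X (prm n s) j * th_sign n (prm n s) i else 0)
      = - ((-1) ^ (p * q) * ((1/2) * (-1) ^ pp j * (if r = prm n i then th_sign n j i * X (prm n j) s else 0)))"
    using arg_cong[OF t3, of "\<lambda>x. x / 2"] by simp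
  have u3: "(if r = j then (1/2) * (-1) ^ (p * q + pp j) * X i s else 0)
      = (-1) ^ (p * q) * ((1/2) * (-1) ^ pp j * (if r = j then X i s else 0))"
    by (simp add: power_add)
  have u4: "(if s = prm n j then (1/2) * (-1) ^ (p * q + pp j) * X i (prm n r) * th_sign n j (prm n r) else 0)
      = - ((1/2) * (-1) ^ pp j * (if s = prm n j then th_sign n j i * X r (prm n i) else 0))"
    using arg_cong[OF t2, of "\<lambda>x. x / 2"] by simp
  have m: "prm n r \<in> Iset n" "prm n s \<in> Iset n" using rs by auto
  show ?thesis
    unfolding sbr_def s1 s2 mmul_Emat_right[OF ij rs(2)] mmul_Emat_left[OF ij rs(1)] sum.distrib
      sum.delta[OF finite_Iset] if_P[OF rs(1)] if_P[OF rs(2)] if_P[OF m(1)] if_P[OF m(2)] u1 u2 u3 u4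
    by (simp only: distrib_left) (simp only: algebra_simps add.right_inverse add_0_right)
qed

subsection \<open>The generating matrix\<close>

text \<open>For \<open>j < i\<close> the element \<open>E\<^sub>j\<^sub>i\<close> reduces to \<open>(f|E\<^sub>j\<^sub>i) = - f\<^sub>i\<^sub>j\<close>, so the matrix \<open>A\<close> of the statement
 is \<open>D + rho Q\<close>, with \<open>Q\<close> the matrix of all \<open>E\<^sub>j\<^sub>i\<close>.\<close>

definition qm :: "nat \<Rightarrow> nat \<Rightarrow> nat \<Rightarrow> supalg" where
  "qm n i j = bar n (Emat n j i)"

lemma bar_diff: "bar n (\<lambda>r s. X r s - Y r s) = bar n X - bar n Y"
proof -
  have "coord n (\<lambda>r s. X r s - Y r s) a = coord n X a - coord n Y a" for a
    by (cases a) (simp add: coord_def diff_divide_distrib)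
  then show ?thesis by (simp add: bar_def sc_diff_left sum_subtractf)
qed

lemma bar_lincomb: "bar n (\<lambda>r s. \<Sum>k\<in>I. c k * X k r s) = (\<Sum>k\<in>I. sc (c k) (bar n (X k)))"
proof -
  have "coord n (\<lambda>r s. \<Sum>k\<in>I. c k * X k r s) a = (\<Sum>k\<in>I. c k * coord n (X k) a)" for a
    by (cases a) (simp add: coord_def sum_divide_distrib)
  then show ?thesis
    unfolding bar_def sc_sum by (subst sum.swap) (simp add: sc_sum_left)
qed

lemma bar_cong:
  assumes "\<And>r s. r \<in> Iset n \<Longrightarrow> s \<in> Iset n \<Longrightarrow> X r s = Y r s" shows "bar n X = bar n Y"
  unfolding bar_def using assms by (intro sum.cong refl) (auto simp: coord_def Bas_def)

lemma hp_qm: "i \<in> Iset n \<Longrightarrow> j \<in> Iset n \<Longrightarrow> hp (odd (pp i + pp j + 1)) (qm n i j)"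
  unfolding qm_def using hp_bar[OF hmat_Emat[of j n i]] by (simp add: add.commute)

lemma coord_hmat: "hmat p X \<Longrightarrow> coord n X b \<noteq> 0 \<Longrightarrow> even (bpar b) = even p"
  by (cases b) (auto simp: coord_def hmat_def bpar_def split: if_splits)

lemma mmul_lincomb: "mmul n X (\<lambda>r s. \<Sum>b\<in>I. c b * Y b r s) r s = (\<Sum>b\<in>I. c b * mmul n X (Y b) r s)"
  unfolding mmul_def sum_distrib_left by (subst sum.swap) (simp add: mult_ac)

lemma mmul_lincomb_left: "mmul n (\<lambda>r s. \<Sum>b\<in>I. c b * Y b r s) X r s = (\<Sum>b\<in>I. c b * mmul n (Y b) X r s)"
  unfolding mmul_def sum_distrib_left sum_distrib_right by (subst sum.swap) (simp add: mult_ac)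

text \<open>In the bracket of generators the sign depends on the basis vector; homogeneity of
  \<open>Y\<close> makes it constant on the basis vectors that occur, so the formula extends
  linearly.\<close>

lemma delta_bar:
  assumes a: "a \<in> Bas n" and Y: "Gmat n Y" "hmat p Y"
  shows "delta n a (bar n Y) =
     sc ((-1) ^ (bpar a * (p + 1))) (eps a 0 * bar n (sbr n (Fb n a) Y (bpar a) p)) +
     sc ((-1) ^ bpar a * str n (mmul n (Fb n a) Y)) (eps a 1)"
proof -
  let ?X = "Fb n a"
  have Yx: "Y = (\<lambda>r s. \<Sum>b\<in>Bas n. coord n Y b * Fb n b r s)"
    using Bas_expand[OF Y(1)] by (intro ext)
  have sg: "coord n Y b * (-1) ^ (bpar a * bpar b) = coord n Y b * (-1) ^ (bpar a * p)" for b
  proof (cases "coord n Y b = 0")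
    case False
    then have "even (bpar b) = even p" using coord_hmat[OF Y(2)] by blast
    then show ?thesis by (subst neg1_cong[of "bpar a * bpar b" "bpar a * p"]) auto
  qed simp
  have "sbr n ?X Y (bpar a) p = (\<lambda>r s. \<Sum>b\<in>Bas n. coord n Y b * sbr n ?X (Fb n b) (bpar a) (bpar b) r s)"
  proof (intro ext)
    fix r s
    have "sbr n ?X Y (bpar a) p r s = (\<Sum>b\<in>Bas n. coord n Y b * mmul n ?X (Fb n b) r s)
       - (\<Sum>b\<in>Bas n. (coord n Y b * (-1) ^ (bpar a * p)) * mmul n (Fb n b) ?X r s)"
      unfolding sbr_def
      by (subst (1) Yx, subst (2) Yx) (simp only: mmul_lincomb mmul_lincomb_left sum_distrib_left mult_ac)
    then show "sbr n ?X Y (bpar a) p r s = (\<Sum>b\<in>Bas n. coord n Y b * sbr n ?X (Fb n b) (bpar a) (bpar b) r s)"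
      unfolding sg[symmetric] by (simp add: sbr_def right_diff_distrib sum_subtractf mult_ac)
  qed
  then have b1: "bar n (sbr n ?X Y (bpar a) p) = (\<Sum>b\<in>Bas n. sc (coord n Y b) (bar n (sbr n ?X (Fb n b) (bpar a) (bpar b))))"
    by (simp add: bar_lincomb)
  have b2: "str n (mmul n ?X Y) = (\<Sum>b\<in>Bas n. coord n Y b * str n (mmul n ?X (Fb n b)))"
  proof -
    have "str n (mmul n ?X Y) = (\<Sum>i\<in>Iset n. (-1) ^ pp i * (\<Sum>b\<in>Bas n. coord n Y b * mmul n ?X (Fb n b) i i))"
      unfolding str_def by (subst Yx) (simp only: mmul_lincomb)
    then show ?thesis
      unfolding str_def sum_distrib_left by (subst sum.swap) (simp add: mult_ac)
  qed
  have "delta n a (bar n Y) = (\<Sum>b\<in>Bas n. sc (coord n Y b) (dv0 n a b))"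
    unfolding bar_def by (simp add: delta_sum delta_gen[OF a] dv_def)
  also have "\<dots> = (\<Sum>b\<in>Bas n. sc (coord n Y b * (-1) ^ (bpar a * bpar b)) (sc ((-1) ^ bpar a) (eps a 0 * bar n (sbr n ?X (Fb n b) (bpar a) (bpar b)))))
     + (\<Sum>b\<in>Bas n. sc (coord n Y b * str n (mmul n ?X (Fb n b))) (sc ((-1) ^ bpar a) (eps a 1)))"
    unfolding sum.distrib[symmetric]
    by (intro sum.cong refl)
      (simp add: dv0_def W_def gbr_def numeral_2_eq_2 es_1 power_add mult_ac)
  also have "\<dots> = sc ((-1) ^ (bpar a * (p + 1))) (eps a 0 * bar n (sbr n ?X Y (bpar a) p)) +
     sc ((-1) ^ bpar a * str n (mmul n ?X Y)) (eps a 1)"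
    unfolding sg b1 b2 by (simp add: sum_distrib_left sc_sum sum_distrib_right sc_sum_left power_add mult_ac)
  finally show ?thesis .
qed

text \<open>As operators this is the entry of A X' - Y' A, where A = D + Q, X' is \<open>X\<close>
  times \<open>eps a 0\<close> and Y' is (-1)^p(a) X'. The term with \<open>eps a 1\<close> is D
  hitting \<open>eps a 0\<close>; the remaining occurrences of D cancel.\<close>

lemma delta_qm:
  assumes a: "a \<in> Bas n" and i: "i \<in> Iset n" and j: "j \<in> Iset n"
  defines "X \<equiv> Fb n a"
  shows "delta n a (qm n i j) = (\<Sum>k\<in>Iset n. sc (X k j) (qm n i k * eps a 0)) + sc (X i j) (eps a 1)
     - (\<Sum>k\<in>Iset n. sc ((-1) ^ bpar a * X i k) (eps a 0 * qm n k j))"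
proof -
  let ?p = "bpar a" let ?q = "pp j + pp i"
  have X: "Gmat n X" "hmat ?p X" unfolding X_def using a by (auto intro: Gmat_Fb hmat_Fb)
  have "bar n (sbr n X (Emat n j i) ?p ?q) =
    (\<Sum>k\<in>Iset n. sc ((-1) ^ ?p * X k j) (qm n i k)) - (\<Sum>k\<in>Iset n. sc ((-1) ^ (?p * ?q) * X i k) (qm n k j))"
  proof -
    have "bar n (sbr n X (Emat n j i) ?p ?q) = bar n (\<lambda>r s. (\<Sum>k\<in>Iset n. (-1) ^ ?p * X k j * Emat n k i r s)
       - (\<Sum>k\<in>Iset n. (-1) ^ (?p * ?q) * X i k * Emat n j k r s))"
      by (rule bar_cong) (rule sbr_Emat[OF X i j], auto)
    then show ?thesis unfolding bar_diff bar_lincomb qm_def .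
  qed
  moreover have "str n (mmul n X (Emat n j i)) = (-1) ^ ?p * X i j"
  proof (cases "X i j = 0")
    case False
    then have "even (pp i + pp j + ?p)" using X(2) unfolding hmat_def by blast
    then show ?thesis using str_Emat[OF X(1) i j] neg1_cong[of "pp i + pp j" ?p] by auto
  qed (simp add: str_Emat[OF X(1) i j])
  ultimately have "delta n a (qm n i j) = sc ((-1) ^ (?p * (?q + 1))) (eps a 0 *
     ((\<Sum>k\<in>Iset n. sc ((-1) ^ ?p * X k j) (qm n i k)) - (\<Sum>k\<in>Iset n. sc ((-1) ^ (?p * ?q) * X i k) (qm n k j))))
     + sc (X i j) (eps a 1)"
    using delta_bar[OF a Gmat_Emat[OF j i] hmat_Emat[OF j i]] neg1_sq[of ?p]
    unfolding X_def qm_def by (simp flip: mult.assoc)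
  also have "\<dots> = (\<Sum>k\<in>Iset n. sc ((-1) ^ (?p * (?q + 1) + ?p) * X k j) (eps a 0 * qm n i k)) + sc (X i j) (eps a 1)
     - (\<Sum>k\<in>Iset n. sc ((-1) ^ (?p * (?q + 1) + ?p * ?q) * X i k) (eps a 0 * qm n k j))"
    by (simp add: right_diff_distrib sum_distrib_left sc_sum power_add mult_ac)
  also have "(\<Sum>k\<in>Iset n. sc ((-1) ^ (?p * (?q + 1) + ?p) * X k j) (eps a 0 * qm n i k)) = (\<Sum>k\<in>Iset n. sc (X k j) (qm n i k * eps a 0))"
  proof (intro sum.cong refl)
    fix k assume k: "k \<in> Iset n"
    show "sc ((-1) ^ (?p * (?q + 1) + ?p) * X k j) (eps a 0 * qm n i k) = sc (X k j) (qm n i k * eps a 0)"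
    proof (cases "X k j = 0")
      case False
      then have e: "even (pp k + pp j + ?p)" using X(2) unfolding hmat_def by blast
      have "qm n i k * eps a 0 = sc ((-1) ^ ((pp i + pp k + 1) * ?p)) (eps a 0 * qm n i k)"
        using hp_comm[OF hp_qm[OF i k] hp_eps[of a 0]] unfolding sgn2_power by simp
      moreover have "(-1::complex) ^ ((pp i + pp k + 1) * ?p) = (-1) ^ (?p * (?q + 1) + ?p)"
        using e by (intro neg1_cong) auto
      ultimately show ?thesis by (simp add: mult.commute)
    qed simp
  qed
  also have "(-1::complex) ^ (?p * (?q + 1) + ?p * ?q) = (-1) ^ ?p"
    by (rule neg1_cong) auto
  finally show ?thesis .
qed

lemma rho_bar:
  assumes Y: "Gmat n Y" and up: "\<And>b. b \<in> Bas n \<Longrightarrow> coord n Y b \<noteq> 0 \<Longrightarrow> b \<in> Bas_n n"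
  shows "rho n (bar n Y) = K (str n (mmul n (fmat n) Y))"
proof -
  have Yx: "Y = (\<lambda>r s. \<Sum>b\<in>Bas n. coord n Y b * Fb n b r s)"
    using Bas_expand[OF Y(1)] by (intro ext)
  have b2: "str n (mmul n (fmat n) Y) = (\<Sum>b\<in>Bas n. coord n Y b * str n (mmul n (fmat n) (Fb n b)))"
  proof -
    have "str n (mmul n (fmat n) Y) = (\<Sum>i\<in>Iset n. (-1) ^ pp i * (\<Sum>b\<in>Bas n. coord n Y b * mmul n (fmat n) (Fb n b) i i))"
      unfolding str_def by (subst Yx) (simp only: mmul_lincomb)
    then show ?thesis
      unfolding str_def sum_distrib_left by (subst sum.swap) (simp add: mult_ac)
  qed
  have "rho n (bar n Y) = (\<Sum>b\<in>Bas n. sc (coord n Y b) (rh n (0, b)))"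
    unfolding bar_def by (simp add: rho_sum rho_gen)
  also have "\<dots> = (\<Sum>b\<in>Bas n. K (coord n Y b * str n (mmul n (fmat n) (Fb n b))))"
  proof (intro sum.cong refl)
    fix b assume "b \<in> Bas n"
    then show "sc (coord n Y b) (rh n (0, b)) = K (coord n Y b * str n (mmul n (fmat n) (Fb n b)))"
      using up[of b] by (cases "coord n Y b = 0") (auto simp: rh_def)
  qed
  finally show ?thesis unfolding b2 K_sum .
qed

lemma coord_Emat:
  assumes "i \<in> Iset n" "j \<in> Iset n" "b \<in> Bas n" "coord n (Emat n j i) b \<noteq> 0"
  shows "b = (j, i) \<or> b = (prm n i, prm n j)"
  using assms Emat_entry[of i n j "fst b" "snd b"]
  by (cases b) (auto simp: coord_def Bas_def split: if_splits)

lemma rho_qm_lower: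
  assumes i: "i \<in> Iset n" and j: "j \<in> Iset n" and "j < i"
  shows "rho n (qm n i j) = K (- fmat n i j)"
proof -
  have "rho n (qm n i j) = K (str n (mmul n (fmat n) (Emat n j i)))"
    unfolding qm_def
  proof (rule rho_bar[OF Gmat_Emat[OF j i]])
    fix b assume b: "b \<in> Bas n" "coord n (Emat n j i) b \<noteq> 0"
    have "prm n i < prm n j" using assms by (auto simp: prm_def Iset_def NN_def)
    then show "b \<in> Bas_n n" using coord_Emat[OF i j b] b(1) assms by (auto simp: Bas_n_def)
  qed
  also have "str n (mmul n (fmat n) (Emat n j i)) = - fmat n i j"
  proof (cases "fmat n i j = 0")
    case False
    then have "even (pp i + pp j + 1)" using hmat_fmat[of n] unfolding hmat_def by blast
    then have "(-1::complex) ^ (pp i + pp j) = -1" by (simp add: neg1_even_iff)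
    then show ?thesis using str_Emat[OF Gmat_fmat i j] by simp
  qed (simp add: str_Emat[OF Gmat_fmat i j])
  finally show ?thesis .
qed

lemma inV_qm:
  assumes i: "i \<in> Iset n" and j: "j \<in> Iset n" and "i \<le> j"
  shows "inV (Bas_p n) (qm n i j)"
  unfolding qm_def bar_def
proof (rule inV_sum)
  fix b assume b: "b \<in> Bas n"
  show "inV (Bas_p n) (sc (coord n (Emat n j i) b) (gen (0, b)))"
  proof (cases "coord n (Emat n j i) b = 0")
    case False
    have "prm n j \<le> prm n i" using assms by (auto simp: prm_def Iset_def NN_def)
    then have "b \<in> Bas_p n" using coord_Emat[OF i j b False] b assms(3) by (auto simp: Bas_p_def)
    then show ?thesis by (intro inV_sc inV_gen) simp
  qed simp
qed

lemma rho_qm_upper: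
  "i \<in> Iset n \<Longrightarrow> j \<in> Iset n \<Longrightarrow> i \<le> j \<Longrightarrow> rho n (qm n i j) = qm n i j"
  by (rule rho_id[OF _ inV_qm]) (auto simp: Bas_n_def Bas_p_def)

subsection \<open>Row determinants of Hessenberg matrices of operators\<close>

text \<open>The entries are linear operators and \<open>x\<close> is what they act on, so the
  ordered product in the row determinant is a composition, and the first-order entries on the
  diagonal need no separate treatment.\<close>

locale hessenberg =
  fixes N :: nat and A :: "nat \<Rightarrow> nat \<Rightarrow> supalg \<Rightarrow> supalg" and f :: "nat \<Rightarrow> complex" and x :: supalg
  assumes lin: "\<And>i j. clinear (A i j)"
    and below: "\<And>i j y. 1 \<le> j \<Longrightarrow> i \<le> N \<Longrightarrow> j + 1 < i \<Longrightarrow> A i j y = 0"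
    and subdiag: "\<And>j y. 1 \<le> j \<Longrightarrow> j < N \<Longrightarrow> A (j + 1) j y = sc (- f j) y"
begin

lemma A_0 [simp]: "A i j 0 = 0"
  and A_sc: "A i j (sc c y) = sc c (A i j y)"
  and A_sum: "A i j (\<Sum>k\<in>I. g k) = (\<Sum>k\<in>I. A i j (g k))"
  by (simp_all add: clinear_0 clinear_sc clinear_sum lin)

definition F :: "nat \<Rightarrow> (nat \<Rightarrow> nat) \<Rightarrow> supalg" where
  "F i s = foldr (\<lambda>k y. A k (s k) y) [i..<N+1] x"

definition minor :: "nat \<Rightarrow> supalg" where
  "minor i = (\<Sum>\<sigma>\<in>{\<sigma>. \<sigma> permutes {i..N}}. sc (of_int (sign \<sigma>)) (F i \<sigma>))"

text \<open>The minor on the rows \<open>i..N\<close> in which column \<open>b\<close> is replaced by column \<open>i - 1\<close>.\<close>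

definition replaced_minor :: "nat \<Rightarrow> nat \<Rightarrow> supalg" where
  "replaced_minor i b = (\<Sum>q\<in>{q. q permutes {i..N}}. sc (of_int (sign q)) (F i (\<lambda>k. if q k = b then i - 1 else q k)))"

lemma F_rec: "i \<le> N \<Longrightarrow> F i s = A i (s i) (F (Suc i) s)"
  by (simp add: F_def upt_conv_Cons del: upt_Suc)

lemma F_cong: "(\<And>k. i \<le> k \<Longrightarrow> k \<le> N \<Longrightarrow> s k = s' k) \<Longrightarrow> F i s = F i s'"
  unfolding F_def by (rule foldr_cong) auto

lemma F_zero:
  assumes "i \<le> k" "k \<le> N" "\<And>y. A k (s k) y = 0"
  shows "F i s = 0"
  using assms(1)
proof (induction "k - i" arbitrary: i)
  case 0
  then have "i = k" by simp
  then show ?case using assms F_rec[of k s] by simp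
next
  case (Suc d)
  then have "F (Suc i) s = 0" by (intro Suc.hyps(1)) auto
  then show ?case using Suc assms(2) F_rec[of i s] by simp
qed

lemma minor_end: "minor (Suc N) = x"
proof -
  have "{\<sigma>. \<sigma> permutes {Suc N..N}} = {id}" by auto
  then show ?thesis by (simp add: minor_def F_def)
qed

lemma sum_permutations_rec:
  assumes "i \<le> N"
  shows "sum g {\<sigma>. \<sigma> permutes {i..N}} = (\<Sum>c\<in>{i..N}. \<Sum>q\<in>{q. q permutes {Suc i..N}}. g (transpose i c \<circ> q))"
proof -
  have "{i..N} = insert i {Suc i..N}" using assms by auto
  then show ?thesis
    using sum_over_permutations_insert[of "{Suc i..N}" i g] by simp
qed

lemma sign_transpose_comp:
  assumes "q permutes {Suc i..N}"
  shows "(of_int (sign (transpose i c \<circ> q)) :: complex) = (if i = c then 1 else -1) * of_int (sign q)"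
  using assms by (simp add: sign_compose sign_swap_id permutation_swap_id permutation_permutes[of q] exI[of _ "{Suc i..N}"])

lemma transpose_comp_apply:
  assumes "q permutes {Suc i..N}" "i < k"
  shows "(transpose i c \<circ> q) k = (if q k = c then i else q k)"
proof -
  have "q k \<noteq> i"
    using assms permutes_inj[OF assms(1)] permutes_not_in[OF assms(1), of i]
    by (metis atLeastAtMost_iff injD less_irrefl not_less_eq_eq order_refl)
  then show ?thesis by (auto simp: transpose_def)
qed

lemma transpose_comp_self:
  assumes "q permutes {Suc i..N}"
  shows "(transpose i c \<circ> q) i = c"
  using permutes_not_in[OF assms, of i] by simp

text \<open>Expansion along row \<open>i\<close>: a permutation sending \<open>i\<close> to
  \<open>c\<close> is \<open>transpose i c\<close> after some \<open>q\<close> fixing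
  \<open>i\<close>, so a lower row uses column \<open>i\<close> where \<open>q\<close> would use
  \<open>c\<close>. The transposition gives the minus sign.\<close>

lemma minor_replaced:
  assumes "i \<le> N"
  shows "minor i = A i i (minor (Suc i)) + (\<Sum>c\<in>{Suc i..N}. A i c (- replaced_minor (Suc i) c))"
proof -
  have *: "(\<Sum>q\<in>{q. q permutes {Suc i..N}}. sc (of_int (sign (transpose i c \<circ> q))) (F i (transpose i c \<circ> q)))
     = A i c (if c = i then minor (Suc i) else - replaced_minor (Suc i) c)" if c: "c \<in> {i..N}" for c
  proof -
    have e: "sc (of_int (sign (transpose i c \<circ> q))) (F i (transpose i c \<circ> q)) =
        A i c (sc ((if i = c then 1 else -1) * of_int (sign q)) (F (Suc i) (\<lambda>k. if q k = c then i else q k)))"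
      if q: "q permutes {Suc i..N}" for q
    proof -
      have "F (Suc i) (transpose i c \<circ> q) = F (Suc i) (\<lambda>k. if q k = c then i else q k)"
        by (rule F_cong) (auto simp only: transpose_comp_apply[OF q] Suc_le_eq)
      then show ?thesis
        unfolding F_rec[OF assms] transpose_comp_self[OF q] A_sc sign_transpose_comp[OF q] by simp
    qed
    show ?thesis
    proof (cases "c = i")
      case True
      have "F (Suc i) (\<lambda>k. if q k = i then i else q k) = F (Suc i) q" for q
        by (rule F_cong) auto
      then show ?thesis unfolding True minor_def using e[of _] True
        by (simp add: A_sum)
    next
      case False
      then show ?thesis unfolding replaced_minor_def diff_Suc_1 using e
        by (simp add: A_sum sum_negf[symmetric])
    qed
  qed
  have "minor i = (\<Sum>c\<in>{i..N}. A i c (if c = i then minor (Suc i) else - replaced_minor (Suc i) c))"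
    unfolding minor_def[of i] sum_permutations_rec[OF assms] by (intro sum.cong refl *)
  also have "{i..N} = insert i {Suc i..N}" using assms by auto
  finally show ?thesis by simp
qed

text \<open>Column i - 1 has only zeros below row \<open>i\<close>, so row \<open>i\<close> must use
  it and contributes the scalar - f (i - 1).\<close>

lemma replaced_minor_rec:
  assumes "1 < i" "i \<le> N" "i \<le> b" "b \<le> N"
  shows "replaced_minor i b = sc (- f (i - 1)) (if b = i then minor (Suc i) else - replaced_minor (Suc i) b)"
proof -
  let ?g = "\<lambda>q. sc (of_int (sign q)) (F i (\<lambda>k. if q k = b then i - 1 else q k))"
  \<comment> \<open>If row \<open>i\<close> takes another column, some lower row takes column i - 1,
    where the entry is 0.\<close>
  have z: "?g (transpose i c \<circ> q) = 0" if c: "c \<in> {i..N}" "c \<noteq> b" and q: "q permutes {Suc i..N}" for c q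
  proof -
    let ?p = "transpose i c \<circ> q"
    have p: "?p permutes {i..N}"
      using q c(1) assms(2)
      by (intro permutes_compose permutes_swap_id permutes_subset[OF q]) auto
    have "b \<in> ?p ` {i..N}" using permutes_image[OF p] assms by simp
    then obtain k where k: "k \<in> {i..N}" "?p k = b" by (metis (no_types, lifting) image_iff)
    moreover have "k \<noteq> i" using k(2) c(2) transpose_comp_self[OF q, of c] by metis
    ultimately have "F i (\<lambda>k. if ?p k = b then i - 1 else ?p k) = 0"
      using assms by (intro F_zero[of i k]) (auto intro!: below)
    then show ?thesis by simp
  qed
  have e: "?g (transpose i b \<circ> q) = sc (- f (i - 1)) (sc ((if i = b then 1 else -1) * of_int (sign q))
      (F (Suc i) (\<lambda>k. if q k = b then i else q k)))" if q: "q permutes {Suc i..N}" for q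
  proof -
    have "F (Suc i) (\<lambda>k. if (transpose i b \<circ> q) k = b then i - 1 else (transpose i b \<circ> q) k)
        = F (Suc i) (\<lambda>k. if q k = b then i else q k)"
    proof (rule F_cong)
      fix k assume k: "Suc i \<le> k" "k \<le> N"
      have "q k \<noteq> i"
        using k permutes_inj[OF q] permutes_not_in[OF q, of i]
        by (metis atLeastAtMost_iff injD less_irrefl not_less_eq_eq order_refl)
      then show "(if (transpose i b \<circ> q) k = b then i - 1 else (transpose i b \<circ> q) k) = (if q k = b then i else q k)"
        using transpose_comp_apply[OF q, of k b] k by auto
    qed
    moreover have "A i (i - 1) y = sc (- f (i - 1)) y" for y
      using subdiag[of "i - 1" y] assms by simp
    ultimately show ?thesis
      unfolding F_rec[OF assms(2)] transpose_comp_self[OF q] sign_transpose_comp[OF q]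
      by (simp add: mult.commute)
  qed
  have "replaced_minor i b = (\<Sum>c\<in>{i..N}. \<Sum>q\<in>{q. q permutes {Suc i..N}}. ?g (transpose i c \<circ> q))"
    unfolding replaced_minor_def sum_permutations_rec[OF assms(2)] ..
  also have "\<dots> = (\<Sum>c\<in>{i..N}. if c = b then \<Sum>q\<in>{q. q permutes {Suc i..N}}. ?g (transpose i b \<circ> q) else 0)"
    using z by (intro sum.cong refl) (auto intro!: sum.neutral)
  also have "\<dots> = (\<Sum>q\<in>{q. q permutes {Suc i..N}}. ?g (transpose i b \<circ> q))"
    using assms by (simp add: sum.delta)
  also have "\<dots> = sc (- f (i - 1)) (\<Sum>q\<in>{q. q permutes {Suc i..N}}. sc ((if i = b then 1 else -1) * of_int (sign q))
      (F (Suc i) (\<lambda>k. if q k = b then i else q k)))"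
    unfolding sc_sum[of "- f (i - 1)"] using e by (intro sum.cong refl) simp
  also have "(\<Sum>q\<in>{q. q permutes {Suc i..N}}. sc ((if i = b then 1 else -1) * of_int (sign q))
      (F (Suc i) (\<lambda>k. if q k = b then i else q k))) = (if b = i then minor (Suc i) else - replaced_minor (Suc i) b)"
  proof (cases "b = i")
    case True
    have "F (Suc i) (\<lambda>k. if q k = i then i else q k) = F (Suc i) q" for q
      by (rule F_cong) auto
    then show ?thesis using True by (simp add: minor_def)
  next
    case False
    then show ?thesis unfolding replaced_minor_def diff_Suc_1 by (simp add: sum_negf[symmetric])
  qed
  finally show ?thesis .
qed

text \<open>The sign of the subdiagonal entry cancels that of the transposition at every step but
  the last, which leaves one overall minus.\<close>

lemma replaced_minor_eq:
  assumes "1 < i" "i \<le> b" "b \<le> N"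
  shows "replaced_minor i b = - sc (\<Prod>k\<in>{i - 1..<b}. f k) (minor (Suc b))"
  using assms
proof (induction "b - i" arbitrary: i)
  case 0
  then have "b = i" by simp
  moreover have "{i - 1..<i} = {i - 1}" using 0 by auto
  ultimately show ?case using replaced_minor_rec[of i b] 0 by simp
next
  case (Suc d)
  then have "i < b" by simp
  have "replaced_minor (Suc i) b = - sc (\<Prod>k\<in>{i..<b}. f k) (minor (Suc b))"
    using Suc.hyps(1)[of "Suc i"] Suc.hyps(2) Suc.prems \<open>i < b\<close> by simp
  moreover have "{i - 1..<b} = insert (i - 1) {i..<b}" using Suc.prems by auto
  then have "(\<Prod>k\<in>{i - 1..<b}. f k) = f (i - 1) * (\<Prod>k\<in>{i..<b}. f k)" using Suc.prems by simp
  ultimately show ?case using replaced_minor_rec[of i b] Suc.prems \<open>i < b\<close> by simp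
qed

text \<open>Only trailing minors remain, so the determinant comes from a triangular elimination.
  Gauge invariance, the weights and the linear coefficients are all derived from this
  recursion.\<close>

lemma minor_rec:
  assumes "1 \<le> i" "i \<le> N"
  shows "minor i = (\<Sum>j\<in>{i..N}. sc (\<Prod>k\<in>{i..<j}. f k) (A i j (minor (Suc j))))"
proof -
  have "minor i = A i i (minor (Suc i)) + (\<Sum>j\<in>{Suc i..N}. sc (\<Prod>k\<in>{i..<j}. f k) (A i j (minor (Suc j))))"
    unfolding minor_replaced[OF assms(2)]
    using assms by (intro arg_cong2[of _ _ _ _ "(+)"] refl sum.cong) (simp add: replaced_minor_eq A_sc)
  moreover have "{i..N} = insert i {Suc i..N}" using assms by auto
  ultimately show ?thesis by simp
qed

end

subsection \<open>The operator matrix\<close>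

definition rm :: "nat \<Rightarrow> nat \<Rightarrow> nat \<Rightarrow> supalg" where
  "rm n i j = rho n (qm n i j)"

definition Aop :: "nat \<Rightarrow> nat \<Rightarrow> nat \<Rightarrow> supalg \<Rightarrow> supalg" where
  "Aop n i j y = (if i = j then D y else 0) + rm n i j * y"

text \<open>\<open>psi t\<close> stands for D^t applied to a free even variable. The index (0, 3)
  gives it parity t and differs from the indices (0, 1) and (0, 2) used by
  \<open>eps\<close>.\<close>

definition psi :: "nat \<Rightarrow> supalg" where "psi t = gen (t, (0, 3))"

lemma D_psi [simp]: "D (psi t) = psi (Suc t)" by (simp add: psi_def)

lemma hp_psi: "hp (odd t) (psi t)"
proof -
  have g: "gpar (t, (0, 3)) = odd t" by (simp add: gpar_def bpar_def pp_def)
  show ?thesis unfolding psi_def using hp_gen[of "(t, (0, 3))"] unfolding g .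
qed

lemma clinear_Aop: "clinear (Aop n i j)"
  by (simp add: clinear_def Aop_def distrib_left)

text \<open>The left coefficients of the product of the entries selected by \<open>s\<close>; a
  diagonal entry uses D c D^t = D(c) D^t + sig(c) D^(t+1).\<close>

fun dpl :: "nat \<Rightarrow> (nat \<Rightarrow> nat) \<Rightarrow> nat list \<Rightarrow> nat \<Rightarrow> supalg" where
  "dpl n s [] t = (if t = 0 then 1 else 0)"
| "dpl n s (i # is) t = (if s i = i then D (dpl n s is t) + (if t = 0 then 0 else sig (dpl n s is (t - 1))) else 0)
     + rm n i (s i) * dpl n s is t"

lemma dpl_bound: "t > length is \<Longrightarrow> dpl n s is t = 0"
  by (induction "is" arbitrary: t) auto

lemma dpl_psi:
  "length is \<le> M \<Longrightarrow> (\<Sum>t\<le>M. dpl n s is t * psi t) = foldr (\<lambda>k y. Aop n k (s k) y) is (psi 0)"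
proof (induction "is" arbitrary: M)
  case Nil
  have "(\<Sum>t\<le>M. dpl n s [] t * psi t) = (\<Sum>t\<in>{0}. dpl n s [] t * psi t)"
    by (rule sum.mono_neutral_right) auto
  then show ?case by simp
next
  case (Cons i "is")
  then obtain M' where M: "M = Suc M'" "length is \<le> M'" by (cases M) auto
  let ?p = "dpl n s is"
  have IH: "(\<Sum>t\<le>M'. ?p t * psi t) = foldr (\<lambda>k y. Aop n k (s k) y) is (psi 0)"
    by (rule Cons.IH[OF M(2)])
  have IH': "(\<Sum>t\<le>M. ?p t * psi t) = foldr (\<lambda>k y. Aop n k (s k) y) is (psi 0)"
    by (rule Cons.IH) (use M in simp)
  have "(\<Sum>t\<le>M. (if t = 0 then 0 else sig (?p (t - 1))) * psi t) = (\<Sum>t\<le>M'. sig (?p t) * psi (Suc t))"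
    unfolding M(1) sum.atMost_Suc_shift by simp
  moreover have "(\<Sum>t\<le>M. D (?p t) * psi t) = (\<Sum>t\<le>M'. D (?p t) * psi t)"
    unfolding M(1) sum.atMost_Suc using dpl_bound[of "is" "Suc M'" n s] M(2) by simp
  ultimately have "(\<Sum>t\<le>M. (D (?p t) + (if t = 0 then 0 else sig (?p (t - 1)))) * psi t) = D (\<Sum>t\<le>M'. ?p t * psi t)"
    by (simp add: D_sum D_mult distrib_right sum.distrib)
  then have 1: "(\<Sum>t\<le>M. (if s i = i then D (?p t) + (if t = 0 then 0 else sig (?p (t - 1))) else 0) * psi t)
      = (if s i = i then D (foldr (\<lambda>k y. Aop n k (s k) y) is (psi 0)) else 0)"
    using IH by simp
  have 2: "(\<Sum>t\<le>M. rm n i (s i) * ?p t * psi t) = rm n i (s i) * foldr (\<lambda>k y. Aop n k (s k) y) is (psi 0)"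
    using IH' by (simp add: mult.assoc flip: sum_distrib_left)
  have "(\<Sum>t\<le>M. dpl n s (i # is) t * psi t) =
     (\<Sum>t\<le>M. (if s i = i then D (?p t) + (if t = 0 then 0 else sig (?p (t - 1))) else 0) * psi t)
     + (\<Sum>t\<le>M. rm n i (s i) * ?p t * psi t)"
    unfolding sum.distrib[symmetric] by (simp add: distrib_right)
  then show ?case unfolding 1 2 by (auto simp: Aop_def[of n i])
qed

lemma Amat_cf:
  assumes i: "i \<in> Iset n" and j: "j \<in> Iset n"
  shows "Amat n i j t = cf (if t = 0 then rm n i j else if t = 1 \<and> i = j then 1 else 0)"
proof (cases "i \<le> j")
  case True
  have "barV n (Emat n j i) = cf (rm n i j)"
    using rho_qm_upper[OF i j True] by (simp add: barV_cf rm_def qm_def)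
  then show ?thesis using True
    by (auto simp: Amat_def dop_add_def dop_const_def dop_D_def sa_add_def fun_eq_iff one_supalg.rep_eq)
next
  case False
  then have "rm n i j = K (- fmat n i j)" using rho_qm_lower[OF i j] by (simp add: rm_def)
  with False show ?thesis
    by (auto simp: Amat_def dop_const_def sa_const_cf zero_cf)
qed

lemma dop_mult_Amat:
  assumes i: "i \<in> Iset n" and j: "j \<in> Iset n"
  shows "dop_mult (Amat n i j) (\<lambda>t. cf (p t)) t =
    cf ((if i = j then D (p t) + (if t = 0 then 0 else sig (p (t - 1))) else 0) + rm n i j * p t)"
proof
  fix M
  let ?P = "Amat n i j"
  have s: "dop_supp ?P \<subseteq> {0, 1}"
    unfolding dop_supp_def using Amat_cf[OF i j] by (auto simp: zero_cf)
  have z: "Vmult (?P s) y M = 0" if "s \<notin> dop_supp ?P" "y = cf y'" for s y y'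
    using that Vmult_cf[of 0 y'] by (simp add: dop_supp_def zero_cf)
  have d: "dop_Dleft (\<lambda>t. cf (p t)) t = cf (D (p t) + (if t = 0 then 0 else sig (p (t - 1))))"
    unfolding dop_Dleft_def by (auto simp: VD_cf sa_sigma_cf sa_add_def fun_eq_iff)
  have "dop_mult ?P (\<lambda>t. cf (p t)) t M = (\<Sum>s\<in>{0, 1}. Vmult (?P s) ((dop_Dleft ^^ s) (\<lambda>t. cf (p t)) t) M)"
    unfolding dop_mult_def using s
  proof (intro sum.mono_neutral_left ballI)
    fix s assume "s \<in> {0, 1} - dop_supp ?P"
    then have "(s = 0 \<or> s = 1) \<and> s \<notin> dop_supp ?P" by auto
    then show "Vmult (?P s) ((dop_Dleft ^^ s) (\<lambda>t. cf (p t)) t) M = 0"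
      using z[of s] d by auto
  qed auto
  also have "\<dots> = cf ((if i = j then D (p t) + (if t = 0 then 0 else sig (p (t - 1))) else 0) + rm n i j * p t) M"
    by (simp add: Amat_cf[OF i j] d Vmult_cf)
  finally show "dop_mult ?P (\<lambda>t. cf (p t)) t M =
    cf ((if i = j then D (p t) + (if t = 0 then 0 else sig (p (t - 1))) else 0) + rm n i j * p t) M" .
qed

lemma dop_listprod_Amat:
  assumes "\<forall>i\<in>set is. i \<in> Iset n \<and> s i \<in> Iset n"
  shows "dop_listprod (map (\<lambda>i. Amat n i (s i)) is) = (\<lambda>t. cf (dpl n s is t))"
  using assms
proof (induction "is")
  case Nil
  show ?case by (auto simp: fun_eq_iff one_supalg.rep_eq)
next
  case (Cons i "is")
  then have IH: "dop_listprod (map (\<lambda>i. Amat n i (s i)) is) = (\<lambda>t. cf (dpl n s is t))" by simp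
  have i: "i \<in> Iset n" "s i \<in> Iset n" using Cons.prems by auto
  show ?case
    unfolding list.map dop_listprod.simps IH
  proof
    fix t
    show "dop_mult (Amat n i (s i)) (\<lambda>t. cf (dpl n s is t)) t = cf (dpl n s (i # is) t)"
      unfolding dop_mult_Amat[OF i] by (simp add: eq_commute[of i])
  qed
qed

definition rd :: "nat \<Rightarrow> nat \<Rightarrow> supalg" where
  "rd n t = (\<Sum>\<sigma>\<in>{\<sigma>. \<sigma> permutes Iset n}. sc (of_int (sign \<sigma>)) (dpl n \<sigma> [1..<NN n + 1] t))"

lemma set_upt_Iset: "set [1..<NN n + 1] = Iset n"
  by (auto simp: Iset_def)

lemma wgen_cf: "wgen n k = cf (rd n (NN n - k))"
proof
  fix M
  have "dop_listprod (map (\<lambda>i. Amat n i (\<sigma> i)) [1..<NN n + 1]) = (\<lambda>t. cf (dpl n \<sigma> [1..<NN n + 1] t))"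
    if "\<sigma> permutes Iset n" for \<sigma>
    using that permutes_in_image[OF that] set_upt_Iset by (intro dop_listprod_Amat) blast
  then show "wgen n k M = cf (rd n (NN n - k)) M"
    unfolding wgen_def rdet_def rd_def cf_sum Iset_def[symmetric] by (intro sum.cong refl) simp
qed

text \<open>Theta keeps the subdiagonal: i' = (i + 1)' + 1.\<close>

lemma fmat_entry:
  assumes "k \<in> Iset n" "l \<in> Iset n" "k \<noteq> l + 1"
  shows "fmat n k l = 0"
  unfolding fmat_def
proof (rule sum.neutral, rule ballI)
  fix i assume "i \<in> {1..2 * n - 1}"
  then show "Fm n (i + 1) i k l = 0"
    using assms by (auto simp: Fm_def emat_def prm_def Iset_def NN_def)
qed

lemma fmat_first: "1 \<le> l \<Longrightarrow> l \<le> 2 * n - 1 \<Longrightarrow> fmat n (l + 1) l = 1"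
proof -
  assume l: "1 \<le> l" "l \<le> 2 * n - 1"
  have "fmat n (l + 1) l = (\<Sum>i\<in>{1..2 * n - 1}. if i = l then 1 else 0)"
    unfolding fmat_def using l by (intro sum.cong refl) (auto simp: Fm_def emat_def prm_def)
  then show ?thesis using l by simp
qed

text \<open>The first 2n - 1 subdiagonal entries are 1; the others are their images under theta,
  hence signs.\<close>

lemma fmat_nonzero:
  assumes "1 \<le> l" "l < NN n" shows "fmat n (l + 1) l \<noteq> 0"
proof (cases "l \<le> 2 * n - 1")
  case True
  then show ?thesis using fmat_first assms by simp
next
  case False
  have I: "l + 1 \<in> Iset n" "l \<in> Iset n" using assms by (auto simp: Iset_def)
  have p: "prm n l = prm n (l + 1) + 1" "1 \<le> prm n (l + 1)" "prm n (l + 1) \<le> 2 * n - 1"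
    using assms False by (auto simp: prm_def NN_def)
  have "fmat n (l + 1) l = th_sign n (l + 1) l * 1"
    using Gmat_sym[OF Gmat_fmat I] fmat_first[OF p(2,3)] p(1) by simp
  then show ?thesis by (simp add: th_sign_def)
qed

lemma hessenberg_Aop: "hessenberg (NN n) (Aop n) (\<lambda>j. fmat n (j + 1) j)"
proof
  show "clinear (Aop n i j)" for i j by (rule clinear_Aop)
  fix i j y
  show "Aop n i j y = 0" if "1 \<le> j" "i \<le> NN n" "j + 1 < i"
  proof -
    have "i \<in> Iset n" "j \<in> Iset n" "j < i" using that by (auto simp: Iset_def)
    then have "rm n i j = 0"
      using rho_qm_lower[of i n j] fmat_entry[of i n j] that by (simp add: rm_def)
    then show ?thesis using that by (simp add: Aop_def)
  qed
next
  fix j y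
  show "Aop n (j + 1) j y = sc (- fmat n (j + 1) j) y" if "1 \<le> j" "j < NN n"
  proof -
    have "j + 1 \<in> Iset n" "j \<in> Iset n" using that by (auto simp: Iset_def)
    then show ?thesis using rho_qm_lower[of "j + 1" n j] by (simp add: Aop_def rm_def K_uminus)
  qed
qed

abbreviation minr :: "nat \<Rightarrow> nat \<Rightarrow> supalg" where
  "minr n i \<equiv> hessenberg.minor (NN n) (Aop n) (psi 0) i"

lemma minr_rd: "minr n 1 = (\<Sum>t\<le>NN n. rd n t * psi t)"
proof -
  interpret hessenberg "NN n" "Aop n" "\<lambda>j. fmat n (j + 1) j" "psi 0" by (rule hessenberg_Aop)
  have "minor 1 = (\<Sum>\<sigma>\<in>{\<sigma>. \<sigma> permutes Iset n}. sc (of_int (sign \<sigma>)) (\<Sum>t\<le>NN n. dpl n \<sigma> [1..<NN n + 1] t * psi t))"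
    unfolding minor_def F_def Iset_def by (subst dpl_psi) auto
  also have "\<dots> = (\<Sum>t\<le>NN n. rd n t * psi t)"
    unfolding rd_def sum_distrib_right sc_sum by (subst sum.swap) simp
  finally show ?thesis .
qed

subsection \<open>Gauge invariance\<close>

lemma inV_rm: "i \<in> Iset n \<Longrightarrow> j \<in> Iset n \<Longrightarrow> inV (Bas_p n) (rm n i j)"
  using inV_qm[of i n j] rho_qm_upper[of i n j] rho_qm_lower[of i n j]
  by (cases "i \<le> j") (auto simp: rm_def not_le)

lemma rho_rm: "i \<in> Iset n \<Longrightarrow> j \<in> Iset n \<Longrightarrow> rho n (rm n i j) = rm n i j"
  by (rule rho_id[OF _ inV_rm]) (auto simp: Bas_disjoint)

lemma rho_psi [simp]: "rho n (psi t) = psi t"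
  by (simp add: psi_def rho_gen rh_def Bas_n_def Bas_def Iset_def)

lemma delta_psi [simp]: "a \<in> Bas n \<Longrightarrow> delta n a (psi t) = 0"
  by (simp add: psi_def delta_gen dv_def Bas_def Iset_def)

lemma inV_dpl:
  assumes "\<forall>i\<in>set is. i \<in> Iset n \<and> s i \<in> Iset n" shows "inV (Bas_p n) (dpl n s is t)"
  using assms by (induction "is" arbitrary: t) (auto intro!: inV_add inV_D inV_sig inV_mult inV_rm)

lemma inV_rd: "inV (Bas_p n) (rd n t)"
  unfolding rd_def
proof (intro inV_sum inV_sc inV_dpl)
  fix \<sigma> assume "\<sigma> \<in> {\<sigma>. \<sigma> permutes Iset n}"
  then show "\<forall>i\<in>set [1..<NN n + 1]. i \<in> Iset n \<and> \<sigma> i \<in> Iset n"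
    using permutes_in_image[of \<sigma> "Iset n"] set_upt_Iset by blast
qed

lemma rho_minr: "rho n (minr n i) = minr n i" if "i \<ge> 1"
proof -
  interpret hessenberg "NN n" "Aop n" "\<lambda>j. fmat n (j + 1) j" "psi 0" by (rule hessenberg_Aop)
  have f: "rho n (foldr (\<lambda>k y. Aop n k (s k) y) is (psi 0)) = foldr (\<lambda>k y. Aop n k (s k) y) is (psi 0)"
    if "\<forall>i\<in>set is. i \<in> Iset n \<and> s i \<in> Iset n" for s "is"
    using that by (induction "is") (auto simp: Aop_def rho_D rho_mult rho_rm)
  have "rho n (F i \<sigma>) = F i \<sigma>" if "\<sigma> permutes {i..NN n}" for \<sigma>
  proof -
    have "\<sigma> k \<in> {i..NN n}" if "k \<in> {i..NN n}" for k
      using permutes_in_image[OF \<open>\<sigma> permutes {i..NN n}\<close>] that by blast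
    moreover have "{i..NN n} \<subseteq> Iset n" using \<open>i \<ge> 1\<close> by (auto simp: Iset_def)
    ultimately show ?thesis unfolding F_def by (intro f) (auto simp: subset_iff)
  qed
  then show ?thesis unfolding minor_def rho_sum by (intro sum.cong refl) simp
qed

lemma strictly_upper:
  assumes "a \<in> Bas_n n" "k \<in> Iset n" "l \<in> Iset n" "l \<le> k"
  shows "Fb n a k l = 0"
proof -
  obtain i j where a: "a = (i, j)" by (cases a)
  have "i \<in> Iset n" "j \<in> Iset n" "i < j" using assms(1) a by (auto simp: Bas_n_def Bas_def)
  moreover from this have "prm n j < prm n i" by (auto simp: prm_def Iset_def NN_def)
  ultimately show ?thesis using assms(4) by (auto simp: a Fb_def Fm_def emat_def)
qed

text \<open>Above the diagonal this is the reduction of \<open>delta_qm\<close>. Below it the entry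
  is constant, and the right-hand side vanishes as well, because \<open>X\<close> is strictly upper
  triangular while the constants of \<open>rm\<close> lie only directly below the diagonal.\<close>

lemma rho_delta_rm:
  assumes a: "a \<in> Bas_n n" and i: "i \<in> Iset n" and j: "j \<in> Iset n"
  defines "X \<equiv> Fb n a"
  shows "rho n (delta n a (rm n i j)) = (\<Sum>k\<in>Iset n. sc (X k j) (rm n i k * eps a 0)) + sc (X i j) (eps a 1)
     - (\<Sum>k\<in>Iset n. sc ((-1) ^ bpar a * X i k) (eps a 0 * rm n k j))"
proof (cases "i \<le> j")
  case True
  have aB: "a \<in> Bas n" using a Bas_n_subset by blast
  show ?thesis
    unfolding rm_def rho_qm_upper[OF i j True] delta_qm[OF aB i j] X_def
    by (simp add: rho_sum rho_mult)
next
  case False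
  have aB: "a \<in> Bas n" using a Bas_n_subset by blast
  have "rm n i j = K (- fmat n i j)" using rho_qm_lower[OF i j] False by (simp add: rm_def)
  then have l: "rho n (delta n a (rm n i j)) = 0"
    by (simp add: delta_def Der_K[OF dpar_dv[OF aB]] del: K_uminus)
  have low: "rm n k l = 0" if "k \<in> Iset n" "l \<in> Iset n" "l + 1 < k" for k l
    using rho_qm_lower[of k n l] fmat_entry[of k n l] that by (simp add: rm_def)
  have 1: "sc (X k j) (rm n i k * eps a 0) = 0" if k: "k \<in> Iset n" for k
  proof (cases "k < j")
    case True
    then show ?thesis using low[OF i k] False by simp
  next
    case False
    then show ?thesis using strictly_upper[OF a k j] by (simp add: X_def)
  qed
  have 2: "sc ((-1) ^ bpar a * X i k) (eps a 0 * rm n k j) = 0" if k: "k \<in> Iset n" for k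
  proof (cases "i < k")
    case True
    then show ?thesis using low[OF k j] False by simp
  next
    case False
    then show ?thesis using strictly_upper[OF a i k] by (simp add: X_def)
  qed
  have 3: "X i j = 0" using strictly_upper[OF a i j] False by (simp add: X_def)
  show ?thesis using l 1 2 3 by simp
qed

text \<open>With \<open>\<phi>\<close> the column given by \<open>\<phi>\<^sub>N = \<psi>\<close> and \<open>A \<phi> = (L \<psi>, 0, \<dots>, 0)\<close>, the derivation acts on
 \<open>A\<close> by \<open>A X - Y A\<close> with \<open>X\<close>, \<open>Y\<close> strictly upper triangular, whence
 \<open>A (\<delta> \<phi> + X \<phi>) = (\<delta> (L \<psi>), 0, \<dots>, 0)\<close>; as the last entry of \<open>\<delta> \<phi> + X \<phi>\<close> is 0, so are all the others.\<close>

lemma delta_minr: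
  assumes a: "a \<in> Bas_n n" and n: "n \<ge> 1"
  shows "rho n (delta n a (minr n 1)) = 0"
proof -
  let ?N = "NN n"
  have N1: "1 \<le> ?N" using n by (simp add: NN_def)
  interpret hessenberg ?N "Aop n" "\<lambda>j. fmat n (j + 1) j" "psi 0" by (rule hessenberg_Aop)
  have aB: "a \<in> Bas n" using a Bas_n_subset by blast
  define X where "X = Fb n a"
  define f where "f = (\<lambda>j. fmat n (j + 1) j)"
  define pf where "pf i = (\<Prod>k\<in>{i..<?N}. f k)" for i
  have f0: "f j \<noteq> 0" if "1 \<le> j" "j < ?N" for j using fmat_nonzero[OF that] by (simp add: f_def)
  have pf0: "pf i \<noteq> 0" if "1 \<le> i" for i unfolding pf_def using f0 that by auto
  \<comment> \<open>Solution of the system by elimination from the bottom: after division by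
    \<open>pf\<close>, row i of \<open>A \<phi>\<close> cancels for i > 1 and is the normalised
    determinant for i = 1.\<close>
  define \<phi> where "\<phi> j = sc (inverse (pf j)) (minor (Suc j))" for j
  define d where "d y = rho n (delta n a y)" for y
  have d_add: "d (y + z) = d y + d z" and d_sc: "d (sc c y) = sc c (d y)" and d_0: "d 0 = 0" for y z c
    by (simp_all add: d_def)
  have d_sum: "d (\<Sum>i\<in>I. g i) = (\<Sum>i\<in>I. d (g i))" for g and I :: "nat set"
    by (simp add: d_def delta_sum rho_sum)
  have rphi: "rho n (\<phi> j) = \<phi> j" for j by (simp add: \<phi>_def rho_minr)
  have phiN: "\<phi> ?N = psi 0" by (simp add: \<phi>_def pf_def minor_end)
  have upper: "(\<Sum>j\<in>{i..?N}. Aop n i j (\<phi> j)) = sc (inverse (pf i)) (minor i)" if i: "i \<in> Iset n" for i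
  proof -
    have i': "1 \<le> i" "i \<le> ?N" using i by (auto simp: Iset_def)
    have "(\<Prod>k\<in>{i..<j}. f k) * pf j = pf i" if "j \<in> {i..?N}" for j
      unfolding pf_def using that i' by (simp add: prod.atLeastLessThan_concat)
    then have "inverse (pf i) * (\<Prod>k\<in>{i..<j}. f k) = inverse (pf j)" if "j \<in> {i..?N}" for j
      using that pf0[of i] pf0[of j] i' by (simp add: field_simps)
    then show ?thesis
      unfolding minor_rec[OF i'] sc_sum f_def[symmetric]
      by (intro sum.cong refl) (simp add: \<phi>_def A_sc f_def)
  qed
  have Aphi: "(\<Sum>j\<in>Iset n. Aop n i j (\<phi> j)) = (if i = 1 then sc (inverse (pf 1)) (minor 1) else 0)" if i: "i \<in> Iset n" for i
  proof (cases "i = 1")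
    case True
    then show ?thesis using upper[OF i] by (simp add: Iset_def)
  next
    case False
    then have i': "1 < i" "i \<le> ?N" "1 \<le> i - 1" "i - 1 < ?N" using i by (auto simp: Iset_def)
    have "{1..?N} = {1..<i - 1} \<union> {i - 1} \<union> {i..?N}" using i' by auto
    moreover have "{1..<i - 1} \<inter> {i..?N} = {}" by auto
    ultimately have "(\<Sum>j\<in>Iset n. Aop n i j (\<phi> j)) = (\<Sum>j\<in>{1..<i - 1}. Aop n i j (\<phi> j)) + Aop n i (i - 1) (\<phi> (i - 1)) + (\<Sum>j\<in>{i..?N}. Aop n i j (\<phi> j))"
      unfolding Iset_def using i' by (simp add: sum.union_disjoint)
    also have "(\<Sum>j\<in>{1..<i - 1}. Aop n i j (\<phi> j)) = 0"
      using i' by (intro sum.neutral ballI below) auto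
    also have "Aop n i (i - 1) (\<phi> (i - 1)) = - sc (f (i - 1) * inverse (pf (i - 1))) (minor i)"
      using subdiag[of "i - 1" "\<phi> (i - 1)"] i' by (simp add: \<phi>_def f_def)
    also have "f (i - 1) * inverse (pf (i - 1)) = inverse (pf i)"
    proof -
      have "{i - 1..<?N} = insert (i - 1) {i..<?N}" using i' by auto
      then have "pf (i - 1) = f (i - 1) * pf i" unfolding pf_def using i' by simp
      then show ?thesis using f0[of "i - 1"] i' by simp
    qed
    finally show ?thesis using upper[OF i] False by simp
  qed
  \<comment> \<open>Here \<chi> is the column \<open>X \<phi>\<close> multiplied by the test
    variable, not the variable of the bracket.\<close>
  define \<chi> where "\<chi> k = (\<Sum>j\<in>Iset n. sc (X k j) (eps a 0 * \<phi> j))" for k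
  have sige: "sig (eps a 0) = sc ((-1) ^ bpar a) (eps a 0)"
    using sig_hp[OF hp_eps[of a 0]] by auto
  have dA: "d (Aop n i j y) = d (rm n i j) * y + Aop n i j (d y)"
    if "i \<in> Iset n" "j \<in> Iset n" "rho n y = y" for i j y
    using that by (simp add: d_def Aop_def delta_D[OF aB] delta_mult[OF aB] rho_D rho_mult rho_rm)
  have dr: "(\<Sum>j\<in>Iset n. d (rm n i j) * \<phi> j) = (\<Sum>k\<in>Iset n. Aop n i k (\<chi> k))" if i: "i \<in> Iset n" for i
  proof -
    have "(\<Sum>j\<in>Iset n. d (rm n i j) * \<phi> j) =
        (\<Sum>j\<in>Iset n. \<Sum>k\<in>Iset n. sc (X k j) (rm n i k * eps a 0 * \<phi> j)) + (\<Sum>j\<in>Iset n. sc (X i j) (eps a 1 * \<phi> j))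
        - (\<Sum>j\<in>Iset n. \<Sum>k\<in>Iset n. sc ((-1) ^ bpar a * X i k) (eps a 0 * rm n k j * \<phi> j))"
      unfolding d_def sum.distrib[symmetric] sum_subtractf[symmetric] X_def
      by (intro sum.cong refl) (simp add: rho_delta_rm[OF a i] algebra_simps sum_distrib_right)
    also have "(\<Sum>j\<in>Iset n. \<Sum>k\<in>Iset n. sc (X k j) (rm n i k * eps a 0 * \<phi> j)) = (\<Sum>k\<in>Iset n. rm n i k * \<chi> k)"
      unfolding \<chi>_def sum_distrib_left by (subst sum.swap) (simp add: mult.assoc)
    also have "(\<Sum>j\<in>Iset n. \<Sum>k\<in>Iset n. sc ((-1) ^ bpar a * X i k) (eps a 0 * rm n k j * \<phi> j)) =
        (\<Sum>k\<in>Iset n. sc ((-1) ^ bpar a * X i k) (eps a 0 * (\<Sum>j\<in>Iset n. rm n k j * \<phi> j)))"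
      unfolding sum_distrib_left sc_sum by (subst sum.swap) (simp add: mult.assoc)
    also have "\<dots> = - (\<Sum>k\<in>Iset n. sc ((-1) ^ bpar a * X i k) (eps a 0 * D (\<phi> k)))"
      unfolding sum_negf[symmetric]
    proof (intro sum.cong refl)
      fix k assume k: "k \<in> Iset n"
      show "sc ((-1) ^ bpar a * X i k) (eps a 0 * (\<Sum>j\<in>Iset n. rm n k j * \<phi> j)) = - sc ((-1) ^ bpar a * X i k) (eps a 0 * D (\<phi> k))"
      \<comment> \<open>Row 1 is the only one on which \<open>A \<phi>\<close> need not vanish, and
        it does not enter, because the first column of \<open>X\<close> is 0.\<close>
      proof (cases "k = 1")
        case True
        then have "X i k = 0" unfolding X_def using i k by (intro strictly_upper[OF a]) (auto simp: Iset_def)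
        then show ?thesis by simp
      next
        case False
        have "(\<Sum>j\<in>Iset n. Aop n k j (\<phi> j)) = D (\<phi> k) + (\<Sum>j\<in>Iset n. rm n k j * \<phi> j)"
          unfolding Aop_def sum.distrib using k by (simp add: sum.delta)
        then have "(\<Sum>j\<in>Iset n. rm n k j * \<phi> j) = - D (\<phi> k)"
          using Aphi[OF k] False by (simp add: add_eq_0_iff2)
        then show ?thesis by simp
      qed
    qed
    finally have 1: "(\<Sum>j\<in>Iset n. d (rm n i j) * \<phi> j) = (\<Sum>k\<in>Iset n. rm n i k * \<chi> k) + (\<Sum>j\<in>Iset n. sc (X i j) (eps a 1 * \<phi> j))
        + (\<Sum>k\<in>Iset n. sc ((-1) ^ bpar a * X i k) (eps a 0 * D (\<phi> k)))" by simp
    have 2: "D (\<chi> i) = (\<Sum>j\<in>Iset n. sc (X i j) (eps a 1 * \<phi> j)) + (\<Sum>k\<in>Iset n. sc ((-1) ^ bpar a * X i k) (eps a 0 * D (\<phi> k)))"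
      unfolding \<chi>_def D_sum sum.distrib[symmetric]
      by (intro sum.cong refl) (simp add: D_mult sige mult.commute)
    have 3: "(\<Sum>k\<in>Iset n. Aop n i k (\<chi> k)) = D (\<chi> i) + (\<Sum>k\<in>Iset n. rm n i k * \<chi> k)"
      unfolding Aop_def sum.distrib using i by (simp add: sum.delta)
    show ?thesis unfolding 1 2 3 by (simp add: algebra_simps)
  qed
  define v where "v k = \<chi> k + d (\<phi> k)" for k
  have Av: "(\<Sum>j\<in>Iset n. Aop n i j (v j)) = (if i = 1 then sc (inverse (pf 1)) (d (minor 1)) else 0)" if i: "i \<in> Iset n" for i
  proof -
    have "(\<Sum>j\<in>Iset n. Aop n i j (v j)) = (\<Sum>j\<in>Iset n. d (rm n i j) * \<phi> j) + (\<Sum>j\<in>Iset n. Aop n i j (d (\<phi> j)))"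
      unfolding dr[OF i] v_def sum.distrib[symmetric] by (simp add: clinear_add[OF clinear_Aop])
    also have "\<dots> = d (\<Sum>j\<in>Iset n. Aop n i j (\<phi> j))"
      unfolding d_sum sum.distrib[symmetric] using i by (intro sum.cong refl) (simp add: dA rphi)
    finally show ?thesis unfolding Aphi[OF i] by (simp add: d_sc d_0)
  qed
  \<comment> \<open>Back substitution: row j + 1 has right-hand side 0, and its subdiagonal entry is
    an invertible constant.\<close>
  have vz: "v j = 0" if "1 \<le> j" "j \<le> ?N" for j
    using that
  proof (induction "?N - j" arbitrary: j rule: less_induct)
    case less
    show ?case
    proof (cases "j = ?N")
      case True
      have "X ?N k = 0" if "k \<in> Iset n" for k
        unfolding X_def using that N1 by (intro strictly_upper[OF a]) (auto simp: Iset_def)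
      then have "\<chi> ?N = 0" unfolding \<chi>_def by simp
      then show ?thesis unfolding v_def True phiN by (simp add: d_def aB)
    next
      case False
      then have j: "j + 1 \<in> Iset n" "1 \<le> j" "j < ?N" using less.prems by (auto simp: Iset_def)
      have z: "Aop n (j + 1) k (v k) = 0" if "k \<in> Iset n" "k \<noteq> j" for k
      proof (cases "k < j")
        case True
        then show ?thesis using that j by (intro below) (auto simp: Iset_def)
      next
        case False
        then have "v k = 0" using that j by (intro less.hyps) (auto simp: Iset_def)
        then show ?thesis by simp
      qed
      have "(\<Sum>k\<in>Iset n. Aop n (j + 1) k (v k)) = (\<Sum>k\<in>{j}. Aop n (j + 1) k (v k))"
        using j z by (intro sum.mono_neutral_right) (auto simp: Iset_def)
      then have "sc (- f j) (v j) = 0"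
        using Av[OF j(1)] subdiag[OF j(2,3)] j by (simp add: f_def)
      then have "sc (inverse (f j)) (sc (- f j) (v j)) = 0" by (simp only: sc_0_right)
      then show ?thesis using f0[OF j(2,3)] by simp
    qed
  qed
  have "sc (inverse (pf 1)) (d (minor 1)) = 0"
    using Av[of 1] vz N1 by (simp add: Iset_def)
  then have "sc (pf 1) (sc (inverse (pf 1)) (d (minor 1))) = 0" by (simp only: sc_0_right)
  then show ?thesis using pf0[of 1] by (simp add: d_def)
qed

text \<open>The derivation kills \<open>psi\<close> and its derivatives, and these are fresh, so
  invariance of the operator applied to \<open>psi\<close> passes to each coefficient.\<close>

lemma inW_rd:
  assumes n: "n \<ge> 1" shows "inW n (rd n t)"
proof (cases "t \<le> NN n")
  case False
  then have "rd n t = 0" unfolding rd_def by (simp add: dpl_bound)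
  then show ?thesis by (simp add: inW_0)
next
  case True
  have "rho n (delta n a (rd n t)) = 0" if a: "a \<in> Bas_n n" for a
  proof -
    have aB: "a \<in> Bas n" using a Bas_n_subset by blast
    let ?y = "\<lambda>t. rho n (delta n a (rd n t))"
    \<comment> \<open>Moving \<open>psi t\<close> to the left twists its coefficient by
      \<open>sig\<close> when t is odd.\<close>
    let ?z = "\<lambda>t. if odd t then sig (?y t) else ?y t"
    let ?E = "(0, bpar a + 1)"
    have "(\<Sum>t\<le>NN n. psi t * ?z t) = (\<Sum>t\<le>NN n. ?y t * psi t)"
      using hp_comm_any[OF hp_psi] by (intro sum.cong refl) auto
    also have "\<dots> = 0"
      using delta_minr[OF a n] unfolding minr_rd by (simp add: delta_sum delta_mult[OF aB] rho_sum rho_mult aB)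
    finally have s: "(\<Sum>t\<le>NN n. gen (t, (0, 3)) * ?z t) = 0" by (simp add: psi_def)
    have dv: "inV (insert ?E (Bas n)) (dv n a (m, b))" if "b \<in> insert ?E (Bas n)" for m b
    proof (cases "b \<in> Bas n")
      case True
      have "inV (insert ?E (Bas n)) (bar n X)" for X using inV_mono[OF inV_bar] by blast
      then have "inV (insert ?E (Bas n)) (dv0 n a b)"
        unfolding dv0_def W_def eps_def gbr_def by (auto intro!: inV_sum inV_sc inV_mult inV_gen)
      then show ?thesis using True by (simp add: dv_def inV_Dpow)
    qed (simp add: dv_def)
    have iny: "inV (insert ?E (Bas_p n)) (?y t)" for t
      unfolding rho_def
    proof (rule inV_Hom[OF parity_pres_rh])
      show "inV (insert ?E (Bas n)) (delta n a (rd n t))"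
        unfolding delta_def using Bas_p_subset
        by (intro inV_Der[OF dpar_dv[OF aB] dv] inV_mono[OF inV_rd]) auto
    qed (auto simp: rh_def Bas_cases intro: inV_gen)
    have "bpar a + 1 \<noteq> 3" using bpar_01[of a] by auto
    then have "?z t = 0"
      using True iny inV_sig[OF iny]
      by (intro fresh_coefficients[of "{..NN n}" "\<lambda>t. (t, (0, 3))" "insert ?E (Bas_p n)" ?z, OF _ _ _ _ s])
        (auto simp: inj_on_def Bas_p_def Bas_def Iset_def)
    then show "?y t = 0" by (metis sig_0 sig_sig)
  qed
  then show ?thesis using inV_rd by (simp add: inW_def)
qed

subsection \<open>The lowest part of the gauge derivations\<close>

definition msz :: "nat \<Rightarrow> supalg \<Rightarrow> bool" where
  "msz s = sup_in (\<lambda>M. size M = s)"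

lemma msz_0 [simp]: "msz s 0" by (simp add: msz_def)
lemma msz_diff: "msz s x \<Longrightarrow> msz s y \<Longrightarrow> msz s (x - y)"
  and msz_sc: "msz s x \<Longrightarrow> msz s (sc c x)"
  and msz_sum: "(\<And>i. i \<in> I \<Longrightarrow> msz s (g i)) \<Longrightarrow> msz s (sum g I)"
  and msz_gen: "msz 1 (gen z)"
  by (auto simp: msz_def intro: sup_in_add sup_in_diff sup_in_sc sup_in_sum sup_in_gen)

lemma msz_mult: "msz s x \<Longrightarrow> msz t y \<Longrightarrow> msz (s + t) (x * y)"
  unfolding msz_def by (erule (1) sup_in_mult) simp

lemma msz_1 [simp]: "msz 0 1"
  by (simp add: msz_def sup_in_1)

lemma msz_L: "msz (length xs) (L xs)"
proof (induction xs)
  case (Cons x xs)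
  from msz_mult[OF msz_gen[of x] Cons] show ?case by (simp add: L_Cons)
qed simp

lemma sup_in_L: "P (mset xs) \<Longrightarrow> sup_in P (L xs)"
proof -
  assume "P (mset xs)"
  moreover obtain c where "L xs = sc c (mon (mset xs))" using L_mon by blast
  ultimately show ?thesis by (simp add: sup_in_sc sup_in_mon)
qed

text \<open>Every monomial in the derivative of a monomial arises by replacing one generator
  \<open>y\<close> by \<open>gD y\<close>.\<close>

lemma sup_in_D:
  assumes x: "sup_in P x" and PQ: "\<And>y M. P (add_mset y M) \<Longrightarrow> Q (add_mset (gD y) M)"
  shows "sup_in Q (D x)"
  using x
proof (rule sup_in_span)
  fix c and M :: "gen multiset" assume M: "P M"
  let ?ys = "sorted_list_of_multiset M"
  have "sup_in Q (dl True (\<lambda>x. gen (gD x)) ?ys)"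
    unfolding dl_sum
  proof (rule sup_in_sum)
    fix i assume "i \<in> {..<length ?ys}"
    then have i: "i < length ?ys" by simp
    define R where "R = mset (take i ?ys @ drop (Suc i) ?ys)"
    have "mset ?ys = mset (take i ?ys @ ?ys ! i # drop (Suc i) ?ys)"
      using id_take_nth_drop[OF i] by metis
    then have "M = add_mset (?ys ! i) R" by (simp add: R_def)
    then have "Q (add_mset (gD (?ys ! i)) R)" using M PQ by metis
    then have "sup_in Q (L (take i ?ys @ [gD (?ys ! i)] @ drop (Suc i) ?ys))"
      by (intro sup_in_L) (simp add: R_def)
    then show "sup_in Q (tws True (L (take i ?ys)) * gen (gD (?ys ! i)) * L (drop (Suc i) ?ys))"
      by (simp add: tws_def sig_L L_append L_Cons mult.assoc sup_in_sc)
  qed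
  then show "sup_in Q (D (sc c (mon M)))"
    unfolding D_sc mon_L by (simp add: D_def Der_L[OF dpar_D] sup_in_sc)
qed (auto intro: sup_in_add)

lemma msz_D: "msz s x \<Longrightarrow> msz s (D x)"
  unfolding msz_def by (erule sup_in_D) auto

lemma msz_Dpow: "msz s x \<Longrightarrow> msz s ((D ^^ m) x)"
  by (induction m) (auto intro: msz_D)

text \<open>On the antidiagonal both halves of E_ji fall on the same entry, but the coordinate is
  halved there, so the factor is the same as elsewhere.\<close>

lemma gen_qm:
  assumes "(j, i) \<in> Bas n"
  shows "gen (0, (j, i)) = sc (2 * (-1) ^ pp j) (qm n i j)"
proof -
  have I: "i \<in> Iset n" "j \<in> Iset n" using assms by (auto simp: Bas_def)
  have "qm n i j = (\<Sum>b\<in>{(j, i)}. sc (coord n (Emat n j i) b) (gen (0, b)))"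
    unfolding qm_def bar_def
  proof (rule sum.mono_neutral_right)
    show "\<forall>b\<in>Bas n - {(j, i)}. sc (coord n (Emat n j i) b) (gen (0, b)) = 0"
    proof
      fix b assume b: "b \<in> Bas n - {(j, i)}"
      have "coord n (Emat n j i) b = 0"
      proof (rule ccontr)
        assume nz: "coord n (Emat n j i) b \<noteq> 0"
        then have "b = (prm n i, prm n j)" using coord_Emat[OF I _ nz] b by auto
        then have "prm n i + prm n j \<le> 4 * n" "j + i \<le> 4 * n" "(prm n i, prm n j) \<noteq> (j, i)"
          using b assms by (auto simp: Bas_def)
        then show False using I by (auto simp: prm_def Iset_def NN_def)
      qed
      then show "sc (coord n (Emat n j i) b) (gen (0, b)) = 0" by simp
    qed
  qed (use assms in auto)
  also have "\<dots> = sc (coord n (Emat n j i) (j, i)) (gen (0, (j, i)))" by simp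
  also have "coord n (Emat n j i) (j, i) = (1/2) * (-1) ^ pp j"
  proof (cases "j + i < 4 * n")
    case True
    then have "prm n i \<noteq> j" using I by (auto simp: prm_def Iset_def NN_def)
    then show ?thesis using True Emat_entry[OF I I(2,1)] by (simp add: coord_def)
  next
    case False
    then have "j + i = 4 * n" "th_sign n j i = 1" using assms by (auto simp: Bas_def)
    moreover from this have "prm n i = j" "prm n j = i" using I by (auto simp: prm_def Iset_def NN_def)
    ultimately show ?thesis using Emat_entry[OF I I(2,1)] by (simp add: coord_def)
  qed
  finally have "qm n i j = sc ((1/2) * (-1) ^ pp j) (gen (0, (j, i)))" by simp
  then show ?thesis using neg1_sq[of "pp j"] by simp
qed

text \<open>The entry (i, j) of - [f, X] for X = \<open>Fb n a\<close>, written out with f supported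
  on the subdiagonal. Triangularity of the gauge action is thus a property of ad f.\<close>

definition tcst :: "nat \<Rightarrow> nat \<times> nat \<Rightarrow> nat \<Rightarrow> nat \<Rightarrow> complex" where
  "tcst n a i j = (if 2 \<le> i then - fmat n i (i - 1) * Fb n a (i - 1) j else 0) +
     (if j < NN n then (-1) ^ bpar a * fmat n (j + 1) j * Fb n a i (j + 1) else 0)"

lemma msz_rm: assumes "i \<in> Iset n" "j \<in> Iset n" "i \<le> j" shows "msz 1 (rm n i j)"
proof -
  have "rm n i j = bar n (Emat n j i)" using rho_qm_upper[OF assms] by (simp add: rm_def qm_def)
  then show ?thesis unfolding bar_def by (simp only:) (intro msz_sum msz_sc msz_gen)
qed

lemma msz_eps: "msz 1 (eps a k)" by (simp add: eps_def msz_gen[unfolded One_nat_def])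

lemma rm_lower:
  assumes "i \<in> Iset n" "j \<in> Iset n" "j < i"
  shows "rm n i j = (if i = j + 1 then K (- fmat n i j) else 0)"
  using rho_qm_lower[OF assms] fmat_entry[OF assms(1,2)] by (simp add: rm_def)

text \<open>Only the subdiagonal entries of \<open>rm\<close> are nonzero constants; they yield the
  terms linear in \<open>eps\<close>, and every other product has degree 2.\<close>

lemma rho_delta_rm_low:
  assumes a: "a \<in> Bas_n n" and i: "i \<in> Iset n" and j: "j \<in> Iset n"
  shows "msz 2 (rho n (delta n a (rm n i j)) - (sc (Fb n a i j) (eps a 1) + sc (tcst n a i j) (eps a 0)))"
proof -
  define X where "X = Fb n a"
  have 1: "(\<Sum>k\<in>Iset n. sc (X k j) (rm n i k * eps a 0)) =
     (\<Sum>k\<in>Iset n. if i \<le> k then sc (X k j) (rm n i k * eps a 0) else 0) +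
     sc (if 2 \<le> i then - fmat n i (i - 1) * X (i - 1) j else 0) (eps a 0)"
  proof -
    have "(\<Sum>k\<in>Iset n. sc (X k j) (rm n i k * eps a 0)) =
     (\<Sum>k\<in>Iset n. (if i \<le> k then sc (X k j) (rm n i k * eps a 0) else 0) +
        (if k = i - 1 then sc (- fmat n i (i - 1) * X (i - 1) j) (eps a 0) else 0))"
    proof (intro sum.cong refl)
      fix k assume k: "k \<in> Iset n"
      then have "k \<ge> 1" by (simp add: Iset_def)
      show "sc (X k j) (rm n i k * eps a 0) = (if i \<le> k then sc (X k j) (rm n i k * eps a 0) else 0) +
        (if k = i - 1 then sc (- fmat n i (i - 1) * X (i - 1) j) (eps a 0) else 0)"
      proof (cases "i \<le> k")
        case True
        then have "k \<noteq> i - 1" using \<open>k \<ge> 1\<close> by linarith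
        then show ?thesis using True by simp
      next
        case False
        then show ?thesis using rm_lower[OF i k] by (auto simp: mult.commute)
      qed
    qed
    moreover have "i - 1 \<in> Iset n \<longleftrightarrow> 2 \<le> i" using i by (auto simp: Iset_def)
    ultimately show ?thesis by (simp add: sum.distrib sum.delta)
  qed
  have 2: "(\<Sum>k\<in>Iset n. sc ((-1) ^ bpar a * X i k) (eps a 0 * rm n k j)) =
     (\<Sum>k\<in>Iset n. if k \<le> j then sc ((-1) ^ bpar a * X i k) (eps a 0 * rm n k j) else 0) -
     sc (if j < NN n then (-1) ^ bpar a * fmat n (j + 1) j * X i (j + 1) else 0) (eps a 0)"
  proof -
    have "(\<Sum>k\<in>Iset n. sc ((-1) ^ bpar a * X i k) (eps a 0 * rm n k j)) =
     (\<Sum>k\<in>Iset n. (if k \<le> j then sc ((-1) ^ bpar a * X i k) (eps a 0 * rm n k j) else 0) +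
        (if k = j + 1 then sc (- ((-1) ^ bpar a * fmat n (j + 1) j * X i (j + 1))) (eps a 0) else 0))"
    proof (intro sum.cong refl)
      fix k assume k: "k \<in> Iset n"
      show "sc ((-1) ^ bpar a * X i k) (eps a 0 * rm n k j) =
        (if k \<le> j then sc ((-1) ^ bpar a * X i k) (eps a 0 * rm n k j) else 0) +
        (if k = j + 1 then sc (- ((-1) ^ bpar a * fmat n (j + 1) j * X i (j + 1))) (eps a 0) else 0)"
      proof (cases "k \<le> j")
        case False
        then show ?thesis using rm_lower[OF k j] by (auto simp: mult_ac)
      qed simp
    qed
    moreover have "j + 1 \<in> Iset n \<longleftrightarrow> j < NN n" using j by (auto simp: Iset_def)
    ultimately show ?thesis by (simp add: sum.distrib sum.delta)
  qed
  have "rho n (delta n a (rm n i j)) - (sc (Fb n a i j) (eps a 1) + sc (tcst n a i j) (eps a 0)) =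
     (\<Sum>k\<in>Iset n. if i \<le> k then sc (X k j) (rm n i k * eps a 0) else 0) -
     (\<Sum>k\<in>Iset n. if k \<le> j then sc ((-1) ^ bpar a * X i k) (eps a 0 * rm n k j) else 0)"
    unfolding rho_delta_rm[OF a i j] X_def[symmetric] 1 2 tcst_def sc_add_left by simp
  moreover have "msz 2 (if i \<le> k then sc (X k j) (rm n i k * eps a 0) else 0)" if "k \<in> Iset n" for k
    using msz_mult[OF msz_rm[OF i that] msz_eps[of a 0]] by (auto simp: numeral_2_eq_2 intro: msz_sc)
  moreover have "msz 2 (if k \<le> j then sc ((-1) ^ bpar a * X i k) (eps a 0 * rm n k j) else 0)" if "k \<in> Iset n" for k
    using msz_mult[OF msz_eps[of a 0] msz_rm[OF that j]] by (auto simp: numeral_2_eq_2 intro: msz_sc)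
  ultimately show ?thesis by (simp add: msz_diff msz_sum)
qed

text \<open>The degree-one part of the reduced derivation on D^m F_ji; the factor 2 (-1)^p(j) is the
  one of \<open>gen_qm\<close>.\<close>

definition tau :: "nat \<Rightarrow> nat \<times> nat \<Rightarrow> gen \<Rightarrow> supalg" where
  "tau n a y = (case y of (m, (j, i)) \<Rightarrow>
     sc (2 * (-1) ^ pp j * Fb n a i j) (eps a (Suc m)) + sc (2 * (-1) ^ pp j * tcst n a i j) (eps a m))"

definition Rv :: "nat \<Rightarrow> nat \<times> nat \<Rightarrow> gen \<Rightarrow> supalg" where
  "Rv n a y = rho n (dv n a y)"

lemma Rv_tau:
  assumes a: "a \<in> Bas_n n" and y: "snd y \<in> Bas_p n"
  shows "msz 2 (Rv n a y - tau n a y)"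
proof -
  obtain m j i where [simp]: "y = (m, (j, i))" by (cases y) auto
  have b: "(j, i) \<in> Bas n" and ij: "i \<le> j" using y by (auto simp: Bas_p_def)
  have I: "i \<in> Iset n" "j \<in> Iset n" using b by (auto simp: Bas_def)
  have aB: "a \<in> Bas n" using a Bas_n_subset by blast
  let ?c = "2 * (-1) ^ pp j :: complex"
  have e: "(D ^^ m) (eps a k) = eps a (m + k)" for k by (simp add: eps_def Dpow_gen)
  have "dv n a y = (D ^^ m) (delta n a (gen (0, (j, i))))"
    by (simp add: delta_gen[OF aB] dv_def b)
  also have "gen (0, (j, i)) = sc ?c (rm n i j)"
    unfolding gen_qm[OF b] rm_def rho_qm_upper[OF I ij] ..
  finally have "Rv n a y = sc ?c ((D ^^ m) (rho n (delta n a (rm n i j))))"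
    by (simp add: Rv_def rho_Dpow)
  then have "Rv n a y - tau n a y =
      sc ?c ((D ^^ m) (rho n (delta n a (rm n i j)) - (sc (Fb n a i j) (eps a 1) + sc (tcst n a i j) (eps a 0))))"
    by (simp add: tau_def e)
  then show ?thesis using msz_sc[OF msz_Dpow[OF rho_delta_rm_low[OF a I]]] by simp
qed

subsection \<open>Coefficients of the lowest part\<close>

definition egen :: "nat \<times> nat \<Rightarrow> nat \<Rightarrow> gen" where
  "egen a k = (k, (0, bpar a + 1))"

lemma eps_egen: "eps a k = gen (egen a k)" by (simp add: eps_def egen_def)

definition tc :: "nat \<Rightarrow> nat \<times> nat \<Rightarrow> gen \<Rightarrow> nat \<Rightarrow> complex" where
  "tc n a y k = cf (tau n a y) {#egen a k#}"

lemma tc_eq: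
  "tc n a (m, (j, i)) k = (if k = Suc m then 2 * (-1) ^ pp j * Fb n a i j
     else if k = m then 2 * (-1) ^ pp j * tcst n a i j else 0)"
  by (auto simp: tc_def tau_def eps_egen cf_gen sa_gen_def egen_def)

lemma cf_L: "cf (L xs) Q = 0" if "Q \<noteq> mset xs"
proof -
  obtain c where "L xs = sc c (mon (mset xs))" using L_mon by blast
  then show ?thesis using that by (simp add: cf_mon)
qed

lemma cf_insert_tau:
  assumes P: "\<forall>x\<in>#P. snd x \<in> Bas_p n"
  shows "cf (L us * tau n a y * L vs) (add_mset (egen a k) P)
    = tc n a y k * sgn2 (gpar (egen a k)) (mpar (mset us)) * msign gpar {#egen a k#} P * cf (L (us @ vs)) P"
proof -
  have nin: "egen a l \<notin># P" for l
  proof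
    assume "egen a l \<in># P"
    with P have "snd (egen a l) \<in> Bas_p n" by blast
    then show False by (auto simp: egen_def Bas_p_def Bas_def Iset_def)
  qed
  have g: "L us * gen z * L vs = sc (sgn2 (gpar z) (mpar (mset us))) (gen z * L (us @ vs))" for z
    using hp_comm[OF L_hp hp_gen, of us z] by (simp add: L_append mult.assoc sgn2_def conj_commute)
  have c: "cf (L us * gen (egen a l) * L vs) (add_mset (egen a k) P) =
     (if l = k then sgn2 (gpar (egen a k)) (mpar (mset us)) * msign gpar {#egen a k#} P * cf (L (us @ vs)) P else 0)" for l
  proof (cases "l = k")
    case True
    then show ?thesis unfolding g by (simp add: cf_gen_mult)
  next
    case False
    then have "egen a l \<notin># add_mset (egen a k) P" using nin[of l] by (simp add: egen_def)
    then show ?thesis unfolding g using False by (simp only: cf_sc cf_gen_mult) simp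
  qed
  obtain m j i where y: "y = (m, (j, i))" by (cases y) auto
  have "L us * tau n a y * L vs = sc (2 * (-1) ^ pp j * Fb n a i j) (L us * gen (egen a (Suc m)) * L vs)
     + sc (2 * (-1) ^ pp j * tcst n a i j) (L us * gen (egen a m) * L vs)"
    by (simp add: y tau_def eps_egen algebra_simps)
  then show ?thesis by (simp only: cf_add cf_sc c y tc_eq) simp
qed

lemma rho_delta_L:
  assumes a: "a \<in> Bas n" and xs: "\<forall>y\<in>set xs. snd y \<in> Bas_p n"
  shows "rho n (delta n a (L xs)) = (\<Sum>i<length xs. L (take i xs) * Rv n a (xs ! i) * L (drop (Suc i) xs))"
proof -
  have r: "rho n (L ys) = L ys" if "set ys \<subseteq> set xs" for ys
    using that xs by (intro rho_id[of "Bas_p n"] inV_L) (auto simp: Bas_disjoint)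
  have "delta n a (L xs) = (\<Sum>i<length xs. L (take i xs) * dv n a (xs ! i) * L (drop (Suc i) xs))"
    unfolding delta_def Der_L[OF dpar_dv[OF a]] dl_sum by (simp add: tws_def)
  then show ?thesis
    by (simp add: rho_sum rho_mult r set_take_subset set_drop_subset Rv_def)
qed

text \<open>Replacing one letter by a term of degree 2 gives degree \<open>length xs + 1\<close>,
  more than the degree of the monomial under consideration, so \<open>tau\<close> may be used in
  place of the full derivation.\<close>

lemma cf_rho_delta_low:
  assumes a: "a \<in> Bas_n n" and xs: "\<forall>y\<in>set xs. snd y \<in> Bas_p n"
    and P: "\<forall>x\<in>#P. snd x \<in> Bas_p n" and sz: "size P + 1 \<le> length xs"
  shows "cf (rho n (delta n a (L xs))) (add_mset (egen a k) P) =
    (\<Sum>i<length xs. tc n a (xs ! i) k * sgn2 (gpar (egen a k)) (mpar (mset (take i xs))) *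
       msign gpar {#egen a k#} P * cf (L (take i xs @ drop (Suc i) xs)) P)"
proof -
  have aB: "a \<in> Bas n" using a Bas_n_subset by blast
  have "cf (L (take i xs) * Rv n a (xs ! i) * L (drop (Suc i) xs)) (add_mset (egen a k) P) =
     cf (L (take i xs) * tau n a (xs ! i) * L (drop (Suc i) xs)) (add_mset (egen a k) P)"
    if i: "i < length xs" for i
  proof -
    let ?r = "L (take i xs) * (Rv n a (xs ! i) - tau n a (xs ! i)) * L (drop (Suc i) xs)"
    have "msz 2 (Rv n a (xs ! i) - tau n a (xs ! i))" using Rv_tau[OF a] xs i by simp
    from msz_mult[OF msz_mult[OF msz_L[of "take i xs"] this] msz_L[of "drop (Suc i) xs"]]
    moreover have "length (take i xs) + 2 + length (drop (Suc i) xs) = length xs + 1" using i by simp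
    ultimately have "msz (length xs + 1) ?r" by metis
    then have "cf ?r (add_mset (egen a k) P) = 0"
      using sz by (auto simp: msz_def sup_in_def)
    then show ?thesis by (simp add: algebra_simps)
  qed
  then show ?thesis
    unfolding rho_delta_L[OF aB xs] cf_sum
    by (intro sum.cong refl) (simp add: cf_insert_tau[OF P])
qed

section \<open>The slice and the restriction to it\<close>

definition slice :: "nat \<Rightarrow> (nat \<times> nat) set" where
  "slice n = {(t, 1) | t. t \<in> Tset n}"

definition killh :: "(nat \<times> nat) set \<Rightarrow> gen \<Rightarrow> supalg" where
  "killh S y = (if snd y \<in> S then gen y else 0)"

definition kill :: "(nat \<times> nat) set \<Rightarrow> supalg \<Rightarrow> supalg" where "kill S = Hom (killh S)"

lemma parity_pres_killh: "parity_pres (killh S)"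
  unfolding parity_pres_def killh_def using hp_gen by auto

lemma kill_add [simp]: "kill S (x + y) = kill S x + kill S y"
  and kill_diff [simp]: "kill S (x - y) = kill S x - kill S y"
  and kill_sc [simp]: "kill S (sc c x) = sc c (kill S x)"
  and kill_0 [simp]: "kill S 0 = 0"
  and kill_1 [simp]: "kill S 1 = 1"
  and kill_mult: "kill S (x * y) = kill S x * kill S y"
  and kill_gen: "kill S (gen z) = killh S z"
  by (simp_all add: kill_def parity_pres_killh Hom_1 Hom_mult Hom_gen)

lemma kill_D: "kill S (D x) = D (kill S x)"
  unfolding kill_def
  by (rule Hom_D_commute[OF parity_pres_killh]) (auto simp: killh_def gD_def split: prod.splits)

lemma kill_Dpow: "kill S ((D ^^ m) x) = (D ^^ m) (kill S x)"
  by (induction m) (auto simp: kill_D)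

lemma kill_prod_list: "kill S (prod_list xs) = prod_list (map (kill S) xs)"
  by (induction xs) (auto simp: kill_mult)

lemma kill_L: "kill S (L xs) = (if \<forall>y\<in>set xs. snd y \<in> S then L xs else 0)"
  by (induction xs) (auto simp: L_Cons kill_mult kill_gen killh_def)

lemma cf_kill: "cf (kill S x) M = (if \<forall>y\<in>#M. snd y \<in> S then cf x M else 0)"
proof -
  have "kill S x = (\<Sum>N\<in>supp x. sc (cf x N) (kill S (mon N)))"
    using expand_mon[of "supp x" x] unfolding kill_def
    by (metis (no_types, lifting) Hom_sc finite_supp clinear_Hom clinear_sum order_refl sum.cong)
  also have "\<dots> = (\<Sum>N\<in>supp x. sc (cf x N) (if \<forall>y\<in>#N. snd y \<in> S then mon N else 0))"
    unfolding mon_L kill_L by simp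
  finally have p: "kill S x = (\<Sum>N\<in>supp x. sc (cf x N) (if \<forall>y\<in>#N. snd y \<in> S then mon N else 0))" .
  have "cf (sc (cf x N) (if \<forall>y\<in>#N. snd y \<in> S then mon N else 0)) M =
      (if N = M then (if \<forall>y\<in>#M. snd y \<in> S then cf x M else 0) else 0)" if "N \<in> supp x" for N
    using that cf_valid[of x N] by (cases "N = M") (auto simp: cf_mon supp_def)
  then have "cf (kill S x) M = (\<Sum>N\<in>supp x. if N = M then (if \<forall>y\<in>#M. snd y \<in> S then cf x M else 0) else 0)"
    unfolding p cf_sum by (intro sum.cong refl)
  then show ?thesis by (auto simp: sum.delta supp_def)
qed

subsection \<open>The restriction to the slice is injective on the W-algebra\<close>

text \<open>Setting a non-slice variable \<open>v\<close> in a monomial to \<open>\<epsilon>\<close> can also come from a different variable \<open>y\<close>,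
 but then \<open>y\<close> has a smaller weight \<open>mu\<close>.\<close>

definition mu :: "nat \<Rightarrow> gen \<Rightarrow> nat" where
  "mu n y = (case y of (m, (j, i)) \<Rightarrow> m * (4 * n + 1) + (if j + 1 - i \<in> Tset n then i else 4 * n - i))"

lemma Fm_entries:
  assumes "k \<in> Iset n" "l \<in> Iset n" "r \<in> Iset n" "s \<in> Iset n"
  shows "Fb n (k, l) r s = (if r = k \<and> s = l then 1 else 0) + (if r + l = 4 * n \<and> s + k = 4 * n then th_sign n k l else 0)"
proof -
  have "(r = prm n l \<and> s = prm n k) = (r + l = 4 * n \<and> s + k = 4 * n)"
  proof -
    have "k < 4 * n" "l < 4 * n" using assms by (auto simp: Iset_def NN_def)
    then show ?thesis by (auto simp: prm_def)
  qed
  then show ?thesis by (simp add: Fb_def Fm_def emat_def)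
qed

text \<open>Hence F_{i,i'} is nonzero precisely for odd i; this parity condition on the antidiagonal
  is what produces residues modulo 4 in \<open>dominate_not_T\<close>.\<close>

lemma th_anti: assumes "i \<in> Iset n" shows "th_sign n i (prm n i) = (if odd i then 1 else -1)"
proof -
  have "th_sign n i (prm n i) = (-1) ^ (pp i * pp i + pp i + 1 + (dlt n i + dlt n (prm n i)))"
    by (simp add: th_sign_def pp_prm[OF assms] add.assoc)
  then show ?thesis unfolding dlt_prm[OF assms] neg1_even_iff by auto
qed

text \<open>For \<open>X\<close> at position (iv - 1, jv), multiplication by f from the left reaches
  (iv, jv). The only other basis position it reaches is (iv - 1, jv - 1), by multiplication from the
  right; the theta-half of \<open>X\<close> stays on the far side of the antidiagonal.\<close>

lemma dominate_T:
  assumes v: "(jv, iv) \<in> Bas_p n" and iv: "2 \<le> iv"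
  shows "(iv - 1, jv) \<in> Bas_n n" "tcst n (iv - 1, jv) iv jv \<noteq> 0"
    "\<And>i j. (j, i) \<in> Bas_p n \<Longrightarrow> (j, i) \<noteq> (jv, iv) \<Longrightarrow> tcst n (iv - 1, jv) i j \<noteq> 0 \<Longrightarrow> i + 1 = iv \<and> j + 1 = jv"
proof -
  have vb: "iv \<in> Iset n" "jv \<in> Iset n" "iv \<le> jv" "jv + iv \<le> 4 * n" and vth: "jv + iv = 4 * n \<Longrightarrow> th_sign n jv iv = 1"
    using v by (auto simp: Bas_p_def Bas_def)
  have I: "iv - 1 \<in> Iset n" "jv \<in> Iset n" "iv - 1 < jv" using vb iv by (auto simp: Iset_def NN_def)
  show a: "(iv - 1, jv) \<in> Bas_n n" using vb iv I by (auto simp: Bas_n_def Bas_def)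
  note F = Fm_entries[OF I(1,2)]
  have p: "prm n jv = 4 * n - jv" "prm n (iv - 1) = 4 * n - (iv - 1)" by (auto simp: prm_def)
  have fnz: "fmat n iv (iv - 1) \<noteq> 0" using fmat_nonzero[of "iv - 1" n] iv vb by (simp add: Iset_def)
  show "tcst n (iv - 1, jv) iv jv \<noteq> 0"
  proof -
    have "iv - 1 + jv \<noteq> 4 * n" using vb(4) iv by linarith
    then have 1: "Fb n (iv - 1, jv) (iv - 1) jv = 1"
      using F[OF I(1,2)] I(3) vb(4) iv by simp
    show ?thesis
    proof (cases "jv + iv = 4 * n")
      case False
      have "Fb n (iv - 1, jv) iv (jv + 1) = 0" if j: "jv < NN n"
      proof -
        have "jv + 1 \<in> Iset n" using j by (simp add: Iset_def)
        then show ?thesis using F[of iv "jv + 1"] vb iv False by simp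
      qed
      then show ?thesis using 1 fnz iv by (simp add: tcst_def)
    next
      case True
      \<comment> \<open>On the antidiagonal f X and X f both contribute to the entry. They add up
        rather than cancel because the basis vector at (jv, iv) is nonzero.\<close>
      have jN: "jv < NN n" using True iv by (simp add: NN_def)
      have e: "prm n jv = iv" "prm n (iv - 1) = jv + 1" "prm n (jv + 1) = iv - 1" "prm n iv = jv"
        using True iv vb by (auto simp: prm_def)
      have I2: "jv + 1 \<in> Iset n" using jN by (simp add: Iset_def)
      have 2: "Fb n (iv - 1, jv) iv (jv + 1) = th_sign n (iv - 1) jv"
        using F[OF vb(1) I2] True iv by simp
      have "bpar (iv - 1, jv) = 1"
      proof -
        have "iv - 1 + jv = 4 * n - 1" using True iv by linarith
        moreover have "odd (4 * n - 1)" using True iv by simp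
        ultimately have "odd (iv - 1 + jv)" by metis
        then show ?thesis by (simp add: bpar_def) (simp add: pp_def mod2_eq_if)
      qed
      moreover have "fmat n (jv + 1) jv = th_sign n iv (iv - 1) * fmat n iv (iv - 1)"
        using Gmat_sym[OF Gmat_fmat I2 vb(2), unfolded e] th_prm[OF vb(1) I(1), unfolded e] by simp
      ultimately have "tcst n (iv - 1, jv) iv jv = - (fmat n iv (iv - 1) * (1 + th_sign n iv (iv - 1) * th_sign n (iv - 1) jv))"
        using iv jN 1 2 by (simp add: tcst_def algebra_simps)
      moreover have "th_sign n iv (iv - 1) * th_sign n (iv - 1) jv = 1"
      proof -
        have o1: "odd (iv - 1) \<noteq> odd iv" using iv by simp
        have "even (jv + iv)" unfolding True by simp
        then have o2: "odd jv = odd iv" by simp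
        from o1 o2 have "(-1::complex) ^ ((pp iv + pp (iv - 1)) * (pp (iv - 1) + pp jv)) = -1"
          by (auto simp: neg1_even_iff)
        then have "th_sign n iv (iv - 1) * th_sign n (iv - 1) jv = th_sign n iv jv"
          unfolding th_compose by simp
        moreover have "th_sign n iv jv = 1"
          using th_swap[of n jv iv] vth[OF True] o2 by (simp add: neg1_even_iff)
        ultimately show ?thesis by simp
      qed
      ultimately show ?thesis using fnz by simp
    qed
  qed
  fix i j assume u: "(j, i) \<in> Bas_p n" "(j, i) \<noteq> (jv, iv)" "tcst n (iv - 1, jv) i j \<noteq> 0"
  have ub: "i \<in> Iset n" "j \<in> Iset n" "i \<le> j" "j + i \<le> 4 * n" using u(1) by (auto simp: Bas_p_def Bas_def)
  have "(2 \<le> i \<and> Fb n (iv - 1, jv) (i - 1) j \<noteq> 0) \<or> (j < NN n \<and> Fb n (iv - 1, jv) i (j + 1) \<noteq> 0)"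
    using u(3) unfolding tcst_def by (rule contrapos_np) auto
  then consider "2 \<le> i" "Fb n (iv - 1, jv) (i - 1) j \<noteq> 0" | "j < NN n" "Fb n (iv - 1, jv) i (j + 1) \<noteq> 0"
    by blast
  then show "i + 1 = iv \<and> j + 1 = jv"
  proof cases
    case 1
    then have "i - 1 \<in> Iset n" using ub by (auto simp: Iset_def)
    then show ?thesis using 1 F[of "i - 1" j] ub u(2) vb iv by (auto split: if_splits)
  next
    case 2
    then have "j + 1 \<in> Iset n" by (auto simp: Iset_def)
    then show ?thesis using 2 F[of i "j + 1"] ub u(2) vb iv by (auto split: if_splits)
  qed
qed

text \<open>Here multiplication by f from the right is used, for \<open>X\<close> at position (iv,
  jv + 1). This fails when jv + iv = 4n, or when jv + iv + 1 = 4n and iv is even, so that F_{iv,iv'}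
  = 0. In these two cases jv + 1 - iv is congruent to 3 and to 0 modulo 4, which is excluded by the
  hypothesis.\<close>

lemma dominate_not_T:
  assumes v: "(jv, iv) \<in> Bas_p n" and T: "jv + 1 - iv \<notin> Tset n"
  shows "(iv, jv + 1) \<in> Bas_n n" "tcst n (iv, jv + 1) iv jv \<noteq> 0"
    "\<And>i j. (j, i) \<in> Bas_p n \<Longrightarrow> (j, i) \<noteq> (jv, iv) \<Longrightarrow> tcst n (iv, jv + 1) i j \<noteq> 0 \<Longrightarrow> i = iv + 1 \<and> j = jv + 1"
proof -
  have vb: "iv \<in> Iset n" "jv \<in> Iset n" "iv \<le> jv" "jv + iv \<le> 4 * n" and vth: "jv + iv = 4 * n \<Longrightarrow> th_sign n jv iv = 1"
    using v by (auto simp: Bas_p_def Bas_def)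
  have T': "(jv + 1 - iv) mod 4 \<noteq> 0" "(jv + 1 - iv) mod 4 \<noteq> 3" using T vb by (auto simp: Tset_def Iset_def)
  have n4: "jv + iv \<noteq> 4 * n"
  proof
    assume e: "jv + iv = 4 * n"
    then have "prm n jv = iv" by (auto simp: prm_def)
    then have "odd jv" using vth[OF e] th_anti[OF vb(2)] by (auto split: if_splits)
    then obtain c where c: "jv = 2 * c + 1" by (rule oddE)
    then have "jv + 1 - iv = 4 * (c - n) + 3" using e vb(3) by linarith
    then show False using T'(2) by simp
  qed
  have oddiv: "odd iv" if e: "jv + iv + 1 = 4 * n"
  proof (rule ccontr)
    assume "\<not> odd iv"
    then obtain c where c: "iv = 2 * c" by (auto elim: evenE)
    then have "jv + 1 - iv = 4 * (n - c)" using e vb(3) by linarith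
    then show False using T'(1) by simp
  qed
  have jN: "jv < NN n" and jI: "jv + 1 \<in> Iset n" using vb n4 by (auto simp: NN_def Iset_def)
  have p: "prm n iv = 4 * n - iv" "prm n (jv + 1) = 4 * n - (jv + 1)" by (auto simp: prm_def)
  have th1: "th_sign n iv (jv + 1) = 1" if e: "jv + iv + 1 = 4 * n"
  proof -
    have "prm n iv = jv + 1" using e by (simp add: p(1))
    then show ?thesis using th_anti[OF vb(1)] oddiv[OF e] by simp
  qed
  show "(iv, jv + 1) \<in> Bas_n n"
    using vb n4 th1 jI by (cases "jv + iv + 1 = 4 * n") (auto simp: Bas_n_def Bas_def add.commute)
  note F = Fm_entries[OF vb(1) jI]
  have fnz: "fmat n (jv + 1) jv \<noteq> 0" using fmat_nonzero[of jv n] jN vb by (simp add: Iset_def)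
  show "tcst n (iv, jv + 1) iv jv \<noteq> 0"
  proof -
    have 1: "Fb n (iv, jv + 1) (iv - 1) jv = 0" if "2 \<le> iv"
    proof -
      have "iv - 1 \<in> Iset n" using that vb by (auto simp: Iset_def)
      then show ?thesis using F[of "iv - 1" jv] that vb n4 by simp
    qed
    have "Fb n (iv, jv + 1) iv (jv + 1) \<noteq> 0"
      using F[OF vb(1) jI] th1 by (simp add: add_ac)
    then show ?thesis using 1 fnz jN by (simp add: tcst_def)
  qed
  fix i j assume u: "(j, i) \<in> Bas_p n" "(j, i) \<noteq> (jv, iv)" "tcst n (iv, jv + 1) i j \<noteq> 0"
  have ub: "i \<in> Iset n" "j \<in> Iset n" "i \<le> j" "j + i \<le> 4 * n" using u(1) by (auto simp: Bas_p_def Bas_def)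
  have "(2 \<le> i \<and> Fb n (iv, jv + 1) (i - 1) j \<noteq> 0) \<or> (j < NN n \<and> Fb n (iv, jv + 1) i (j + 1) \<noteq> 0)"
    using u(3) unfolding tcst_def by (rule contrapos_np) auto
  then consider "2 \<le> i" "Fb n (iv, jv + 1) (i - 1) j \<noteq> 0" | "j < NN n" "Fb n (iv, jv + 1) i (j + 1) \<noteq> 0"
    by blast
  then show "i = iv + 1 \<and> j = jv + 1"
  proof cases
    case 1
    then have "i - 1 \<in> Iset n" using ub by (auto simp: Iset_def)
    then show ?thesis using 1 F[of "i - 1" j] ub u(2) vb n4 by (auto split: if_splits)
  next
    case 2
    then have "j + 1 \<in> Iset n" by (auto simp: Iset_def)
    then show ?thesis using 2 F[of i "j + 1"] ub u(2) vb n4 by (auto split: if_splits)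
  qed
qed

lemma dominating:
  assumes v: "snd v \<in> Bas_p n" "snd v \<notin> slice n"
  shows "\<exists>a\<in>Bas_n n. tc n a v (fst v) \<noteq> 0 \<and>
    (\<forall>y. snd y \<in> Bas_p n \<longrightarrow> y \<noteq> v \<longrightarrow> tc n a y (fst v) \<noteq> 0 \<longrightarrow> mu n y < mu n v)"
proof -
  obtain mv jv iv where ve: "v = (mv, (jv, iv))" by (cases v) auto
  have vb: "iv \<in> Iset n" "jv \<in> Iset n" "iv \<le> jv" "(jv, iv) \<in> Bas_p n"
    using v(1) by (auto simp: ve Bas_p_def Bas_def)
  have "\<exists>a\<in>Bas_n n. tcst n a iv jv \<noteq> 0 \<and> (\<forall>i j. (j, i) \<in> Bas_p n \<longrightarrow> (j, i) \<noteq> (jv, iv) \<longrightarrow>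
      tcst n a i j \<noteq> 0 \<longrightarrow> mu n (mv, (j, i)) < mu n v)"
  proof (cases "jv + 1 - iv \<in> Tset n")
    case True
    then have "iv \<noteq> 1" using v(2) by (auto simp: ve slice_def)
    then have iv: "2 \<le> iv" using vb by (auto simp: Iset_def)
    note d = dominate_T[OF vb(4) iv]
    have "mu n (mv, (j, i)) < mu n v" if "i + 1 = iv" "j + 1 = jv" for i j
    proof -
      have "j + 1 - i = jv + 1 - iv" using that vb(3) by simp
      then show ?thesis using True that by (simp add: mu_def ve)
    qed
    then show ?thesis using d by blast
  next
    case False
    note d = dominate_not_T[OF vb(4) False]
    have "mu n (mv, (j, i)) < mu n v" if "i = iv + 1" "j = jv + 1" for i j
    proof -
      have "j + 1 - i = jv + 1 - iv" using that by simp
      then show ?thesis using False that vb(1) by (auto simp: mu_def ve Iset_def NN_def)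
    qed
    then show ?thesis using d by blast
  qed
  then obtain a where a: "a \<in> Bas_n n" "tcst n a iv jv \<noteq> 0"
    and lt: "\<And>i j. (j, i) \<in> Bas_p n \<Longrightarrow> (j, i) \<noteq> (jv, iv) \<Longrightarrow> tcst n a i j \<noteq> 0 \<Longrightarrow> mu n (mv, (j, i)) < mu n v"
    by blast
  have "mu n y < mu n v" if y: "snd y \<in> Bas_p n" "y \<noteq> v" "tc n a y mv \<noteq> 0" for y
  proof -
    obtain m j i where ye: "y = (m, (j, i))" by (cases y) auto
    consider "mv = Suc m" | "mv = m" "tcst n a i j \<noteq> 0"
      using y(3) by (auto simp: ye tc_eq split: if_splits)
    then show ?thesis
    proof cases
      case 1
      \<comment> \<open>The factor 4n + 1 in \<open>mu\<close> exceeds the second summand, so fewer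
        derivatives always mean a smaller \<open>mu\<close>.\<close>
      have "i \<in> Iset n" using y(1) by (auto simp: ye Bas_p_def Bas_def)
      then have "mu n y \<le> m * (4 * n + 1) + 4 * n" by (auto simp: mu_def ye Iset_def NN_def)
      also have "\<dots> < mu n v" by (simp add: mu_def ve 1)
      finally show ?thesis .
    next
      case 2
      then show ?thesis using lt[of j i] y by (auto simp: ye ve)
    qed
  qed
  then show ?thesis using a by (intro bexI[of _ a]) (auto simp: ve tc_eq)
qed

lemma sorted_remove:
  assumes "sorted xs" shows "sorted (take i xs @ drop (Suc i) xs)"
proof (cases "i < length xs")
  case True
  have "sorted (take i xs @ xs ! i # drop (Suc i) xs)"
    using assms id_take_nth_drop[OF True] by simp
  then show ?thesis by (auto simp: sorted_append)
qed (use assms in simp)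

lemma mset_remove: "i < length xs \<Longrightarrow> mset (take i xs @ drop (Suc i) xs) = mset xs - {#xs ! i#}"
proof -
  assume "i < length xs"
  then have "mset xs = mset (take i xs @ xs ! i # drop (Suc i) xs)" by (simp add: id_take_nth_drop[symmetric])
  then show ?thesis by simp
qed

lemma mset_remove_add: "i < length xs \<Longrightarrow> mset xs = add_mset (xs ! i) (mset (take i xs @ drop (Suc i) xs))"
  by (metis mset_remove insert_DiffM nth_mem set_mset_mset)

text \<open>The derivation is even, so its linear part replaces a variable by a test variable of the
  same parity.\<close>

lemma tc_parity:
  assumes a: "a \<in> Bas_n n" and v: "snd v \<in> Bas_p n" and nz: "tc n a v k \<noteq> 0"
  shows "gpar (egen a k) = gpar v"
proof -
  have aB: "a \<in> Bas n" using a Bas_n_subset by blast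
  have "hp (gpar v \<noteq> False) (dv n a v)" by (rule dparD[OF dpar_dv[OF aB]])
  then have h: "hp (gpar v) (Rv n a v)"
    unfolding Rv_def rho_def using Hom_hp[OF parity_pres_rh] by simp
  have "cf (Rv n a v - tau n a v) {#egen a k#} = 0"
    using Rv_tau[OF a v] by (auto simp: msz_def sup_in_def)
  then have "cf (Rv n a v) {#egen a k#} \<noteq> 0" using nz by (simp add: tc_def)
  then have "mpar {#egen a k#} = gpar v" using h unfolding hp_def sup_in_def by blast
  then show ?thesis by simp
qed

text \<open>Among the monomials of least degree in a nonzero \<open>w\<close>, take one with least
  total \<open>mu\<close>; it contains a letter \<open>v\<close> outside the slice. Replacing
  \<open>v\<close> by its test variable gives a monomial that the derivation chosen for
  \<open>v\<close> produces from no other monomial of \<open>w\<close>, so its coefficient cannot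
  vanish.\<close>

lemma kill_slice_inj:
  assumes w: "inW n w" and p0: "kill (slice n) w = 0"
  shows "w = 0"
proof (rule ccontr)
  assume "w \<noteq> 0"
  then obtain Q where "cf w Q \<noteq> cf 0 Q" using supalg_eqI by blast
  then have "Q \<in> supp w" by (simp add: supp_def)
  then obtain M0 where M0: "M0 \<in> supp w" "\<And>M. M \<in> supp w \<Longrightarrow> size M0 \<le> size M"
    using ex_has_least_nat[of "\<lambda>M. M \<in> supp w" Q size] by blast
  define S where "S = {M \<in> supp w. size M = size M0}"
  have "M0 \<in> S" using M0 by (simp add: S_def)
  define m where "m M = (\<Sum>y\<in>#M. mu n y)" for M
  obtain M where M: "M \<in> S" and Mmin: "\<And>M'. M' \<in> S \<Longrightarrow> m M \<le> m M'"
    using ex_has_least_nat[of "\<lambda>M. M \<in> S" M0 m] \<open>M0 \<in> S\<close> by blast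
  have Ms: "M \<in> supp w" "size M = size M0" using M by (auto simp: S_def)
  have wp: "\<forall>y\<in>#N. snd y \<in> Bas_p n" if "N \<in> supp w" for N
    using w that by (auto simp: inW_def inV_def sup_in_def supp_def)
  obtain v where v: "v \<in># M" "snd v \<notin> slice n"
    using p0 cf_kill[of "slice n" w M] Ms(1) by (auto simp: supp_def split: if_splits)
  have vp: "snd v \<in> Bas_p n" using wp[OF Ms(1)] v(1) by blast
  obtain a where a: "a \<in> Bas_n n" and nz: "tc n a v (fst v) \<noteq> 0"
    and lt: "\<And>y. snd y \<in> Bas_p n \<Longrightarrow> y \<noteq> v \<Longrightarrow> tc n a y (fst v) \<noteq> 0 \<Longrightarrow> mu n y < mu n v"
    using dominating[OF vp v(2)] by blast
  define k where "k = fst v"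
  define P where "P = M - {#v#}"
  have MP: "M = add_mset v P" using v(1) by (simp add: P_def)
  have P: "\<forall>x\<in>#P. snd x \<in> Bas_p n" using wp[OF Ms(1)] MP by auto
  let ?Q = "add_mset (egen a k) P"
  let ?ys = "\<lambda>N. sorted_list_of_multiset N"
  let ?t = "\<lambda>ys i. tc n a (ys ! i) k * sgn2 (gpar (egen a k)) (mpar (mset (take i ys))) *
       msign gpar {#egen a k#} P * cf (L (take i ys @ drop (Suc i) ys)) P"
  have cfN: "cf (rho n (delta n a (mon N))) ?Q = (\<Sum>i<length (?ys N). ?t (?ys N) i)" if N: "N \<in> supp w" for N
  proof -
    have "length (?ys N) = size N" by (metis mset_sorted_list_of_multiset size_mset)
    moreover have "size P + 1 \<le> size N" using M0(2)[OF N] Ms(2) MP by simp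
    ultimately show ?thesis
      unfolding mon_L using wp[OF N] P by (intro cf_rho_delta_low[OF a]) auto
  qed
  \<comment> \<open>Another source \<open>N\<close> would arise from \<open>M\<close> by exchanging
    \<open>v\<close> for a letter of smaller \<open>mu\<close>, against the choice of
    \<open>M\<close>.\<close>
  have zero: "(\<Sum>i<length (?ys N). ?t (?ys N) i) = 0" if N: "N \<in> supp w" "N \<noteq> M" for N
  proof (rule sum.neutral, rule ballI, rule ccontr)
    fix i assume i: "i \<in> {..<length (?ys N)}" and nz: "?t (?ys N) i \<noteq> 0"
    let ?y = "?ys N ! i"
    have tcy: "tc n a ?y k \<noteq> 0" and "cf (L (take i (?ys N) @ drop (Suc i) (?ys N))) P \<noteq> 0" using nz by auto
    then have "P = mset (take i (?ys N) @ drop (Suc i) (?ys N))" using cf_L by metis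
    then have NP: "N = add_mset ?y P" using mset_remove_add[of i "?ys N"] i by simp
    then have "?y \<noteq> v" using N(2) MP by auto
    moreover have "snd ?y \<in> Bas_p n" using wp[OF N(1)] i by (metis lessThan_iff nth_mem set_sorted_list_of_multiset)
    ultimately have "mu n ?y < mu n v" using lt tcy by (simp add: k_def)
    then have "m N < m M" by (subst NP, subst MP) (simp add: m_def)
    moreover have "N \<in> S" using N(1) NP MP Ms(2) by (metis (mono_tags, lifting) S_def mem_Collect_eq size_add_mset)
    ultimately show False using Mmin by fastforce
  qed
  have "rho n (delta n a w) = 0" using w a by (simp add: inW_def)
  moreover have "rho n (delta n a w) = (\<Sum>N\<in>supp w. sc (cf w N) (rho n (delta n a (mon N))))"
  proof -
    have "rho n (delta n a w) = rho n (delta n a (\<Sum>N\<in>supp w. sc (cf w N) (mon N)))"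
      using expand_mon[of "supp w" w] by simp
    then show ?thesis by (simp add: delta_sum rho_sum)
  qed
  ultimately have "cf (\<Sum>N\<in>supp w. sc (cf w N) (rho n (delta n a (mon N)))) ?Q = 0" by simp
  then have "(\<Sum>N\<in>supp w. cf w N * cf (rho n (delta n a (mon N))) ?Q) = 0"
    unfolding cf_sum cf_sc .
  moreover have "(\<Sum>N\<in>supp w. cf w N * cf (rho n (delta n a (mon N))) ?Q) = (\<Sum>N\<in>supp w. if N = M then cf w M * (\<Sum>i<length (?ys M). ?t (?ys M) i) else 0)"
    using cfN zero by (intro sum.cong refl) auto
  ultimately have s0: "(\<Sum>i<length (?ys M). ?t (?ys M) i) = 0"
    using Ms(1) by (auto simp: sum.delta supp_def)
  have Pv: "valid_mono gpar P" using cf_valid[of w M] Ms(1) MP valid_mono_subset[of gpar M P] by (auto simp: supp_def)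
  have pe: "gpar (egen a k) = gpar v" using tc_parity[OF a vp nz] by (simp add: k_def)
  \<comment> \<open>The positions of \<open>v\<close> in the sorted word: an even \<open>v\<close>
    contributes equal terms that add up to its multiplicity, an odd \<open>v\<close> occurs only
    once.\<close>
  define I where "I = {i. i < length (?ys M) \<and> v = ?ys M ! i}"
  have cI: "card I = count M v"
    unfolding I_def length_filter_conv_card[symmetric]
    by (metis count_list_eq_length_filter count_mset mset_sorted_list_of_multiset)
  define c where "c = tc n a v k * msign gpar {#egen a k#} P"
  have tI: "?t (?ys M) i = (if i \<in> I then sgn2 (gpar v) (mpar (mset (take i (?ys M)))) * c else 0)" if i: "i < length (?ys M)" for i
  proof (cases "i \<in> I")
    case True
    have s: "sorted (take i (?ys M) @ drop (Suc i) (?ys M))" by (rule sorted_remove) simp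
    have "mset (take i (?ys M) @ drop (Suc i) (?ys M)) = P"
      using mset_remove[OF i] True by (simp add: I_def P_def)
    then have "cf (L (take i (?ys M) @ drop (Suc i) (?ys M))) P = 1"
      using L_sorted[OF s] Pv by (simp only: cf_mon) simp
    then show ?thesis using True by (simp add: c_def pe I_def)
  next
    case False
    have "P \<noteq> mset (take i (?ys M) @ drop (Suc i) (?ys M))"
    proof
      define y where "y = ?ys M ! i"
      assume "P = mset (take i (?ys M) @ drop (Suc i) (?ys M))"
      then have "M = add_mset y P"
        using mset_remove_add[OF i] unfolding y_def by (metis mset_sorted_list_of_multiset)
      then have "add_mset v P = add_mset y P" using MP by simp
      then have "v = y" by simp
      then show False using False i by (simp add: I_def y_def)
    qed
    then show ?thesis using False cf_L by simp
  qed
  have "(\<Sum>i<length (?ys M). ?t (?ys M) i) = (\<Sum>i\<in>I. sgn2 (gpar v) (mpar (mset (take i (?ys M)))) * c)"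
  proof -
    have "(\<Sum>i<length (?ys M). ?t (?ys M) i) = (\<Sum>i<length (?ys M). if i \<in> I then sgn2 (gpar v) (mpar (mset (take i (?ys M)))) * c else 0)"
      using tI by (intro sum.cong refl) auto
    also have "\<dots> = (\<Sum>i\<in>{..<length (?ys M)} \<inter> I. sgn2 (gpar v) (mpar (mset (take i (?ys M)))) * c)"
      by (simp add: sum.inter_restrict)
    also have "{..<length (?ys M)} \<inter> I = I" by (auto simp: I_def)
    finally show ?thesis .
  qed
  moreover have "\<dots> \<noteq> 0"
  proof -
    have enP: "egen a k \<notin># P"
      using P by (auto simp: egen_def Bas_p_def Bas_def Iset_def)
    then have c0: "c \<noteq> 0" using msign_single[OF Pv enP] nz by (simp add: c_def k_def)
    have cM: "count M v \<ge> 1" using v(1) by simp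
    show ?thesis
    proof (cases "gpar v")
      case False
      then have "(\<Sum>i\<in>I. sgn2 (gpar v) (mpar (mset (take i (?ys M)))) * c) = of_nat (card I) * c" by simp
      then show ?thesis using c0 cI cM by simp
    next
      case True
      have "valid_mono gpar M" using cf_valid[of w M] Ms(1) by (simp add: supp_def)
      then have "count M v \<le> 1" using True unfolding valid_mono_def by blast
      then have "count M v = 1" using cM by (metis le_antisym)
      then obtain i where "I = {i}" using cI by (metis card_1_singletonE)
      then show ?thesis using c0 by (simp add: sgn2_def)
    qed
  qed
  ultimately show False using s0 by simp
qed

subsection \<open>Conformal weights\<close>

text \<open>The weight of \<open>D\<^sup>m F\<^sub>j\<^sub>i\<close> is \<open>m + (j - i) + 1\<close>; for the auxiliary variable \<open>psi m\<close>, of index \<open>(0, 3)\<close>,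
 truncated subtraction yields the weight \<open>m\<close>.\<close>

definition wtg :: "gen \<Rightarrow> nat" where
  "wtg y = (case y of (m, (j, i)) \<Rightarrow> m + (j + 1 - i))"

definition wts :: "nat \<Rightarrow> supalg \<Rightarrow> bool" where
  "wts s = sup_in (\<lambda>M. (\<Sum>y\<in>#M. wtg y) = s)"

lemma wts_0 [simp]: "wts s 0" by (simp add: wts_def)
lemma wts_add: "wts s x \<Longrightarrow> wts s y \<Longrightarrow> wts s (x + y)"
  and wts_sc: "wts s x \<Longrightarrow> wts s (sc c x)"
  and wts_sum: "(\<And>i. i \<in> I \<Longrightarrow> wts s (g i)) \<Longrightarrow> wts s (sum g I)"
  and wts_gen: "wtg z = s \<Longrightarrow> wts s (gen z)"
  and wts_K: "wts 0 (K c)"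
  by (auto simp: wts_def intro: sup_in_add sup_in_sc sup_in_sum sup_in_gen sup_in_K)

lemma wts_mult: "wts s x \<Longrightarrow> wts t y \<Longrightarrow> wts (s + t) (x * y)"
  unfolding wts_def by (erule (1) sup_in_mult) simp

lemma wts_D: "wts s x \<Longrightarrow> wts (Suc s) (D x)"
  unfolding wts_def by (erule sup_in_D) (auto simp: wtg_def gD_def split: prod.splits)

text \<open>Below the diagonal truncated subtraction gives weight 0, matching the constant entries
  there.\<close>

lemma wts_rm:
  assumes "i \<in> Iset n" "j \<in> Iset n" shows "wts (j + 1 - i) (rm n i j)"
proof (cases "i \<le> j")
  case True
  have "rm n i j = (\<Sum>b\<in>Bas n. sc (coord n (Emat n j i) b) (gen (0, b)))"
    using rho_qm_upper[OF assms True] by (simp add: rm_def qm_def bar_def)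
  moreover have "wts (j + 1 - i) (sc (coord n (Emat n j i) b) (gen (0, b)))" if b: "b \<in> Bas n" for b
  proof (cases "coord n (Emat n j i) b = 0")
    case False
    have "i < 4 * n" "j < 4 * n" using assms by (auto simp: Iset_def NN_def)
    then have "wtg (0, b) = j + 1 - i"
      using coord_Emat[OF assms b False] True by (auto simp: wtg_def prm_def)
    then show ?thesis by (intro wts_sc wts_gen)
  qed simp
  ultimately show ?thesis by (simp only:) (rule wts_sum)
next
  case False
  then show ?thesis using rm_lower[OF assms] by (auto simp: wts_K simp del: K_uminus)
qed

lemma wts_Aop: "i \<in> Iset n \<Longrightarrow> j \<in> Iset n \<Longrightarrow> wts s y \<Longrightarrow> wts (s + (j + 1 - i)) (Aop n i j y)"
  using wts_mult[OF wts_rm[of i n j], of s y] wts_D[of s y]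
  by (auto simp: Aop_def add.commute intro!: wts_add)

lemma minr_rec:
  assumes "1 \<le> i" "i \<le> NN n"
  shows "minr n i = (\<Sum>j\<in>{i..NN n}. sc (\<Prod>k\<in>{i..<j}. fmat n (k + 1) k) (Aop n i j (minr n (Suc j))))"
  using hessenberg.minor_rec[OF hessenberg_Aop assms] .

lemma minr_end: "minr n (Suc (NN n)) = psi 0"
  using hessenberg.minor_end[OF hessenberg_Aop] .

lemma wts_minr:
  assumes "1 \<le> i" "i \<le> Suc (NN n)" shows "wts (Suc (NN n) - i) (minr n i)"
  using assms
proof (induction "Suc (NN n) - i" arbitrary: i rule: less_induct)
  case less
  show ?case
  proof (cases "i = Suc (NN n)")
    case True
    show ?thesis unfolding True minr_end by (simp add: psi_def wts_gen wtg_def)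
  next
    case False
    then have i: "1 \<le> i" "i \<le> NN n" using less.prems by auto
    show ?thesis
      unfolding minr_rec[OF i]
    proof (intro wts_sum wts_sc)
      fix j assume j: "j \<in> {i..NN n}"
      then have "wts (Suc (NN n) - Suc j) (minr n (Suc j))" using i by (intro less.hyps) auto
      then have "wts (Suc (NN n) - Suc j + (j + 1 - i)) (Aop n i j (minr n (Suc j)))"
        using i j by (intro wts_Aop) (auto simp: Iset_def)
      moreover have "Suc (NN n) - Suc j + (j + 1 - i) = Suc (NN n) - i" using i j by auto
      ultimately show "wts (Suc (NN n) - i) (Aop n i j (minr n (Suc j)))" by metis
    qed
  qed
qed

lemma cf_mult_gen:
  "cf (y * gen z) M = (if z \<in># M then msign gpar (M - {#z#}) {#z#} * cf y (M - {#z#}) else 0)"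
proof -
  have "cf (y * gen z) M = (\<Sum>A\<in>{A. A \<subseteq># M}. if A = M - {#z#} then (if z \<in># M then msign gpar (M - {#z#}) {#z#} * cf y (M - {#z#}) else 0) else 0)"
    unfolding cf_mult
  proof (rule sum.cong)
    fix A assume "A \<in> {A. A \<subseteq># M}"
    then have A: "A \<subseteq># M" by simp
    have "M - A = {#z#} \<longleftrightarrow> z \<in># M \<and> A = M - {#z#}"
      using A by (metis add_diff_cancel_left' add_diff_cancel_right' insert_DiffM2 single_subset_iff
          mset_subset_eq_add_right subset_mset.add_diff_inverse union_single_eq_member)
    then show "msign gpar A (M - A) * cf y A * cf (gen z) (M - A) =
      (if A = M - {#z#} then (if z \<in># M then msign gpar (M - {#z#}) {#z#} * cf y (M - {#z#}) else 0) else 0)"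
      by (auto simp: gen_def cf_mon)
  qed simp
  then show ?thesis by (simp add: sum.delta finite_subsets_mset)
qed

definition psig :: "nat \<Rightarrow> gen" where "psig t = (t, (0, 3))"

lemma psi_psig: "psi t = gen (psig t)" by (simp add: psi_def psig_def)

lemma psig_fresh: "\<forall>y\<in>#M. snd y \<in> Bas_p n \<Longrightarrow> psig t \<notin># M"
  by (auto simp: psig_def Bas_p_def Bas_def Iset_def)

lemma cf_minr:
  assumes M: "\<forall>y\<in>#M. snd y \<in> Bas_p n" and t: "t \<le> NN n"
  shows "cf (minr n 1) (add_mset (psig t) M) = msign gpar M {#psig t#} * cf (rd n t) M"
proof -
  have "cf (minr n 1) (add_mset (psig t) M) = (\<Sum>s\<le>NN n. if s = t then msign gpar M {#psig t#} * cf (rd n t) M else 0)"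
    unfolding minr_rd cf_sum
  proof (rule sum.cong)
    fix s
    have "psig s \<in># add_mset (psig t) M \<longleftrightarrow> s = t"
      using psig_fresh[OF M, of s] by (auto simp: psig_def)
    then show "cf (rd n s * psi s) (add_mset (psig t) M) = (if s = t then msign gpar M {#psig t#} * cf (rd n t) M else 0)"
      unfolding psi_psig cf_mult_gen by auto
  qed simp
  then show ?thesis using t by simp
qed

lemma rd_vars: "cf (rd n t) M \<noteq> 0 \<Longrightarrow> \<forall>y\<in>#M. snd y \<in> Bas_p n"
  using inV_rd[of n t] by (simp add: inV_def sup_in_def)

lemma msign_psig:
  assumes "\<forall>y\<in>#M. snd y \<in> Bas_p n" "valid_mono gpar M"
  shows "msign gpar M {#psig t#} \<noteq> 0"
  using msign_single[OF assms(2) psig_fresh[OF assms(1)]] msign_swap[of gpar M "{#psig t#}"] by simp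

text \<open>The determinant applied to \<open>psi 0\<close> is homogeneous of weight N, and
  \<open>psi t\<close> accounts for t of it.\<close>

lemma wts_rd:
  assumes t: "t \<le> NN n" and n: "1 \<le> n" shows "wts (NN n - t) (rd n t)"
  unfolding wts_def sup_in_def
proof (intro allI impI)
  fix M assume nz: "cf (rd n t) M \<noteq> 0"
  then have "cf (minr n 1) (add_mset (psig t) M) \<noteq> 0"
    using cf_minr[OF rd_vars[OF nz] t] msign_psig[OF rd_vars[OF nz] cf_valid[OF nz]] by simp
  moreover have "wts (NN n) (minr n 1)" using wts_minr[of 1 n] by simp
  ultimately have "(\<Sum>y\<in>#add_mset (psig t) M. wtg y) = NN n"
    unfolding wts_def sup_in_def by blast
  moreover have "wtg (psig t) = t" by (simp add: wtg_def psig_def)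
  ultimately show "(\<Sum>y\<in>#M. wtg y) = NN n - t" by simp
qed

subsection \<open>The term \<open>a\<^sub>t\<close> of \<open>w\<^sub>t\<close>\<close>

definition ag :: "nat \<Rightarrow> gen" where "ag t = (0, (t, 1))"

text \<open>Besides a_t the test variable, of index (0, 3), must survive.\<close>

definition St :: "nat \<Rightarrow> (nat \<times> nat) set" where "St t = {(t, 1), (0, 3)}"

lemma Tset_props:
  assumes "t \<in> Tset n"
  shows "3 \<le> t" "t \<le> NN n" "t \<in> Iset n" "even t = (t mod 4 = 0)" "odd t = (t mod 4 = 3)"
  using assms by (auto simp: Tset_def Iset_def) presburger+

lemma Tset_n: "t \<in> Tset n \<Longrightarrow> 1 \<le> n"
  by (auto simp: Tset_def NN_def)

lemma th_last: assumes "1 \<le> n" shows "th_sign n (NN n) 1 = 1"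
proof -
  have I: "NN n \<in> Iset n" "prm n (NN n) = 1" "odd (NN n)" using assms by (auto simp: Iset_def NN_def prm_def)
  then show ?thesis using th_anti[OF I(1)] by simp
qed

lemma t1_Bas_p: assumes t: "t \<in> Tset n" shows "(t, 1) \<in> Bas_p n"
proof -
  have b: "3 \<le> t" "t \<le> NN n" "1 \<le> n" "t \<in> Iset n" using Tset_props[OF t] Tset_n[OF t] by auto
  have "t + 1 < 4 * n \<or> (t + 1 = 4 * n \<and> t = NN n)" using b by (auto simp: NN_def)
  then show ?thesis using b th_last by (auto simp: Bas_p_def Bas_def Iset_def)
qed

definition cc :: "nat \<Rightarrow> nat \<Rightarrow> nat \<Rightarrow> nat \<Rightarrow> complex" where
  "cc n t i j = coord n (Emat n j i) (t, 1)"

lemma kill_rm: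
  assumes t: "t \<in> Tset n" and i: "i \<in> Iset n" and j: "j \<in> Iset n" and "i \<le> j"
  shows "kill (St t) (rm n i j) = sc (cc n t i j) (gen (ag t))"
proof -
  have B: "(t, 1) \<in> Bas n" using t1_Bas_p[OF t] Bas_p_subset by blast
  have "rm n i j = (\<Sum>b\<in>Bas n. sc (coord n (Emat n j i) b) (gen (0, b)))"
    using rho_qm_upper[OF i j assms(4)] by (simp add: rm_def qm_def bar_def)
  then have "kill (St t) (rm n i j) = (\<Sum>b\<in>Bas n. sc (coord n (Emat n j i) b) (killh (St t) (0, b)))"
    unfolding kill_def by (simp add: clinear_sum[OF clinear_Hom] Hom_gen parity_pres_killh)
  also have "\<dots> = (\<Sum>b\<in>Bas n. if b = (t, 1) then sc (coord n (Emat n j i) (t, 1)) (gen (0, (t, 1))) else 0)"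
  proof (intro sum.cong refl)
    fix b assume "b \<in> Bas n"
    then have "b \<noteq> (0, 3)" by (auto simp: Bas_def Iset_def)
    then show "sc (coord n (Emat n j i) b) (killh (St t) (0, b)) = (if b = (t, 1) then sc (coord n (Emat n j i) (t, 1)) (gen (0, (t, 1))) else 0)"
      by (auto simp: killh_def St_def)
  qed
  finally show ?thesis using B by (simp add: sum.delta cc_def ag_def)
qed

text \<open>The variable a_t sits at position (1, t) and, through theta, at (t', 1') = (t',
  N).\<close>

lemma cc_zero:
  assumes t: "t \<in> Tset n" and i: "i \<in> Iset n" and j: "j \<in> Iset n" and nz: "cc n t i j \<noteq> 0"
  shows "(i = 1 \<and> j = t) \<or> (i = prm n t \<and> j = NN n)"
proof -
  have B: "(t, 1) \<in> Bas n" using t1_Bas_p[OF t] Bas_p_subset by blast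
  have "(t, 1) = (j, i) \<or> (t, 1) = (prm n i, prm n j)"
    using coord_Emat[OF i j B] nz by (simp add: cc_def)
  moreover have "j = NN n" if "prm n j = 1" using that j by (auto simp: prm_def NN_def Iset_def)
  ultimately show ?thesis using i by auto
qed

definition fprod :: "nat \<Rightarrow> nat \<Rightarrow> nat \<Rightarrow> complex" where
  "fprod n i j = (\<Prod>k\<in>{i..<j}. fmat n (k + 1) k)"

lemma kill_psi: "kill (St t) (psi m) = psi m"
  by (simp add: psi_def kill_gen killh_def St_def)

lemma kill_sum: "kill S (\<Sum>i\<in>I. g i) = (\<Sum>i\<in>I. kill S (g i))"
  by (simp add: kill_def clinear_sum)

lemma kill_minr_rec:
  assumes t: "t \<in> Tset n" and i: "1 \<le> i" "i \<le> NN n"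
  shows "kill (St t) (minr n i) = D (kill (St t) (minr n (Suc i))) +
     (\<Sum>j\<in>{i..NN n}. sc (fprod n i j * cc n t i j) (gen (ag t) * kill (St t) (minr n (Suc j))))"
proof -
  have "kill (St t) (minr n i) = (\<Sum>j\<in>{i..NN n}. (if j = i then D (kill (St t) (minr n (Suc i))) else 0) +
     sc (fprod n i j * cc n t i j) (gen (ag t) * kill (St t) (minr n (Suc j))))"
    unfolding minr_rec[OF i] kill_sum
  proof (intro sum.cong refl)
    fix j assume "j \<in> {i..NN n}"
    then have "i \<in> Iset n" "j \<in> Iset n" "i \<le> j" using i by (auto simp: Iset_def)
    then show "kill (St t) (sc (\<Prod>k\<in>{i..<j}. fmat n (k + 1) k) (Aop n i j (minr n (Suc j)))) =
      (if j = i then D (kill (St t) (minr n (Suc i))) else 0) +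
      sc (fprod n i j * cc n t i j) (gen (ag t) * kill (St t) (minr n (Suc j)))"
      using kill_rm[OF t] by (auto simp: Aop_def kill_mult kill_D fprod_def)
  qed
  then show ?thesis using i by (simp add: sum.distrib sum.delta)
qed

text \<open>Rows from 2 on do not meet position (1, t). The entry at (t', N) acts on
  \<open>psi 0\<close>, and the diagonal D of each row above differentiates the result.\<close>

lemma kill_minr_below:
  assumes t: "t \<in> Tset n" and i: "2 \<le> i" "i \<le> Suc (NN n)"
  shows "kill (St t) (minr n i) = psi (Suc (NN n) - i) +
    (if i \<le> prm n t then sc (fprod n (prm n t) (NN n) * cc n t (prm n t) (NN n)) ((D ^^ (prm n t - i)) (gen (ag t) * psi 0)) else 0)"
  using i
proof (induction "Suc (NN n) - i" arbitrary: i rule: less_induct)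
  case less
  have pN: "prm n t \<le> NN n" "prm n t \<in> Iset n" using prm_Iset[OF Tset_props(3)[OF t]] by (auto simp: Iset_def)
  let ?g = "fprod n (prm n t) (NN n) * cc n t (prm n t) (NN n)"
  show ?case
  proof (cases "i = Suc (NN n)")
    case True
    then show ?thesis using pN by (simp add: minr_end kill_psi)
  next
    case False
    then have i: "1 \<le> i" "i \<le> NN n" "2 \<le> i" using less.prems by auto
    have I: "i \<in> Iset n" using i by (simp add: Iset_def)
    have z: "cc n t i j = 0" if "j \<in> {i..NN n}" "j \<noteq> NN n \<or> i \<noteq> prm n t" for j
      using cc_zero[OF t I, of j] that i by (auto simp: Iset_def)
    have "(\<Sum>j\<in>{i..NN n}. sc (fprod n i j * cc n t i j) (gen (ag t) * kill (St t) (minr n (Suc j)))) =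
      (\<Sum>j\<in>{i..NN n}. if j = NN n then (if i = prm n t then sc ?g (gen (ag t) * psi 0) else 0) else 0)"
    proof (intro sum.cong refl)
      fix j assume j: "j \<in> {i..NN n}"
      show "sc (fprod n i j * cc n t i j) (gen (ag t) * kill (St t) (minr n (Suc j))) =
        (if j = NN n then (if i = prm n t then sc ?g (gen (ag t) * psi 0) else 0) else 0)"
        using z[OF j] by (cases "j = NN n \<and> i = prm n t") (auto simp: minr_end kill_psi)
    qed
    also have "\<dots> = (if i = prm n t then sc ?g (gen (ag t) * psi 0) else 0)" using i by (simp add: sum.delta)
    finally have r: "kill (St t) (minr n i) = D (kill (St t) (minr n (Suc i))) + (if i = prm n t then sc ?g (gen (ag t) * psi 0) else 0)"
      using kill_minr_rec[OF t i(1,2)] by simp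
    have IH: "kill (St t) (minr n (Suc i)) = psi (NN n - i) +
      (if Suc i \<le> prm n t then sc ?g ((D ^^ (prm n t - Suc i)) (gen (ag t) * psi 0)) else 0)"
      using less.hyps[of "Suc i"] i by simp
    have s1: "Suc (NN n) - i = Suc (NN n - i)" using i by simp
    consider "Suc i \<le> prm n t" "prm n t - i = Suc (prm n t - Suc i)" | "i = prm n t" | "i > prm n t" by linarith
    then show ?thesis unfolding r IH s1 by cases auto
  qed
qed

text \<open>For t = N the two positions of a_t coincide at (1, N), so the contribution from below is
  absent.\<close>

lemma kill_minr_1:
  assumes t: "t \<in> Tset n"
  shows "kill (St t) (minr n 1) = psi (NN n) +
    (if t < NN n then sc (fprod n (prm n t) (NN n) * cc n t (prm n t) (NN n)) ((D ^^ (NN n - t)) (gen (ag t) * psi 0)) else 0) +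
    sc (fprod n 1 t * cc n t 1 t) (gen (ag t) * kill (St t) (minr n (Suc t)))"
proof -
  have n: "1 \<le> n" and tb: "3 \<le> t" "t \<le> NN n" using Tset_n[OF t] Tset_props[OF t] by auto
  have I: "1 \<in> Iset n" using n by (simp add: Iset_def NN_def)
  have N2: "2 \<le> NN n" "Suc (NN n - Suc 0) = NN n" using tb by auto
  have z: "cc n t 1 j = 0" if "j \<in> {1..NN n}" "j \<noteq> t" for j
  proof (rule ccontr)
    assume "cc n t 1 j \<noteq> 0"
    then have "1 = prm n t \<and> j = NN n" using cc_zero[OF t I, of j] that by (auto simp: Iset_def)
    then have "t = NN n \<and> j = NN n" using tb by (auto simp: prm_def NN_def)
    then show False using that by simp
  qed
  have "(\<Sum>j\<in>{1..NN n}. sc (fprod n 1 j * cc n t 1 j) (gen (ag t) * kill (St t) (minr n (Suc j)))) =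
    (\<Sum>j\<in>{1..NN n}. if j = t then sc (fprod n 1 t * cc n t 1 t) (gen (ag t) * kill (St t) (minr n (Suc t))) else 0)"
    using z by (intro sum.cong refl) auto
  then have "(\<Sum>j\<in>{1..NN n}. sc (fprod n 1 j * cc n t 1 j) (gen (ag t) * kill (St t) (minr n (Suc j)))) =
    sc (fprod n 1 t * cc n t 1 t) (gen (ag t) * kill (St t) (minr n (Suc t)))"
    using tb by (simp add: sum.delta)
  moreover have "D (kill (St t) (minr n 2)) = psi (NN n) +
    (if t < NN n then sc (fprod n (prm n t) (NN n) * cc n t (prm n t) (NN n)) ((D ^^ (NN n - t)) (gen (ag t) * psi 0)) else 0)"
  proof (cases "t < NN n")
    case True
    then have "2 \<le> prm n t" "NN n - t = Suc (prm n t - 2)" by (auto simp: prm_def NN_def)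
    then show ?thesis using True kill_minr_below[OF t, of 2] N2 by simp
  next
    case False
    then have "\<not> 2 \<le> prm n t" using tb by (auto simp: prm_def NN_def)
    then show ?thesis using False kill_minr_below[OF t, of 2] N2 by simp
  qed
  ultimately show ?thesis using kill_minr_rec[OF t, of 1] N2 by (simp add: numeral_2_eq_2)
qed

lemma ag_par: assumes "t \<in> Tset n" shows "gpar (ag t) = odd t"
  by (auto simp: ag_def gpar_def bpar_def pp_def)

text \<open>Only the term in which every D hits \<open>psi\<close> keeps a_t undifferentiated;
  passing a_t m times costs the sign (-1)^(t m).\<close>

lemma cf_Dpow_ag_psi:
  assumes t: "t \<in> Tset n" and m: "even (t * m)"
  shows "cf ((D ^^ m) (gen (ag t) * psi 0)) {#ag t, psig m#} = cf (gen (ag t) * psi m) {#ag t, psig m#}"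
proof -
  have sg: "sig (gen (ag t)) = sc ((-1) ^ t) (gen (ag t))"
    using sig_hp[OF hp_gen[of "ag t"]] ag_par[OF t] by auto
  have "sup_in (\<lambda>M. ag t \<notin># M) ((D ^^ m) (gen (ag t) * psi 0) - sc ((-1) ^ (t * m)) (gen (ag t) * psi m))" for m
  proof (induction m)
    case (Suc m)
    have "D ((D ^^ m) (gen (ag t) * psi 0) - sc ((-1) ^ (t * m)) (gen (ag t) * psi m)) =
      ((D ^^ Suc m) (gen (ag t) * psi 0) - sc ((-1) ^ (t * Suc m)) (gen (ag t) * psi (Suc m)))
      - sc ((-1) ^ (t * m)) (D (gen (ag t)) * psi m)"
      by (simp add: D_mult sg power_add algebra_simps)
    moreover have "sup_in (\<lambda>M. ag t \<notin># M) (D ((D ^^ m) (gen (ag t) * psi 0) - sc ((-1) ^ (t * m)) (gen (ag t) * psi m)))"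
      by (rule sup_in_D[OF Suc]) (auto simp: ag_def gD_def split: prod.splits)
    moreover have "sup_in (\<lambda>M. ag t \<notin># M) (sc ((-1) ^ (t * m)) (D (gen (ag t)) * psi m))"
    proof -
      have "sup_in (\<lambda>M. ag t \<notin># M) (L [(Suc 0, (t, 1)), psig m])"
        by (rule sup_in_L) (auto simp: ag_def psig_def)
      then show ?thesis by (intro sup_in_sc) (simp add: ag_def L_Cons psi_psig)
    qed
    ultimately have "sup_in (\<lambda>M. ag t \<notin># M) (((D ^^ Suc m) (gen (ag t) * psi 0) - sc ((-1) ^ (t * Suc m)) (gen (ag t) * psi (Suc m)))
      - sc ((-1) ^ (t * m)) (D (gen (ag t)) * psi m) + sc ((-1) ^ (t * m)) (D (gen (ag t)) * psi m))"
      by (metis sup_in_add)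
    then show ?case by simp
  qed simp
  from sup_inD[OF this[of m], of "{#ag t, psig m#}"] show ?thesis
    using m by simp
qed

lemma cf_ag_psi: assumes "t \<in> Tset n" shows "cf (gen (ag t) * psi m) {#ag t, psig m#} \<noteq> 0"
proof -
  have "psig m \<noteq> ag t" using Tset_props(1)[OF assms] by (auto simp: psig_def ag_def)
  then have "msign gpar {#ag t#} {#psig m#} \<noteq> 0" using msign_single[of "{#psig m#}" "ag t"] by simp
  then show ?thesis by (simp add: cf_gen_mult psi_psig) (simp add: gen_def cf_mon)
qed

text \<open>Theta reflects the subdiagonal of f onto itself, so the product over the last t - 1
  entries differs from that over the first ones by signs.\<close>

lemma fprod_prm:
  assumes "1 \<le> t" "t \<le> NN n"
  shows "fprod n (prm n t) (NN n) = (\<Prod>k\<in>{1..<t}. th_sign n (k + 1) k) * fprod n 1 t"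
proof -
  have "fprod n (prm n t) (NN n) = (\<Prod>k\<in>{1..<t}. fmat n (prm n k) (prm n (k + 1)))"
    unfolding fprod_def
    by (rule prod.reindex_bij_witness[of _ "\<lambda>k. prm n (k + 1)" "\<lambda>k. prm n (k + 1)"])
      (use assms in \<open>auto simp: prm_def NN_def Suc_diff_Suc\<close>)
  also have "\<dots> = (\<Prod>k\<in>{1..<t}. th_sign n (k + 1) k * fmat n (k + 1) k)"
  proof (intro prod.cong refl)
    fix k assume k: "k \<in> {1..<t}"
    then have I: "k \<in> Iset n" "k + 1 \<in> Iset n" using assms by (auto simp: Iset_def)
    show "fmat n (prm n k) (prm n (k + 1)) = th_sign n (k + 1) k * fmat n (k + 1) k"
      using Gmat_sym[OF Gmat_fmat prm_Iset[OF I(1)] prm_Iset[OF I(2)]] I th_prm[OF I(2) I(1)] by simp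
  qed
  finally show ?thesis by (simp add: prod.distrib fprod_def)
qed

text \<open>The product telescopes by \<open>th_compose\<close>, where each step leaves a sign
  depending on the parity of t; the accumulated sign has period 4.\<close>

lemma th_prod:
  assumes "1 \<le> t"
  shows "(\<Prod>k\<in>{1..<t}. th_sign n (k + 1) k) = (if t mod 4 = 0 \<or> t mod 4 = 1 then -1 else 1) * th_sign n t 1"
  using assms
proof (induction t rule: dec_induct)
  case base
  show ?case by (simp add: th_diag)
next
  case (step t)
  have "(\<Prod>k\<in>{1..<Suc t}. th_sign n (k + 1) k) = (\<Prod>k\<in>{1..<t}. th_sign n (k + 1) k) * th_sign n (t + 1) t"
    using step by (simp add: prod.atLeastLessThan_Suc)
  also have "\<dots> = (if t mod 4 = 0 \<or> t mod 4 = 1 then -1 else 1) * (th_sign n (t + 1) t * th_sign n t 1)"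
    unfolding step.IH by simp
  also have "th_sign n (t + 1) t * th_sign n t 1 = (if even t then 1 else -1) * th_sign n (t + 1) 1"
  proof -
    have "(-1::complex) ^ ((pp (t + 1) + pp t) * (pp t + pp 1)) = (if even t then -1 else 1)"
      by (auto simp: neg1_even_iff)
    then show ?thesis unfolding th_compose by simp
  qed
  also have "(if t mod 4 = 0 \<or> t mod 4 = 1 then -1 else 1) * ((if even t then 1 else -1) * th_sign n (t + 1) 1)
    = (if Suc t mod 4 = 0 \<or> Suc t mod 4 = 1 then -1 else (1::complex)) * th_sign n (t + 1) 1"
  proof -
    have "t mod 4 < 4" by simp
    then consider "t mod 4 = 0" | "t mod 4 = 1" | "t mod 4 = 2" | "t mod 4 = 3" by linarith
    then show ?thesis
    proof cases
      case 1
      then have "even t" "Suc t mod 4 = 1" by presburger+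
      then show ?thesis using 1 by simp
    next
      case 2
      then have "odd t" "Suc t mod 4 = 2" by presburger+
      then show ?thesis using 2 by simp
    next
      case 3
      then have "even t" "Suc t mod 4 = 3" by presburger+
      then show ?thesis using 3 by simp
    next
      case 4
      then have "odd t" "Suc t mod 4 = 0" by presburger+
      then show ?thesis using 4 by simp
    qed
  qed
  finally show ?case by simp
qed

lemma fprod_nonzero: "t \<le> NN n \<Longrightarrow> fprod n 1 t \<noteq> 0"
  unfolding fprod_def using fmat_nonzero[of _ n] by auto

text \<open>The coefficient \<open>a\<^sub>t\<close> of \<open>w\<^sub>t\<close> collects the contributions of the entries \<open>(1, t)\<close> and \<open>(t', N)\<close>, which add up
 for \<open>t\<close> congruent to 0 or 3 modulo 4 and cancel otherwise.\<close>

lemma linear_coefficient: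
  assumes t: "t \<in> Tset n"
  shows "cf (rd n (NN n - t)) {#ag t#} \<noteq> 0"
proof -
  have n: "1 \<le> n" and tb: "3 \<le> t" "t \<le> NN n" "t \<in> Iset n" using Tset_n[OF t] Tset_props[OF t] by auto
  let ?m = "NN n - t" and ?Q = "{#ag t, psig (NN n - t)#}"
  let ?g = "fprod n (prm n t) (NN n) * cc n t (prm n t) (NN n)" and ?h = "fprod n 1 t * cc n t 1 t"
  have oN: "odd (NN n)" using n by (auto simp: NN_def)
  \<comment> \<open>N is odd, so N - t is even whenever t is odd.\<close>
  have ev: "even (t * ?m)" using oN tb by auto
  have I: "1 \<in> Iset n" "NN n \<in> Iset n" "prm n t \<in> Iset n" "prm n (prm n t) = t" "prm n (NN n) = 1"
    using n tb by (auto simp: Iset_def NN_def prm_def)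
  have mt: "cf x ?Q = 0" if "msz s x" "s \<noteq> 2" for x s using that by (auto simp: msz_def sup_in_def)
  have psiN: "cf (psi (NN n)) ?Q = 0" unfolding psi_psig by (rule mt[OF msz_gen]) simp
  let ?c = "cf (gen (ag t) * psi ?m) ?Q"
  have c0: "?c \<noteq> 0" by (rule cf_ag_psi[OF t])
  \<comment> \<open>After multiplication by a_t the second summand of \<open>kill_minr_below\<close>
    has degree 3 and misses the quadratic monomial \<open>?Q\<close>.\<close>
  have minr_t: "cf (gen (ag t) * kill (St t) (minr n (Suc t))) ?Q = ?c"
  proof -
    have k: "kill (St t) (minr n (Suc t)) = psi ?m + (if Suc t \<le> prm n t then sc ?g ((D ^^ (prm n t - Suc t)) (gen (ag t) * psi 0)) else 0)"
      using kill_minr_below[OF t, of "Suc t"] tb by simp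
    have "msz 2 ((D ^^ (prm n t - Suc t)) (gen (ag t) * psi 0))"
      using msz_mult[OF msz_gen msz_gen, of "ag t" "psig 0"] by (intro msz_Dpow) (simp add: psi_psig numeral_2_eq_2)
    from msz_mult[OF msz_gen[of "ag t"] this]
    have "cf (gen (ag t) * (D ^^ (prm n t - Suc t)) (gen (ag t) * psi 0)) ?Q = 0" by (rule mt) simp
    then show ?thesis unfolding k by (auto simp: distrib_left)
  qed
  have coef: "cf (kill (St t) (minr n 1)) ?Q = (if t < NN n then ?g else 0) * ?c + ?h * ?c"
    unfolding kill_minr_1[OF t] using psiN minr_t cf_Dpow_ag_psi[OF t ev] by auto
  have pt: "(-1::complex) ^ pp t = (if t mod 4 = 0 then 1 else -1)"
    using Tset_props(4)[OF t] by (simp add: neg1_even_iff)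
  have T: "t mod 4 = 0 \<or> t mod 4 = 3" using t by (auto simp: Tset_def)
  have "(if t < NN n then ?g else 0) + ?h \<noteq> 0"
  proof (cases "t < NN n")
    case True
    then have p1: "t + 1 < 4 * n" "prm n t \<noteq> 1" by (auto simp: NN_def prm_def)
    have c1: "cc n t 1 t = (1/2) * (-1) ^ pp t"
      using Emat_entry[OF I(1) tb(3) tb(3) I(1)] p1 I True by (auto simp: cc_def coord_def)
    have c2: "cc n t (prm n t) (NN n) = - (1/2) * th_sign n t 1"
    proof -
      have "th_sign n (NN n) (prm n t) = th_sign n t 1"
        using th_prm[OF tb(3) I(1)] I(5) n by (simp add: prm_def NN_def)
      moreover have "(-1::complex) ^ pp (NN n) = -1" using oN by (simp add: neg1_even_iff)
      ultimately show ?thesis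
        using Emat_entry[OF I(3,2) tb(3) I(1)] p1 I True by (auto simp: cc_def coord_def)
    qed
    have "fprod n (prm n t) (NN n) = (if t mod 4 = 0 then -1 else 1) * th_sign n t 1 * fprod n 1 t"
      using fprod_prm[of t n] th_prod[of t n] tb T by auto
    \<comment> \<open>Two equal halves: for residue 0 the sign of \<open>th_prod\<close> cancels the
      minus in \<open>c2\<close>, for residue 3 both terms are negative.\<close>
    then have "?g + ?h = (if t mod 4 = 0 then 1 else -1) * fprod n 1 t"
      using th_square[of n t 1] T unfolding c1 c2 pt by (auto simp: algebra_simps)
    then show ?thesis using True fprod_nonzero[OF tb(2)] by auto
  next
    case False
    then have tN: "t = NN n" using tb by simp
    have "cc n t 1 t = - (1/2)"
      using Emat_entry[OF I(1,2,2,1)] th_last[OF n] oN I n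
      by (auto simp: cc_def coord_def tN neg1_even_iff prm_def NN_def)
    then show ?thesis using False fprod_nonzero[OF tb(2)] by simp
  qed
  then have "cf (kill (St t) (minr n 1)) ?Q \<noteq> 0"
    using coef c0 by (simp flip: distrib_right)
  then have "cf (minr n 1) ?Q \<noteq> 0" by (auto simp: cf_kill split: if_splits)
  moreover have "\<forall>y\<in>#{#ag t#}. snd y \<in> Bas_p n" using t1_Bas_p[OF t] by (simp add: ag_def)
  ultimately show ?thesis using cf_minr[of "{#ag t#}" n ?m] by (auto simp: add_mset_commute)
qed

subsection \<open>Leading terms\<close>

text \<open>Replacing a variable \<open>a\<^sub>t\<close> by a different monomial of the same conformal weight lowers the sum of the
 squares of the indices.\<close>

definition nu :: "gen multiset \<Rightarrow> nat" where
  "nu M = (\<Sum>y\<in>#M. (fst (snd y))\<^sup>2)"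

lemma nu_add [simp]: "nu (A + B) = nu A + nu B" and nu_empty [simp]: "nu {#} = 0"
  and nu_add_mset [simp]: "nu (add_mset y M) = (fst (snd y))\<^sup>2 + nu M"
  by (simp_all add: nu_def)

definition low :: "nat \<Rightarrow> nat \<Rightarrow> supalg \<Rightarrow> bool" where
  "low n c = sup_in (\<lambda>M. nu M < c \<and> (\<forall>y\<in>#M. snd y \<in> slice n))"

text \<open>Squaring is strictly superadditive on positive numbers, so with the sum bounded by t
  only a single term equal to t reaches t^2.\<close>

lemma sum_mset_square_less:
  fixes s :: "'a \<Rightarrow> nat"
  assumes "\<forall>y\<in>#M. 0 < s y" "(\<Sum>y\<in>#M. s y) \<le> t" "0 < t" "\<not> (\<exists>y. M = {#y#} \<and> s y = t)"
  shows "(\<Sum>y\<in>#M. (s y)\<^sup>2) < t\<^sup>2"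
proof -
  have sq: "(\<Sum>y\<in>#M. (s y)\<^sup>2) \<le> (\<Sum>y\<in>#M. s y)\<^sup>2" for M :: "'a multiset"
  proof (induction M)
    case (add x M)
    have "(s x)\<^sup>2 + (\<Sum>y\<in>#M. s y)\<^sup>2 \<le> (s x + (\<Sum>y\<in>#M. s y))\<^sup>2" by (simp add: power2_sum)
    then show ?case using add by simp
  qed simp
  show ?thesis
  proof (cases M)
    case empty
    then show ?thesis using assms(3) by simp
  next
    case (add x M')
    show ?thesis
    proof (cases "M' = {#}")
      case True
      then have "s x < t" using add assms(2,4) by (auto simp: le_less)
      then show ?thesis using add True by (simp add: power_strict_mono)
    next
      case False
      then obtain z M'' where z: "M' = add_mset z M''" by (metis multiset_cases)
      let ?S = "\<Sum>y\<in>#M'. s y"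
      have pos: "0 < s x" "0 < ?S" using assms(1) add z by auto
      have "(\<Sum>y\<in>#M. (s y)\<^sup>2) \<le> (s x)\<^sup>2 + ?S\<^sup>2" using sq[of M'] add by simp
      also have "\<dots> < (s x + ?S)\<^sup>2" using pos by (simp add: power2_sum)
      also have "\<dots> \<le> t\<^sup>2" using assms(2) add by (simp add: power_mono)
      finally show ?thesis .
    qed
  qed
qed

definition wv :: "nat \<Rightarrow> nat \<Rightarrow> supalg" where "wv n t = rd n (NN n - t)"

definition kap :: "nat \<Rightarrow> nat \<Rightarrow> complex" where "kap n t = cf (wv n t) {#ag t#}"

text \<open>On slice variables the weight is derivative order plus index, so the indices in a
  monomial of w_t add up to at most t, and only a_t itself attains t^2.\<close>

lemma kill_wv:
  assumes t: "t \<in> Tset n"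
  shows "low n (t\<^sup>2) (kill (slice n) (wv n t) - sc (kap n t) (gen (ag t)))"
  unfolding low_def sup_in_def
proof (intro allI impI)
  fix M assume nz: "cf (kill (slice n) (wv n t) - sc (kap n t) (gen (ag t))) M \<noteq> 0"
  have tb: "1 \<le> n" "3 \<le> t" "t \<le> NN n" using Tset_n[OF t] Tset_props[OF t] by auto
  have at: "snd (ag t) \<in> slice n" using t by (auto simp: ag_def slice_def)
  have "M \<noteq> {#ag t#}"
  proof
    assume "M = {#ag t#}"
    then show False using nz at by (simp add: cf_kill kap_def cf_gen sa_gen_def)
  qed
  then have "cf (kill (slice n) (wv n t)) M \<noteq> 0" using nz by (simp add: cf_gen sa_gen_def)
  then have sl: "\<forall>y\<in>#M. snd y \<in> slice n" and w: "cf (wv n t) M \<noteq> 0"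
    by (auto simp: cf_kill split: if_splits)
  have ys: "wtg y = fst y + fst (snd y)" "0 < fst (snd y)" if "y \<in># M" for y
  proof -
    obtain m s where "y = (m, (s, 1))" "s \<in> Tset n" using sl \<open>y \<in># M\<close> by (cases y) (auto simp: slice_def)
    then show "wtg y = fst y + fst (snd y)" "0 < fst (snd y)" by (auto simp: wtg_def Tset_def)
  qed
  have "(\<Sum>y\<in>#M. wtg y) = t"
    using wts_rd[of "NN n - t" n] tb w by (auto simp: wv_def wts_def sup_in_def)
  moreover have "(\<Sum>y\<in>#M. wtg y) = (\<Sum>y\<in>#M. fst y) + (\<Sum>y\<in>#M. fst (snd y))"
    using ys by (simp add: sum_mset.distrib[symmetric] cong: image_mset_cong)
  ultimately have e: "(\<Sum>y\<in>#M. fst y) + (\<Sum>y\<in>#M. fst (snd y)) = t" by simp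
  have "\<not> (\<exists>y. M = {#y#} \<and> fst (snd y) = t)"
  proof
    assume "\<exists>y. M = {#y#} \<and> fst (snd y) = t"
    then obtain m i where M: "M = {#(m, (t, i))#}" by auto
    then have "i = 1" using sl by (simp add: slice_def)
    moreover have "m = 0" using e M by simp
    ultimately show False using M \<open>M \<noteq> {#ag t#}\<close> by (simp add: ag_def)
  qed
  then have "nu M < t\<^sup>2"
    unfolding nu_def using sum_mset_square_less[of M "\<lambda>y. fst (snd y)" t] ys(2) e tb by auto
  then show "nu M < t\<^sup>2 \<and> (\<forall>y\<in>#M. snd y \<in> slice n)" using sl by simp
qed

lemma low_D: "low n c x \<Longrightarrow> low n c (D x)"
  unfolding low_def by (erule sup_in_D) (auto simp: gD_def split: prod.splits)

lemma low_Dpow: "low n c x \<Longrightarrow> low n c ((D ^^ m) x)"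
  by (induction m) (auto intro: low_D)

text \<open>The slice variable that is the leading term of D^m w_t; symbols and generators list
  index and derivative order in opposite positions.\<close>

definition jm :: "nat \<times> nat \<Rightarrow> gen" where "jm x = (case x of (t, m) \<Rightarrow> (m, (t, 1)))"

definition dw :: "nat \<Rightarrow> nat \<times> nat \<Rightarrow> supalg" where
  "dw n x = (case x of (t, m) \<Rightarrow> (D ^^ m) (wv n t))"

lemma kill_dw:
  assumes "fst x \<in> Tset n"
  shows "low n ((fst x)\<^sup>2) (kill (slice n) (dw n x) - sc (kap n (fst x)) (gen (jm x)))"
proof -
  obtain t m where x: "x = (t, m)" by (cases x)
  have "(D ^^ m) (kill (slice n) (wv n t) - sc (kap n t) (gen (ag t))) = kill (slice n) (dw n x) - sc (kap n (fst x)) (gen (jm x))"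
    by (simp add: x dw_def kill_Dpow jm_def ag_def Dpow_gen)
  then show ?thesis using low_Dpow[OF kill_wv, of t n m] assms by (simp add: x)
qed

text \<open>Non-strict companion of \<open>low\<close>: a product is \<open>low\<close> as soon as
  one factor is \<open>low\<close> and the other is \<open>lows\<close>.\<close>

definition lows :: "nat \<Rightarrow> nat \<Rightarrow> supalg \<Rightarrow> bool" where
  "lows n c = sup_in (\<lambda>M. nu M \<le> c \<and> (\<forall>y\<in>#M. snd y \<in> slice n))"

lemma kill_dw_list:
  assumes "\<forall>x\<in>set xs. fst x \<in> Tset n"
  shows "low n (nu (mset (map jm xs)))
    (prod_list (map (\<lambda>x. kill (slice n) (dw n x)) xs) - sc (\<Prod>x\<leftarrow>xs. kap n (fst x)) (L (map jm xs)))"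
  using assms
proof (induction xs)
  case Nil
  show ?case by (simp add: low_def)
next
  case (Cons x xs)
  let ?a = "sc (kap n (fst x)) (gen (jm x))" and ?b = "sc (\<Prod>x\<leftarrow>xs. kap n (fst x)) (L (map jm xs))"
  let ?r = "kill (slice n) (dw n x) - ?a"
  let ?P = "prod_list (map (\<lambda>x. kill (slice n) (dw n x)) xs)"
  have f: "fst (snd (jm x)) = fst x" for x by (cases x) (simp add: jm_def)
  have sl: "snd (jm y) \<in> slice n" if "fst y \<in> Tset n" for y
    using that by (cases y) (auto simp: jm_def slice_def)
  have x: "fst x \<in> Tset n" using Cons.prems by simp
  have r: "low n ((fst x)\<^sup>2) ?r" by (rule kill_dw[OF x])
  have IH: "low n (nu (mset (map jm xs))) (?P - ?b)" using Cons by simp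
  have a: "lows n ((fst x)\<^sup>2) ?a"
    unfolding lows_def by (intro sup_in_sc sup_in_gen) (simp add: f sl[OF x])
  have b: "lows n (nu (mset (map jm xs))) ?b"
    unfolding lows_def using Cons.prems sl by (intro sup_in_sc sup_in_L) auto
  have rs: "lows n ((fst x)\<^sup>2) ?r" using r unfolding low_def lows_def by (rule sup_in_mono) auto
  have m1: "low n (c + d) (u * v)" if "lows n c u" "low n d v" for c d u v
    using that unfolding low_def lows_def by (rule sup_in_mult) (auto intro: add_le_less_mono)
  have m2: "low n (c + d) (u * v)" if "low n c u" "lows n d v" for c d u v
    using that unfolding low_def lows_def by (rule sup_in_mult) (auto intro: add_less_le_mono)
  have "low n ((fst x)\<^sup>2 + nu (mset (map jm xs))) (?a * (?P - ?b) + (?r * (?P - ?b) + ?r * ?b))"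
    using m1[OF a IH] m1[OF rs IH] m2[OF r b] unfolding low_def by (intro sup_in_add)
  moreover have "?a * (?P - ?b) + (?r * (?P - ?b) + ?r * ?b) = kill (slice n) (dw n x) * ?P - ?a * ?b"
    by (simp only: right_diff_distrib left_diff_distrib) (simp add: algebra_simps)
  ultimately show ?case by (simp add: L_Cons f mult.commute)
qed

lemma kap_nonzero: "t \<in> Tset n \<Longrightarrow> kap n t \<noteq> 0"
  unfolding kap_def wv_def by (rule linear_coefficient)

definition E :: "nat \<Rightarrow> (nat \<times> nat) multiset \<Rightarrow> supalg" where
  "E n M = prod_list (map (dw n) (sorted_list_of_multiset M))"

text \<open>\<open>jm\<close> does not preserve the order of generators, so sorting the leading word
  costs a sign, which is absorbed in the constant.\<close>

lemma kill_E:
  assumes "\<forall>x\<in>#M. fst x \<in> Tset n"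
  shows "\<exists>c. c \<noteq> 0 \<and> low n (nu (image_mset jm M)) (kill (slice n) (E n M) - sc c (mon (image_mset jm M)))"
proof -
  let ?xs = "sorted_list_of_multiset M"
  have m: "mset (map jm ?xs) = image_mset jm M" by simp
  obtain d where d: "d = 1 \<or> d = -1" "L (map jm ?xs) = sc d (mon (image_mset jm M))"
    using L_mon[of "map jm ?xs"] unfolding m by blast
  have "(\<Prod>x\<leftarrow>?xs. kap n (fst x)) \<noteq> 0"
    using assms kap_nonzero by (auto simp: prod_list_zero_iff)
  moreover have "low n (nu (image_mset jm M)) (kill (slice n) (E n M) - sc ((\<Prod>x\<leftarrow>?xs. kap n (fst x)) * d) (mon (image_mset jm M)))"
    using kill_dw_list[of ?xs n] assms unfolding m d(2) by (simp add: E_def kill_prod_list o_def)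
  ultimately show ?thesis using d(1) by (intro exI[of _ "(\<Prod>x\<leftarrow>?xs. kap n (fst x)) * d"]) auto
qed

subsection \<open>Free generation\<close>

definition ev :: "nat \<Rightarrow> (nat \<times> nat) sa \<Rightarrow> supalg" where
  "ev n \<phi> = (\<Sum>M\<in>sa_supp \<phi>. sc (\<phi> M) (E n M))"

lemma wgen_wv: "wgen n t = cf (wv n t)"
  by (simp add: wgen_cf wv_def)

lemma evalW_cf: "evalW n \<phi> = cf (ev n \<phi>)"
proof
  fix N
  have "map (\<lambda>(t, m). (VD ^^ m) (wgen n t)) zs = map cf (map (dw n) zs)" for zs
    by (auto simp: wgen_wv VD_pow_cf dw_def)
  then have "sa_listprod gpar (map (\<lambda>(t, m). (VD ^^ m) (wgen n t)) (sorted_list_of_multiset M)) = cf (E n M)" for M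
    by (simp only: cf_listprod E_def)
  then show "evalW n \<phi> N = cf (ev n \<phi>) N" by (simp add: evalW_def ev_def)
qed

lemma FreeW_finite: "\<phi> \<in> FreeW n \<Longrightarrow> finite (sa_supp \<phi>)"
  by (simp add: FreeW_def sa_carrier_def sa_supp_def)

lemma FreeW_supp: "\<phi> \<in> FreeW n \<Longrightarrow> M \<in> sa_supp \<phi> \<Longrightarrow> valid_mono spar M \<and> (\<forall>x\<in>#M. fst x \<in> Tset n)"
  by (simp add: FreeW_def sa_carrier_def sa_supp_def)

lemma ev_superset:
  assumes "finite S" "sa_supp \<phi> \<subseteq> S" shows "ev n \<phi> = (\<Sum>M\<in>S. sc (\<phi> M) (E n M))"
  unfolding ev_def using assms by (intro sum.mono_neutral_left) (auto simp: sa_supp_def)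

lemma inW_ev: "n \<ge> 1 \<Longrightarrow> inW n (ev n \<phi>)"
  unfolding ev_def E_def
  by (intro inW_sum inW_sc inW_prod_list) (auto simp: dw_def wv_def intro!: inW_Dpow inW_rd)

lemma gpar_jm: "fst x \<in> Tset n \<Longrightarrow> gpar (jm x) = spar x"
  by (cases x) (auto simp: jm_def gpar_def spar_def bpar_def pp_def)

lemma image_jm_inj:
  assumes "image_mset jm M = image_mset jm N" shows "M = N"
proof -
  have "image_mset (\<lambda>y. (fst (snd y), fst y)) (image_mset jm M) = M" for M
    by (simp add: multiset.map_comp o_def jm_def split_beta)
  then show ?thesis using assms by metis
qed

lemma count_image_jm: "count (image_mset jm M) (jm x) = count M x"
  by (induction M) (auto simp: jm_def split_beta prod_eq_iff)

lemma valid_jm: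
  assumes "\<forall>x\<in>#M. fst x \<in> Tset n"
  shows "valid_mono gpar (image_mset jm M) \<longleftrightarrow> valid_mono spar M"
proof -
  have c: "count (image_mset jm M) (jm x) = count M x" for x
    by (rule count_image_jm)
  show ?thesis
  proof
    assume v: "valid_mono gpar (image_mset jm M)"
    show "valid_mono spar M"
      unfolding valid_mono_def
    proof (intro allI impI)
      fix x assume "spar x"
      show "count M x \<le> 1"
      proof (cases "x \<in># M")
        case True
        then have "gpar (jm x)" using gpar_jm assms \<open>spar x\<close> by blast
        then have "count (image_mset jm M) (jm x) \<le> 1" using v unfolding valid_mono_def by blast
        then show ?thesis unfolding c .
      qed (simp add: not_in_iff)
    qed
  next
    assume v: "valid_mono spar M"
    show "valid_mono gpar (image_mset jm M)"
      unfolding valid_mono_def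
    proof (intro allI impI)
      fix y assume "gpar y"
      show "count (image_mset jm M) y \<le> 1"
      proof (cases "y \<in># image_mset jm M")
        case True
        then obtain x where x: "x \<in># M" "y = jm x" by auto
        then have "spar x" using gpar_jm assms \<open>gpar y\<close> by blast
        then have "count M x \<le> 1" using v unfolding valid_mono_def by blast
        then show ?thesis unfolding x(2) c .
      next
        case False
        then have "count (image_mset jm M) y = 0" by (simp only: count_eq_zero_iff not_False_eq_True)
        then show ?thesis by simp
      qed
    qed
  qed
qed

text \<open>In a vanishing combination, the leading monomial of a term with largest
  \<open>nu\<close> cannot be cancelled: leading monomials of distinct terms are distinct, and the
  lower parts have smaller \<open>nu\<close>.\<close>

lemma evalW_inj: "inj_on (evalW n) (FreeW n)"
proof (rule inj_onI, rule ccontr)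
  fix \<phi> \<phi>' assume f: "\<phi> \<in> FreeW n" "\<phi>' \<in> FreeW n" and e: "evalW n \<phi> = evalW n \<phi>'" and ne: "\<phi> \<noteq> \<phi>'"
  define S where "S = sa_supp \<phi> \<union> sa_supp \<phi>'"
  define d where "d M = \<phi> M - \<phi>' M" for M
  have S: "finite S" unfolding S_def using f FreeW_finite by blast
  have S_props: "valid_mono spar M" "\<forall>x\<in>#M. fst x \<in> Tset n" if "M \<in> S" for M
    using that f FreeW_supp unfolding S_def by blast+
  have "ev n \<phi> = ev n \<phi>'" using e unfolding evalW_cf cf_inject .
  moreover have "ev n \<phi> = (\<Sum>M\<in>S. sc (\<phi> M) (E n M))" "ev n \<phi>' = (\<Sum>M\<in>S. sc (\<phi>' M) (E n M))"
    by (rule ev_superset[OF S], simp add: S_def)+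
  ultimately have z: "(\<Sum>M\<in>S. sc (d M) (E n M)) = 0"
    by (simp add: d_def sc_diff_left sum_subtractf)
  define S' where "S' = {M \<in> S. d M \<noteq> 0}"
  have "S' \<noteq> {}"
  proof -
    obtain M where "\<phi> M \<noteq> \<phi>' M" using ne by blast
    then have "M \<in> S'" by (auto simp: S'_def S_def d_def sa_supp_def)
    then show ?thesis by blast
  qed
  let ?n = "\<lambda>M. nu (image_mset jm M)"
  have fS': "finite S'" using S by (simp add: S'_def)
  obtain M where M: "M \<in> S'" and Mmax: "\<And>N. N \<in> S' \<Longrightarrow> ?n N \<le> ?n M"
  proof -
    have "Max (?n ` S') \<in> ?n ` S'" using fS' \<open>S' \<noteq> {}\<close> by (intro Max_in) auto
    then obtain M where "M \<in> S'" "?n M = Max (?n ` S')" by force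
    then show ?thesis using that[of M] fS' by simp
  qed
  have MS: "M \<in> S" "d M \<noteq> 0" using M by (auto simp: S'_def)
  let ?Q = "image_mset jm M"
  have c: "cf (sc (d N) (kill (slice n) (E n N))) ?Q \<noteq> 0 \<longleftrightarrow> N = M" if N: "N \<in> S" for N
  proof (cases "d N = 0")
    case True
    then show ?thesis using MS by auto
  next
    case False
    then have "N \<in> S'" using N by (simp add: S'_def)
    then have le: "?n N \<le> ?n M" by (rule Mmax)
    obtain k where k: "k \<noteq> 0" "low n (?n N) (kill (slice n) (E n N) - sc k (mon (image_mset jm N)))"
      using kill_E[OF S_props(2)[OF N]] by blast
    have "cf (kill (slice n) (E n N) - sc k (mon (image_mset jm N))) ?Q = 0"
      by (rule sup_inD[OF k(2)[unfolded low_def]]) (use le in auto)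
    then have "cf (kill (slice n) (E n N)) ?Q = (if N = M then k else 0)"
      using image_jm_inj[of M N] valid_jm[OF S_props(2)[OF MS(1)]] S_props(1)[OF MS(1)]
      by (auto simp: cf_mon)
    then show ?thesis using False k(1) by simp
  qed
  have "(\<Sum>N\<in>S. cf (sc (d N) (kill (slice n) (E n N))) ?Q) = 0"
    using arg_cong[OF z, of "\<lambda>x. cf (kill (slice n) x) ?Q"] unfolding kill_sum kill_sc cf_sum by simp
  moreover have "(\<Sum>N\<in>S. cf (sc (d N) (kill (slice n) (E n N))) ?Q) = (\<Sum>N\<in>{M}. cf (sc (d N) (kill (slice n) (E n N))) ?Q)"
    using S MS c by (intro sum.mono_neutral_right) auto
  ultimately show False using c[OF MS(1)] by simp
qed

lemma sa_supp_single: "sa_supp (\<lambda>N. if N = M then 1 else 0) = {M}"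
  by (auto simp: sa_supp_def)

text \<open>Induction on \<open>nu\<close>: the restricted polynomial with leading monomial
  \<open>Q\<close> differs from a multiple of \<open>Q\<close> only by monomials of smaller
  \<open>nu\<close>.\<close>

lemma slice_surj:
  assumes "inV (slice n) x"
  shows "\<exists>\<phi>\<in>FreeW n. kill (slice n) (ev n \<phi>) = x"
proof -
  define R where "R x \<longleftrightarrow> (\<exists>\<phi>\<in>FreeW n. kill (slice n) (ev n \<phi>) = x)" for x
  have R0: "R 0"
    unfolding R_def by (rule bexI[of _ "\<lambda>_. 0"]) (simp_all add: ev_def sa_supp_def FreeW_def)
  have Radd: "R (x + y)" if xy: "R x" "R y" for x y
  proof -
    obtain \<phi> \<phi>' where p: "\<phi> \<in> FreeW n" "kill (slice n) (ev n \<phi>) = x" "\<phi>' \<in> FreeW n" "kill (slice n) (ev n \<phi>') = y"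
      using xy unfolding R_def by blast
    let ?f = "\<lambda>M. \<phi> M + \<phi>' M"
    have F: "?f \<in> FreeW n"
      using p(1,3) sa_add_carrier[of \<phi> spar \<phi>'] unfolding FreeW_def mem_Collect_eq by (metis add.right_neutral)
    let ?S = "sa_supp \<phi> \<union> sa_supp \<phi>'"
    have S: "finite ?S" using p FreeW_finite by blast
    have s: "sa_supp ?f \<subseteq> ?S" by (auto simp: sa_supp_def)
    have "ev n ?f = ev n \<phi> + ev n \<phi>'"
      unfolding ev_superset[OF S s] ev_superset[OF S Un_upper1] ev_superset[OF S Un_upper2]
      by (simp add: sc_add_left sum.distrib)
    then show ?thesis using F p unfolding R_def by (intro bexI[of _ ?f]) auto
  qed
  have Rsc: "R (sc c x)" if x: "R x" for c x
  proof -
    obtain \<phi> where p: "\<phi> \<in> FreeW n" "kill (slice n) (ev n \<phi>) = x" using x unfolding R_def by blast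
    let ?f = "\<lambda>M. c * \<phi> M"
    have s: "sa_supp ?f \<subseteq> sa_supp \<phi>" by (auto simp: sa_supp_def)
    have F: "?f \<in> FreeW n"
      using p(1) finite_subset[OF s FreeW_finite[OF p(1)]] by (auto simp: FreeW_def sa_carrier_def sa_supp_def)
    have "ev n ?f = sc c (ev n \<phi>)"
      unfolding ev_superset[OF FreeW_finite[OF p(1)] s] ev_def by (simp add: sc_sum)
    then show ?thesis using F p unfolding R_def by (intro bexI[of _ ?f]) auto
  qed
  have RE: "R (kill (slice n) (E n M))" if M: "valid_mono spar M" "\<forall>x\<in>#M. fst x \<in> Tset n" for M
  proof -
    let ?f = "\<lambda>N. if N = M then 1 else 0 :: complex"
    have "?f \<in> FreeW n" using M by (auto simp: FreeW_def sa_carrier_def)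
    moreover have "ev n ?f = E n M" by (simp add: ev_def sa_supp_single)
    ultimately show ?thesis unfolding R_def by (intro bexI[of _ ?f]) auto
  qed
  have Rmon: "R (mon Q)" if "\<forall>y\<in>#Q. snd y \<in> slice n" for Q
    using that
  proof (induction "nu Q" arbitrary: Q rule: less_induct)
    case less
    show ?case
    proof (cases "valid_mono gpar Q")
      case False
      then show ?thesis using R0 by (simp add: mon_invalid)
    next
      case True
      define M where "M = image_mset (\<lambda>y. (fst (snd y), fst y)) Q"
      have "jm (fst (snd y), fst y) = y" if "y \<in># Q" for y
        using less.prems that by (cases y) (auto simp: jm_def slice_def)
      then have Q: "image_mset jm M = Q"
        using image_mset_cong[of Q "\<lambda>y. jm (fst (snd y), fst y)" "\<lambda>y. y"]
        by (simp add: M_def multiset.map_comp o_def)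
      have M: "\<forall>x\<in>#M. fst x \<in> Tset n" using less.prems by (auto simp: M_def slice_def)
      then have v: "valid_mono spar M" using valid_jm[OF M] True by (simp add: Q)
      obtain c where c: "c \<noteq> 0" "low n (nu Q) (kill (slice n) (E n M) - sc c (mon Q))"
        using kill_E[OF M] unfolding Q by blast
      have "R (kill (slice n) (E n M) - sc c (mon Q))"
        using c(2) unfolding low_def
        by (rule sup_in_span) (auto intro: R0 Radd Rsc less.hyps)
      from Radd[OF RE[OF v M] Rsc[OF this, of "-1"]]
      have "R (sc c (mon Q))" by (simp add: sc_minus)
      from Rsc[OF this, of "inverse c"] show ?thesis using c(1) by simp
    qed
  qed
  have "R x"
    using assms unfolding inV_def by (rule sup_in_span) (auto intro: R0 Radd Rsc Rmon)
  then show ?thesis by (simp add: R_def)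
qed

theorem mainTheorem10:
  fixes n :: nat
  assumes "n \<ge> 1"
  shows "(\<forall>t\<in>{1..NN n}. wgen n t \<in> Walg n) \<and> freely_generates n"
proof
  show "\<forall>t\<in>{1..NN n}. wgen n t \<in> Walg n"
    using Walg_iff[OF assms] inW_rd[OF assms] by (simp add: wgen_cf)
  have "evalW n ` FreeW n = Walg n"
  proof
    show "evalW n ` FreeW n \<subseteq> Walg n"
      using Walg_iff[OF assms] inW_ev[OF assms] by (auto simp: evalW_cf)
    show "Walg n \<subseteq> evalW n ` FreeW n"
    proof
      fix w assume w: "w \<in> Walg n"
      then obtain x where x: "w = cf x" using Walg_cf by blast
      then have W: "inW n x" using w Walg_iff[OF assms] by simp
      have "inV (slice n) (kill (slice n) x)"
        by (auto simp: inV_def sup_in_def cf_kill)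
      then obtain \<phi> where p: "\<phi> \<in> FreeW n" "kill (slice n) (ev n \<phi>) = kill (slice n) x"
        using slice_surj by blast
      have "ev n \<phi> - x = 0"
        using p(2) by (intro kill_slice_inj[OF inW_diff[OF inW_ev[OF assms] W]]) simp
      then show "w \<in> evalW n ` FreeW n" using p(1) x by (auto simp: evalW_cf)
    qed
  qed
  then show "freely_generates n"
    using evalW_inj by (simp add: freely_generates_def)
qed

end
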